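(* Let $k_1,k_2\in\mathbb{Z}$ and let $m\in\mathbb{R}$, $m\ge -1$. Then for a nonzero radial T-function $\varphi(r)$ on $D$, the commutator $[T_{e^{ik_1\theta}r^m},T_{e^{ik_2\theta}\varphi}]$ has finite rank on the Bergman space $L_a^2$ if and only if one of the following conditions holds (where $C$ denotes some constant): (1) $k_1=m=0$. (2) $k_2=0$ and $\varphi=C$. (3) $k_1=k_2=0$. (4) $k_1k_2>0$, $|k_2|<m+|k_1|+2$ and $\widehat{\varphi}(z)=C\,\frac{\Gamma\left(\frac{z+|k_2|}{2|k_1|}\right)\Gamma\left(\frac{z+m+|k_1|-|k_2|}{2|k_1|}\right)}{\Gamma\left(\frac{z+2|k_1|-|k_2|}{2|k_1|}\right)\Gamma\left(\frac{z+m+|k_1|+|k_2|}{2|k_1|}\right)}$. (5) $k_1k_2>0$, $|k_2|\ge m+|k_1|+2$, $m=(2n+1)|k_1|$ for some $n\in\mathbb{N}$ and $$\widehat{\varphi}(z)=C\,\frac{\left(\frac{z-|k_2|}{2|k_1|}+1\right)\left(\frac{z-|k_2|}{2|k_1|}+2\right)\cdots\left(\frac{z-|k_2|}{2|k_1|}+n\right)}{\frac{z+|k_2|}{2|k_1|}\left(\frac{z+|k_2|}{2|k_1|}+1\right)\cdots\left(\frac{z+|k_2|}{2|k_1|}+n\right)}.$$ (6) $k_1k_2<0$, $|k_2|\ge 2$, $m+|k_1|=0$ and $\varphi(r)=Cr^{|k_2|}$. (7) $k_1k_2<0$, $|k_2|=1$ and $\widehat{\varphi}(z)=C\,\frac{\Gamma\left(\frac{z-1}{2|k_1|}\right)\Gamma\left(\frac{z+m+|k_1|+1}{2|k_1|}\right)}{\Gamma\left(\frac{z+2|k_1|+1}{2|k_1|}\right)\Gamma\left(\frac{z+m+|k_1|-1}{2|k_1|}\right)}$.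 In each of the conditions (1)-(5), $\mathrm{rank}\left([T_{e^{ik_1\theta}r^m},T_{e^{ik_2\theta}\varphi}]\right)=0$. In each of the conditions (6)-(7), $$\mathrm{Ran}\left([T_{e^{ik_1\theta}r^m},T_{e^{ik_2\theta}\varphi}]\right)=\mathrm{span}\left\{z^{\max\{k_1,k_2\}-1}\right\}$$ and, for some constant $C'$, $$[T_{e^{ik_1\theta}r^m},T_{e^{ik_2\theta}\varphi}]=C'\, z^{\max\{k_1,k_2\}-1}\otimes z^{\max\{-k_1,-k_2\}-1};$$ therefore $\mathrm{rank}\left([T_{e^{ik_1\theta}r^m},T_{e^{ik_2\theta}\varphi}]\right)=1$.
   Context: $D$ is the open unit disk in $\mathbb{C}$ and $dA$ is Lebesgue area measure on $D$ normalized so that $D$ has measure $1$. $L_a^2$ is the Bergman space of analytic functions in $L^2(D,dA)$, and $P$ is the Bergman projection $Pf(z)=\int_D\frac{f(w)}{(1-z\bar w)^2}\,dA(w)$, which extends to $L^1(D,dA)$ by this formula. $L_h^2=L_a^2+\overline{L_a^2}$ is the harmonic Bergman space of harmonic functions in $L^2(D,dA)$, with orthogonal projection $Q$ given by $Qf(z)=\int_D\left(\frac{1}{(1-z\bar w)^2}+\frac{1}{(1-\bar z w)^2}-1\right)f(w)\,dA(w)$. A function $u\in L^1(D,dA)$ is a T-function if $h\mapsto Q(uh)$, densely defined on harmonic polynomials, is bounded in the $L_h^2$ norm. (Every $u\in L^1(D,dA)$ essentially bounded on some annulus $r_0<|z|<1$ is a T-function.) On $L_a^2$ the Toeplitz operator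 $T_u$ with T-function symbol $u$ is the bounded operator extending $h\mapsto P(uh)$ from the analytic polynomials. Points of $D$ are written $re^{i\theta}$; a radial T-function is a T-function depending only on $r$, and for $k\in\mathbb{Z}$, $e^{ik\theta}\varphi(r)$ is a T-function iff $\varphi$ is. $[A,B]=AB-BA$. A bounded operator $A$ on a Hilbert space has finite rank if the closure of its range $\mathrm{Ran}(A)$ is finite dimensional, and $\mathrm{rank}(A)=\dim\mathrm{Ran}(A)$ (rank $0$ is allowed). $(\phi\otimes\psi)h=\langle h,\psi\rangle\phi$. The Mellin transform of a radial $\varphi\in L^1([0,1],r\,dr)$ is $\widehat{\varphi}(z)=\int_0^1\varphi(r)r^{z-1}\,dr$, defined for $\mathrm{Re}\,z\ge 2$; formulas for $\widehat\varphi(z)$ are understood there. $\mathbb{N}=\{0,1,2,\dots\}$; an empty product equals $1$. *)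

theory Defs
  imports "HOL-Complex_Analysis.Complex_Analysis" "HOL-Library.Function_Algebras"
    "HOL-Library.Extended_Nat"
begin

section \<open>Complex-valued functions as a complex vector space\<close>

definition fscale :: "complex \<Rightarrow> (complex \<Rightarrow> complex) \<Rightarrow> complex \<Rightarrow> complex" where
  "fscale c f = (\<lambda>z. c * f z)"

global_interpretation cfun: vector_space fscale
  defines fspan = cfun.span and fdim = cfun.dim
  by unfold_locales (auto simp: fscale_def fun_eq_iff algebra_simps)


section \<open>The Bergman space of the unit disk\<close>

abbreviation disk :: "complex set" where
  "disk \<equiv> ball 0 1"

definition dA :: "complex measure" where
  "dA = scale_measure (ennreal (1 / pi)) (lebesgue_on disk)"

definition square_integrable :: "(complex \<Rightarrow> complex) \<Rightarrow> bool" where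
  "square_integrable f \<longleftrightarrow>
     f \<in> borel_measurable dA \<and> integrable dA (\<lambda>z. (cmod (f z))\<^sup>2)"

definition L2_inner :: "(complex \<Rightarrow> complex) \<Rightarrow> (complex \<Rightarrow> complex) \<Rightarrow> complex" where
  "L2_inner f g = (LINT z|dA. f z * cnj (g z))"

definition L2_norm :: "(complex \<Rightarrow> complex) \<Rightarrow> real" where
  "L2_norm f = sqrt (LINT z|dA. (cmod (f z))\<^sup>2)"

text \<open>Functions on the disk are represented by total functions vanishing off the disk, so that
  equality of elements of the Bergman space is equality of functions.\<close>

definition on_disk :: "(complex \<Rightarrow> complex) \<Rightarrow> complex \<Rightarrow> complex" where
  "on_disk f = (\<lambda>z. if z \<in> disk then f z else 0)"

definition bergman_space :: "(complex \<Rightarrow> complex) set" where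
  "bergman_space =
     {f. f holomorphic_on disk \<and> square_integrable f \<and> (\<forall>z. z \<notin> disk \<longrightarrow> f z = 0)}"

definition harmonic_bergman_space :: "(complex \<Rightarrow> complex) set" where
  "harmonic_bergman_space =
     {\<lambda>z. f z + cnj (g z) | f g. f \<in> bergman_space \<and> g \<in> bergman_space}"

definition bergman_proj :: "(complex \<Rightarrow> complex) \<Rightarrow> complex \<Rightarrow> complex" where
  "bergman_proj f = on_disk (\<lambda>z. LINT w|dA. f w / (1 - z * cnj w)\<^sup>2)"

definition harmonic_proj :: "(complex \<Rightarrow> complex) \<Rightarrow> complex \<Rightarrow> complex" where
  "harmonic_proj f = on_disk (\<lambda>z. LINT w|dA.
     (1 / (1 - z * cnj w)\<^sup>2 + 1 / (1 - cnj z * w)\<^sup>2 - 1) * f w)"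


section \<open>Operators on the Bergman space\<close>

definition bounded_operator :: "((complex \<Rightarrow> complex) \<Rightarrow> complex \<Rightarrow> complex) \<Rightarrow> bool" where
  "bounded_operator T \<longleftrightarrow>
     T \<in> bergman_space \<rightarrow>\<^sub>E bergman_space \<and>
     (\<forall>f\<in>bergman_space. \<forall>g\<in>bergman_space. T (f + g) = T f + T g) \<and>
     (\<forall>c. \<forall>f\<in>bergman_space. T (fscale c f) = fscale c (T f)) \<and>
     (\<exists>K. \<forall>f\<in>bergman_space. L2_norm (T f) \<le> K * L2_norm f)"

definition commutator ::
  "((complex \<Rightarrow> complex) \<Rightarrow> complex \<Rightarrow> complex) \<Rightarrow> ((complex \<Rightarrow> complex) \<Rightarrow> complex \<Rightarrow> complex)
     \<Rightarrow> (complex \<Rightarrow> complex) \<Rightarrow> complex \<Rightarrow> complex" where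
  "commutator A B = (\<lambda>f\<in>bergman_space. A (B f) - B (A f))"

definition op_scale ::
  "complex \<Rightarrow> ((complex \<Rightarrow> complex) \<Rightarrow> complex \<Rightarrow> complex) \<Rightarrow> (complex \<Rightarrow> complex) \<Rightarrow> complex \<Rightarrow> complex"
  where
  "op_scale c T = (\<lambda>f\<in>bergman_space. fscale c (T f))"

definition rank_one ::
  "(complex \<Rightarrow> complex) \<Rightarrow> (complex \<Rightarrow> complex) \<Rightarrow> (complex \<Rightarrow> complex) \<Rightarrow> complex \<Rightarrow> complex" where
  "rank_one f g = (\<lambda>h\<in>bergman_space. fscale (L2_inner h g) f)"

definition Ran :: "((complex \<Rightarrow> complex) \<Rightarrow> complex \<Rightarrow> complex) \<Rightarrow> (complex \<Rightarrow> complex) set" where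
  "Ran T = T ` bergman_space"

definition bergman_closure :: "(complex \<Rightarrow> complex) set \<Rightarrow> (complex \<Rightarrow> complex) set" where
  "bergman_closure S = {f \<in> bergman_space. \<forall>e>0. \<exists>g\<in>S. L2_norm (f - g) < e}"

definition finite_dimensional :: "(complex \<Rightarrow> complex) set \<Rightarrow> bool" where
  "finite_dimensional V \<longleftrightarrow> (\<exists>B. finite B \<and> V \<subseteq> fspan B)"

definition finite_rank :: "((complex \<Rightarrow> complex) \<Rightarrow> complex \<Rightarrow> complex) \<Rightarrow> bool" where
  "finite_rank T \<longleftrightarrow> finite_dimensional (bergman_closure (Ran T))"

text \<open>The library dimension of an infinite-dimensional space is \<open>0\<close>, hence the case split.\<close>

definition op_rank :: "((complex \<Rightarrow> complex) \<Rightarrow> complex \<Rightarrow> complex) \<Rightarrow> enat" where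
  "op_rank T = (if finite_dimensional (Ran T) then enat (fdim (Ran T)) else \<infinity>)"


section \<open>T-functions and Toeplitz operators\<close>

definition harmonic_polynomials :: "(complex \<Rightarrow> complex) set" where
  "harmonic_polynomials = {\<lambda>z. poly p z + cnj (poly q z) | p q. True}"

definition T_function :: "(complex \<Rightarrow> complex) \<Rightarrow> bool" where
  "T_function u \<longleftrightarrow> integrable dA u \<and>
     (\<exists>K. \<forall>h\<in>harmonic_polynomials.
        harmonic_proj (\<lambda>w. u w * h w) \<in> harmonic_bergman_space \<and>
        L2_norm (harmonic_proj (\<lambda>w. u w * h w)) \<le> K * L2_norm h)"

text \<open>A bounded operator is determined by its values on the polynomials, which are dense in the
  Bergman space; for a T-function \<open>u\<close> an operator with the described property exists.\<close>

definition toeplitz ::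
  "(complex \<Rightarrow> complex) \<Rightarrow> (complex \<Rightarrow> complex) \<Rightarrow> complex \<Rightarrow> complex" where
  "toeplitz u = (THE T. bounded_operator T \<and>
     (\<forall>p :: complex poly. T (on_disk (poly p)) = bergman_proj (\<lambda>w. u w * poly p w)))"

definition quasihomogeneous :: "int \<Rightarrow> (real \<Rightarrow> complex) \<Rightarrow> complex \<Rightarrow> complex" where
  "quasihomogeneous k \<phi> = (\<lambda>z. cis (of_int k * Arg z) * \<phi> (cmod z))"

definition toeplitz_commutator ::
  "int \<Rightarrow> real \<Rightarrow> int \<Rightarrow> (real \<Rightarrow> complex) \<Rightarrow> (complex \<Rightarrow> complex) \<Rightarrow> complex \<Rightarrow> complex" where
  "toeplitz_commutator k1 m k2 \<phi> =
     commutator (toeplitz (quasihomogeneous k1 (\<lambda>r. of_real (r powr m))))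
                (toeplitz (quasihomogeneous k2 \<phi>))"

text \<open>Only used for exponents \<open>k \<ge> 0\<close>.\<close>

definition monomial :: "int \<Rightarrow> complex \<Rightarrow> complex" where
  "monomial k = on_disk (\<lambda>z. z powi k)"

definition mellin :: "(real \<Rightarrow> complex) \<Rightarrow> complex \<Rightarrow> complex" where
  "mellin \<phi> z = (LINT r|lebesgue_on {0..1}. \<phi> r * of_real r powr (z - 1))"


section \<open>The seven conditions\<close>

text \<open>A radial symbol is an element of \<open>L\<^sup>1\<close>, so equations between radial symbols hold almost
  everywhere. In the quotients of Gamma values, the arguments in the numerators have positive real
  part for \<open>Re z \<ge> 2\<close>; an argument in a denominator may be a pole of \<open>Gamma\<close>, where the
  library conventions \<open>Gamma = 0\<close> and \<open>x / 0 = 0\<close> yield the intended value \<open>0\<close> of the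
  entire function \<open>1 / Gamma\<close>.\<close>

definition cond1 :: "int \<Rightarrow> real \<Rightarrow> int \<Rightarrow> (real \<Rightarrow> complex) \<Rightarrow> bool" where
  "cond1 k1 m k2 \<phi> \<longleftrightarrow> k1 = 0 \<and> m = 0"

definition cond2 :: "int \<Rightarrow> real \<Rightarrow> int \<Rightarrow> (real \<Rightarrow> complex) \<Rightarrow> bool" where
  "cond2 k1 m k2 \<phi> \<longleftrightarrow> k2 = 0 \<and> (\<exists>C. AE r in lebesgue_on {0..1}. \<phi> r = C)"

definition cond3 :: "int \<Rightarrow> real \<Rightarrow> int \<Rightarrow> (real \<Rightarrow> complex) \<Rightarrow> bool" where
  "cond3 k1 m k2 \<phi> \<longleftrightarrow> k1 = 0 \<and> k2 = 0"

definition cond4 :: "int \<Rightarrow> real \<Rightarrow> int \<Rightarrow> (real \<Rightarrow> complex) \<Rightarrow> bool" where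
  "cond4 k1 m k2 \<phi> \<longleftrightarrow> k1 * k2 > 0 \<and> of_int \<bar>k2\<bar> < m + of_int \<bar>k1\<bar> + 2 \<and>
     (\<exists>C. \<forall>z. Re z \<ge> 2 \<longrightarrow> mellin \<phi> z = C *
        (Gamma ((z + of_int \<bar>k2\<bar>) / (2 * of_int \<bar>k1\<bar>)) *
         Gamma ((z + of_real m + of_int \<bar>k1\<bar> - of_int \<bar>k2\<bar>) / (2 * of_int \<bar>k1\<bar>))) /
        (Gamma ((z + 2 * of_int \<bar>k1\<bar> - of_int \<bar>k2\<bar>) / (2 * of_int \<bar>k1\<bar>)) *
         Gamma ((z + of_real m + of_int \<bar>k1\<bar> + of_int \<bar>k2\<bar>) / (2 * of_int \<bar>k1\<bar>))))"

definition cond5 :: "int \<Rightarrow> real \<Rightarrow> int \<Rightarrow> (real \<Rightarrow> complex) \<Rightarrow> bool" where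
  "cond5 k1 m k2 \<phi> \<longleftrightarrow> k1 * k2 > 0 \<and> of_int \<bar>k2\<bar> \<ge> m + of_int \<bar>k1\<bar> + 2 \<and>
     (\<exists>n::nat. m = (2 * of_nat n + 1) * of_int \<bar>k1\<bar> \<and>
       (\<exists>C. \<forall>z. Re z \<ge> 2 \<longrightarrow> mellin \<phi> z = C *
          (\<Prod>j=1..n. (z - of_int \<bar>k2\<bar>) / (2 * of_int \<bar>k1\<bar>) + of_nat j) /
          (\<Prod>j=0..n. (z + of_int \<bar>k2\<bar>) / (2 * of_int \<bar>k1\<bar>) + of_nat j)))"

definition cond6 :: "int \<Rightarrow> real \<Rightarrow> int \<Rightarrow> (real \<Rightarrow> complex) \<Rightarrow> bool" where
  "cond6 k1 m k2 \<phi> \<longleftrightarrow> k1 * k2 < 0 \<and> \<bar>k2\<bar> \<ge> 2 \<and> m + of_int \<bar>k1\<bar> = 0 \<and>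
     (\<exists>C. AE r in lebesgue_on {0..1}. \<phi> r = C * of_real r powi \<bar>k2\<bar>)"

definition cond7 :: "int \<Rightarrow> real \<Rightarrow> int \<Rightarrow> (real \<Rightarrow> complex) \<Rightarrow> bool" where
  "cond7 k1 m k2 \<phi> \<longleftrightarrow> k1 * k2 < 0 \<and> \<bar>k2\<bar> = 1 \<and>
     (\<exists>C. \<forall>z. Re z \<ge> 2 \<longrightarrow> mellin \<phi> z = C *
        (Gamma ((z - 1) / (2 * of_int \<bar>k1\<bar>)) *
         Gamma ((z + of_real m + of_int \<bar>k1\<bar> + 1) / (2 * of_int \<bar>k1\<bar>))) /
        (Gamma ((z + 2 * of_int \<bar>k1\<bar> + 1) / (2 * of_int \<bar>k1\<bar>)) *
         Gamma ((z + of_real m + of_int \<bar>k1\<bar> - 1) / (2 * of_int \<bar>k1\<bar>))))"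

end

(*
  On monomials both Toeplitz operators act as weighted shifts, with weights given by Mellin
  transforms at integers, so the commutator is a weighted shift too and has finite rank iff all but
  finitely many of its weights vanish.  Vanishing of a weight is the functional equation
    (z + s) (z + m + a - s) F(z) = (z + 2a - s) (z + m + a + s) F(z + 2a),
  with a = |k1|, s = sgn(k1) k2 and F the Mellin transform of the symbol, at one point of an
  arithmetic progression.  A quotient of Gamma functions solves this equation and grows at most
  polynomially in a half-plane; a suitable multiple of it agrees with F on an arithmetic
  progression, hence in a half-plane, because the zeros of a bounded function there satisfy the
  Blaschke condition.  As F is bounded for Re z >= 2, the poles of the Gamma quotient in that region
  have to cancel, which separates the cases.  If k1 k2 < 0 the operators annihilate some monomials,
  which leaves one weight not governed by the equation and produces the rank one commutators.
*)
theory Submission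
  imports Defs
begin

section \<open>The area measure in polar form\<close>

text \<open>\<open>toeplitz\<close> is a definite description of a bounded operator, so nothing can
  be computed before existence and uniqueness are settled. Both are obtained on coefficients: the
  Bergman norm becomes a weighted square sum, and a shift is bounded once its weights are. For
  \<phi> this needs s F(s) = O(1) over the integers s >= 2, which comes from testing the T-function
  bound on w^n. A progression of zeros is enough for uniqueness because a zero at s > 0 costs a
  factor of about exp(- c / s), and the sum of 1 / s over the progression diverges. The Gamma
  quotient equals F only far to the right at first. Multiplying by the reciprocals of its numerator
  Gammas gives an identity that survives on all of Re z >= 2. At a pole of a numerator it forces a
  reciprocal Gamma on the other side to vanish, which is an equation on the parameters. With b =
  |k2| the decisive points are z = b when s = - b and b >= 2, and z = b - m - a when s = b >= m + a
  + 2. For k1 k2 < 0 the number of weights outside the equation is min(|k1|, |k2|); conditions (6)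
  and (7) force this minimum to be 1.\<close>

definition disk_borel_measure :: "complex measure" where
  "disk_borel_measure = density lborel (\<lambda>z. ennreal (indicator disk z / pi))"

text \<open>The image of normalized area under \<open>cmod\<close>: a thin annulus has area 2 pi r
  dr, and division by pi leaves the density \<open>2 * r\<close>.\<close>

definition radial_measure :: "real measure" where
  "radial_measure = density lborel (\<lambda>r. ennreal (indicator {0..1} r * (2 * r)))"

lemma disk_in_borel [measurable]: "(disk :: complex set) \<in> sets borel"
  by simp

lemma density_disk_measurable [measurable]:
    "(\<lambda>z. indicat_real disk z / pi) \<in> borel_measurable borel"
  by measurable

lemma sets_disk_borel_measure [simp, measurable_cong]: "sets disk_borel_measure = sets borel"
  by (simp add: disk_borel_measure_def)

lemma sets_radial_measure [simp, measurable_cong]: "sets radial_measure = sets borel"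
  by (simp add: radial_measure_def)

lemma dA_density: "dA = density (lebesgue_on disk) (\<lambda>_. ennreal (1 / pi))"
  by (rule measure_eqI) (auto simp: dA_def emeasure_density_const)

lemma space_dA [simp]: "space dA = disk"
  by (simp add: dA_density)

lemma measurable_dA: "borel_measurable dA = borel_measurable (lebesgue_on disk)"
  by (auto simp: dA_density intro!: measurable_cong_sets)

lemma borel_measurable_dAI: "f \<in> borel_measurable borel \<Longrightarrow> f \<in> borel_measurable dA"
  unfolding measurable_dA
  by (intro measurable_restrict_space1 measurable_completion) auto

text \<open>\<open>dA\<close> lives on Lebesgue sets, whereas rotations and the push-forward under
  \<open>cmod\<close> are treated on Borel sets. This equivalence and the next two lemmas carry
  results over.\<close>

lemma integrable_dA_iff_borel:
  fixes f :: "complex \<Rightarrow> 'a::{banach, second_countable_topology}"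
  assumes "f \<in> borel_measurable borel"
  shows "integrable dA f \<longleftrightarrow> integrable disk_borel_measure f"
proof -
  have "integrable dA f \<longleftrightarrow> integrable (lebesgue_on disk) (\<lambda>z. (1 / pi) *\<^sub>R f z)"
    unfolding dA_density using borel_measurable_dAI[OF assms]
    by (subst integrable_density) (auto simp: measurable_dA)
  also have "\<dots> \<longleftrightarrow> integrable lebesgue (\<lambda>z. (indicator disk z / pi) *\<^sub>R f z)"
    by (subst integrable_restrict_space) (auto simp: algebra_simps)
  also have "\<dots> \<longleftrightarrow> integrable lborel (\<lambda>z. (indicator disk z / pi) *\<^sub>R f z)"
    using assms by (intro integrable_completion) measurable
  also have "\<dots> \<longleftrightarrow> integrable disk_borel_measure f"
    unfolding disk_borel_measure_def using assms by (subst integrable_density) auto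
  finally show ?thesis .
qed

lemma integral_dA_eq_borel:
  fixes f :: "complex \<Rightarrow> 'a::{banach, second_countable_topology}"
  assumes "f \<in> borel_measurable borel"
  shows "(LINT z|dA. f z) = (LINT z|disk_borel_measure. f z)"
proof -
  have "(LINT z|dA. f z) = (LINT z|lebesgue_on disk. (1 / pi) *\<^sub>R f z)"
    unfolding dA_density using borel_measurable_dAI[OF assms]
    by (subst integral_density) (auto simp: measurable_dA)
  also have "\<dots> = (LINT z|lebesgue. (indicator disk z / pi) *\<^sub>R f z)"
    by (subst integral_restrict_space) (auto simp: algebra_simps)
  also have "\<dots> = (LINT z|lborel. (indicator disk z / pi) *\<^sub>R f z)"
    using assms by (intro integral_completion) measurable
  also have "\<dots> = (LINT z|disk_borel_measure. f z)"
    unfolding disk_borel_measure_def using assms by (subst integral_density) auto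
  finally show ?thesis .
qed

lemma AE_dA_of_borel:
  assumes "AE z in disk_borel_measure. P z"
  shows "AE z in dA. P z"
proof -
  have "AE z in lborel. z \<in> disk \<longrightarrow> P z"
    using assms unfolding disk_borel_measure_def
    by (subst (asm) AE_density) (auto elim!: eventually_mono)
  then have "AE z in lebesgue. z \<in> disk \<longrightarrow> P z"
    by (rule AE_completion)
  then have "AE z in lebesgue_on disk. P z"
    by (subst AE_restrict_space_iff) auto
  then show ?thesis
    unfolding dA_density by (subst AE_density) auto
qed

text \<open>The library knows that orthogonal maps preserve Lebesgue measure only on \<^typ>\<open>real^2\<close>; rotation invariance
  on \<^typ>\<open>complex\<close> is transported from there.\<close>

definition of_vec2 :: "real^2 \<Rightarrow> complex" where
  "of_vec2 v = Complex (v $ 1) (v $ 2)"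

definition to_vec2 :: "complex \<Rightarrow> real^2" where
  "to_vec2 z = (\<chi> i. if i = 1 then Re z else Im z)"

lemma of_vec2_to_vec2 [simp]: "of_vec2 (to_vec2 z) = z"
  by (simp add: of_vec2_def to_vec2_def complex_eq_iff)

lemma to_vec2_of_vec2 [simp]: "to_vec2 (of_vec2 v) = v"
  by (simp add: of_vec2_def to_vec2_def vec_eq_iff forall_2)

lemma continuous_of_vec2: "continuous_on A of_vec2"
  unfolding of_vec2_def Complex_eq by (intro continuous_intros)

lemma continuous_to_vec2: "continuous_on A to_vec2"
  unfolding to_vec2_def
proof (intro continuous_on_vec_lambda)
  show "continuous_on A (\<lambda>z. if i = (1::2) then Re z else Im z)" for i
    by (cases "i = 1") (auto intro!: continuous_intros)
qed

lemma prod_Basis_2: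
  fixes f :: "real^2 \<Rightarrow> real"
  shows "(\<Prod>b\<in>Basis. f b) = f (axis 1 1) * f (axis 2 1)"
proof -
  have B: "(Basis :: (real^2) set) = {axis 1 1, axis 2 1}"
    by (auto simp: Basis_vec_def UNIV_2)
  have "axis 1 (1::real) \<noteq> (axis 2 1 :: real^2)"
    by (simp add: axis_eq_axis)
  then show ?thesis unfolding B by simp
qed

lemma of_vec2_lborel: "distr lborel borel of_vec2 = lborel"
proof (rule lborel_eqI[symmetric])
  have meas: "of_vec2 \<in> borel_measurable lborel"
    using borel_measurable_continuous_onI[OF continuous_of_vec2] by simp
  fix l u :: complex assume le: "\<And>b. b \<in> Basis \<Longrightarrow> l \<bullet> b \<le> u \<bullet> b"
  have le': "Re l \<le> Re u" "Im l \<le> Im u"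
    using le[of 1] le[of \<i>] by (auto simp: Basis_complex_def)
  have vim: "of_vec2 -` box l u = box (to_vec2 l) (to_vec2 u)"
    by (auto simp: mem_box_cart forall_2 of_vec2_def to_vec2_def in_box_complex_iff)
  have "emeasure (distr lborel borel of_vec2) (box l u)
      = emeasure lborel (box (to_vec2 l) (to_vec2 u))"
    using meas by (subst emeasure_distr) (auto simp: vim)
  also have "\<dots> = ennreal (\<Prod>b\<in>Basis. (to_vec2 u - to_vec2 l) \<bullet> b)"
    by (rule emeasure_lborel_box)
       (use le' in \<open>auto simp: Basis_vec_def inner_axis to_vec2_def\<close>)
  also have "(\<Prod>b\<in>Basis. (to_vec2 u - to_vec2 l) \<bullet> b) = (\<Prod>b\<in>Basis. (u - l) \<bullet> b)"
    by (simp add: prod_Basis_2 inner_axis to_vec2_def Basis_complex_def)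
  finally show "emeasure (distr lborel borel of_vec2) (box l u) = ennreal (\<Prod>b\<in>Basis. (u - l) \<bullet> b)" .
qed auto

lemma emeasure_lborel_rotate:
  assumes "cmod c = 1" "A \<in> sets borel" "bounded A"
  shows "emeasure lborel ((*) c -` A) = emeasure lborel A"
proof -
  \<comment> \<open>A preimage under multiplication by \<open>c\<close> is an image under
    multiplication by \<open>inverse c\<close>; \<open>M\<close> is the latter in real coordinates.
    Boundedness of \<open>A\<close> makes all measures finite.\<close>
  define M where "M = (\<lambda>v. to_vec2 (inverse c * of_vec2 v))"
  have c0: "c \<noteq> 0" using assms(1) by auto
  have 1: "inverse c = cnj c"
    using assms(1) by (simp add: complex_eq_iff cmod_def)
  have bor: "of_vec2 \<in> borel_measurable borel" "to_vec2 \<in> borel_measurable borel"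
    using borel_measurable_continuous_onI[OF continuous_of_vec2]
      borel_measurable_continuous_onI[OF continuous_to_vec2] by auto
  have sq: "(Re c)\<^sup>2 + (Im c)\<^sup>2 = 1"
    using assms(1) by (simp add: cmod_def)
  have inn: "v \<bullet> w = v $ 1 * w $ 1 + v $ 2 * w $ 2" for v w :: "real^2"
    by (simp add: inner_vec_def sum_2)
  have orth: "orthogonal_transformation M"
    unfolding orthogonal_transformation_def
  proof (intro conjI allI)
    show "linear M"
      by (intro linearI) (auto simp: M_def 1 to_vec2_def of_vec2_def vec_eq_iff algebra_simps)
    fix v w
    have "M v \<bullet> M w = ((Re c)\<^sup>2 + (Im c)\<^sup>2) * (v \<bullet> w)"
      unfolding inn by (simp add: M_def 1 to_vec2_def of_vec2_def power2_eq_square algebra_simps)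
    then show "M v \<bullet> M w = v \<bullet> w" by (simp add: sq)
  qed
  define B where "B = of_vec2 -` A"
  have B: "B \<in> sets borel" unfolding B_def using measurable_sets[OF bor(1) assms(2)] by simp
  have "B = to_vec2 ` A" unfolding B_def by (force intro: rev_image_eqI)
  moreover have "bounded (to_vec2 ` A)"
  proof -
    have "bounded (to_vec2 ` closure A)"
      by (intro compact_imp_bounded compact_continuous_image continuous_to_vec2)
        (use assms(3) in \<open>simp add: compact_closure\<close>)
    then show ?thesis by (rule bounded_subset) (auto intro: closure_subset[THEN subsetD])
  qed
  ultimately have Bm: "B \<in> lmeasurable"
    using bounded_set_imp_lmeasurable B by (metis sets_completionI_sets sets_lborel)
  have MB: "M ` B = of_vec2 -` ((*) c -` A)"
  proof (intro equalityI subsetI)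
    fix v assume "v \<in> M ` B"
    then show "v \<in> of_vec2 -` ((*) c -` A)"
      using c0 by (auto simp: M_def B_def mult.assoc[symmetric])
  next
    fix v assume "v \<in> of_vec2 -` ((*) c -` A)"
    then have "to_vec2 (c * of_vec2 v) \<in> B" "M (to_vec2 (c * of_vec2 v)) = v"
      using c0 by (auto simp: M_def B_def mult.assoc[symmetric])
    then show "v \<in> M ` B" by (metis imageI)
  qed
  have cA: "(*) c -` A \<in> sets borel"
    using measurable_sets[of "(*) c" borel borel A] assms(2) by simp
  have MBs: "M ` B \<in> sets borel"
    unfolding MB using measurable_sets[OF bor(1) cA] by simp
  have "emeasure lborel ((*) c -` A) = emeasure (distr lborel borel of_vec2) ((*) c -` A)"
    by (simp add: of_vec2_lborel)
  also have "\<dots> = emeasure lborel (M ` B)"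
    using bor cA by (subst emeasure_distr) (auto simp: MB)
  also have "\<dots> = emeasure lebesgue (M ` B)"
    using MBs by simp
  also have "\<dots> = ennreal (measure lebesgue (M ` B))"
    using measurable_orthogonal_image[OF orth Bm] by (simp add: emeasure_eq_measure2)
  also have "\<dots> = ennreal (measure lebesgue B)"
    by (simp add: measure_orthogonal_image[OF orth Bm])
  also have "\<dots> = emeasure lebesgue B"
    using Bm by (simp add: emeasure_eq_measure2)
  also have "\<dots> = emeasure lborel B"
    using B by simp
  also have "\<dots> = emeasure (distr lborel borel of_vec2) A"
    using bor assms(2) by (subst emeasure_distr) (auto simp: B_def)
  finally show ?thesis by (simp add: of_vec2_lborel)
qed

lemma emeasure_disk_borel:
  assumes "A \<in> sets borel"
  shows "emeasure disk_borel_measure A = ennreal (1 / pi) * emeasure lborel (A \<inter> disk)"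
proof -
  have "emeasure disk_borel_measure A = (\<integral>\<^sup>+z. ennreal (1 / pi) * indicator (A \<inter> disk) z \<partial>lborel)"
    unfolding disk_borel_measure_def using assms
    by (subst emeasure_density) (auto intro!: nn_integral_cong simp: indicator_def)
  also have "\<dots> = ennreal (1 / pi) * emeasure lborel (A \<inter> disk)"
    using assms by (subst nn_integral_cmult) (auto intro!: borel_measurable_indicator)
  finally show ?thesis .
qed

lemma distr_disk_borel_rotate:
  assumes "cmod c = 1"
  shows "distr disk_borel_measure disk_borel_measure ((*) c) = disk_borel_measure"
proof (rule measure_eqI)
  fix A assume "A \<in> sets (distr disk_borel_measure disk_borel_measure ((*) c))"
  then have A: "A \<in> sets borel" by simp
  have m: "(*) c \<in> disk_borel_measure \<rightarrow>\<^sub>M disk_borel_measure" by measurable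
  have "emeasure (distr disk_borel_measure disk_borel_measure ((*) c)) A
      = emeasure disk_borel_measure ((*) c -` A)"
    using A by (subst emeasure_distr[OF m]) (auto simp: disk_borel_measure_def)
  also have "\<dots> = ennreal (1 / pi) * emeasure lborel ((*) c -` A \<inter> disk)"
    using measurable_sets[of "(*) c" borel borel A] A by (subst emeasure_disk_borel) auto
  also have "(*) c -` A \<inter> disk = (*) c -` (A \<inter> disk)"
    using assms by (auto simp: norm_mult)
  also have "emeasure lborel \<dots> = emeasure lborel (A \<inter> disk)"
    by (rule emeasure_lborel_rotate) (use A assms bounded_ball in \<open>auto simp: bounded_Int\<close>)
  finally show "emeasure (distr disk_borel_measure disk_borel_measure ((*) c)) A
      = emeasure disk_borel_measure A"
    using A by (simp add: emeasure_disk_borel)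
qed simp

lemma finite_measure_disk_borel: "finite_measure disk_borel_measure"
proof
  show "emeasure disk_borel_measure (space disk_borel_measure) \<noteq> \<infinity>"
    using emeasure_bounded_finite[OF bounded_ball[of "0::complex" 1]]
    by (auto simp: disk_borel_measure_def emeasure_disk_borel[unfolded disk_borel_measure_def]
        ennreal_mult_eq_top_iff)
qed

section \<open>Push-forward of area to the radius\<close>

lemma nn_integral_radial:
  assumes "0 \<le> x"
  shows "(\<integral>\<^sup>+r. ennreal (indicator {x<..1} r * (2 * r)) \<partial>lborel) = ennreal (1 - min x 1 ^ 2)"
proof (cases "x \<le> 1")
  case True
  have "(\<integral>\<^sup>+r. ennreal (indicator {x<..1} r * (2 * r)) \<partial>lborel)
      = (\<integral>\<^sup>+r. ennreal (2 * r) * indicator {x..1} r \<partial>lborel)"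
    by (intro nn_integral_cong_AE)
      (auto intro!: AE_I[of _ _ "{x}"] simp: indicator_def split: if_splits)
  also have "\<dots> = ennreal (1^2 - x^2)"
    by (rule nn_integral_FTC_Icc) (use assms True in \<open>auto intro!: derivative_eq_intros\<close>)
  finally show ?thesis using True by (simp add: min_def)
next
  case False
  then show ?thesis by (auto simp: indicator_def min_def)
qed

lemma emeasure_disk_borel_cmod_greater:
  assumes "0 \<le> x"
  shows "emeasure disk_borel_measure (cmod -` {x<..}) = ennreal (1 - min x 1 ^ 2)"
proof (cases "x < 1")
  case True
  have "emeasure disk_borel_measure (cmod -` {x<..})
      = ennreal (1 / pi) * emeasure lborel (disk - cball 0 x)"
    using measurable_sets[of cmod borel borel "{x<..}"]
    by (subst emeasure_disk_borel)
      (auto intro!: arg_cong2[of _ _ _ _ "(*)"] arg_cong2[of _ _ _ _ emeasure])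
  also have "emeasure lborel (disk - cball 0 x :: complex set)
      = emeasure lborel (disk :: complex set) - emeasure lborel (cball 0 x :: complex set)"
    using True assms by (subst emeasure_Diff) (auto simp: emeasure_cball unit_ball_vol_2)
  also have "\<dots> = ennreal (pi * (1 - x\<^sup>2))"
    using assms by (simp add: emeasure_cball emeasure_ball unit_ball_vol_2 ennreal_minus
        algebra_simps)
  also have "ennreal (1 / pi) * \<dots> = ennreal (1 - x\<^sup>2)"
    using assms True by (subst ennreal_mult[symmetric]) (auto simp: power_le_one)
  finally show ?thesis using True by (simp add: min_def)
next
  case False
  then have "cmod -` {x<..} \<inter> disk = {}" by auto
  then show ?thesis
    using False measurable_sets[of cmod borel borel "{x<..}"]
        by (subst emeasure_disk_borel) (auto simp: min_def)
qed

lemma emeasure_radial_measure_greater: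
  "emeasure radial_measure {x<..} = ennreal (1 - min (max x 0) 1 ^ 2)"
proof -
  have "emeasure radial_measure {x<..}
      = (\<integral>\<^sup>+r. ennreal (indicator {max x 0<..1} r * (2 * r)) \<partial>lborel)"
    unfolding radial_measure_def
    by (subst emeasure_density) (auto intro!: nn_integral_cong simp: indicator_def max_def)
  then show ?thesis by (simp add: nn_integral_radial)
qed

text \<open>Measures on the line that are finite on the rays \<open>{x<..}\<close> are determined by
  their values there; on the disk these rays are annuli, computed as differences of balls.\<close>

lemma distr_disk_borel_cmod: "distr disk_borel_measure borel cmod = radial_measure"
proof (rule measure_eqI_lessThan)
  have m: "cmod \<in> disk_borel_measure \<rightarrow>\<^sub>M borel" by measurable
  have 1: "emeasure (distr disk_borel_measure borel cmod) {x<..}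
      = emeasure disk_borel_measure (cmod -` {x<..})" for x
    by (subst emeasure_distr[OF m]) (auto simp: disk_borel_measure_def)
  show eq: "emeasure (distr disk_borel_measure borel cmod) {x<..} = emeasure radial_measure {x<..}"
      for x
  proof (cases "x < 0")
    \<comment> \<open>Below 0 the preimage of the ray is the whole plane, which differs from that of
      \<open>{0<..}\<close> only by the origin.\<close>
    case True
    have "emeasure disk_borel_measure (cmod -` {0<..})
        = emeasure disk_borel_measure (cmod -` {x<..})"
    proof (rule emeasure_eq_AE)
      have "AE z in lborel. z \<noteq> (0::complex)" by (rule AE_lborel_singleton)
      then show "AE z in disk_borel_measure. z \<in> cmod -` {0<..} \<longleftrightarrow> z \<in> cmod -` {x<..}"
        unfolding disk_borel_measure_def using True
        by (subst AE_density) (measurable, auto elim!: eventually_mono intro: less_le_trans)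
    qed (use measurable_sets[OF m] in \<open>auto simp: disk_borel_measure_def\<close>)
    then show ?thesis
      using True by (simp add: 1 emeasure_disk_borel_cmod_greater emeasure_radial_measure_greater)
  qed (simp add: 1 emeasure_disk_borel_cmod_greater emeasure_radial_measure_greater)
  show "emeasure (distr disk_borel_measure borel cmod) {x<..} < \<infinity>" for x
    by (simp add: eq emeasure_radial_measure_greater)
qed auto

text \<open>The density is positive on (0, 1] and the point 0 is null, so both measures have the
  same null sets.\<close>

lemma AE_radial_measure_iff: "(AE r in radial_measure. P r) \<longleftrightarrow> (AE r in lebesgue_on {0..1}. P r)"
proof -
  have "(AE r in radial_measure. P r) \<longleftrightarrow> (AE r in lborel. r \<in> {0<..1} \<longrightarrow> P r)"
    unfolding radial_measure_def
        by (subst AE_density) (auto simp: indicator_def ennreal_eq_0_iff intro!: AE_cong)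
  also have "\<dots> \<longleftrightarrow> (AE r in lborel. r \<in> {0..1} \<longrightarrow> P r)"
  proof -
    have "AE r in lborel. r \<noteq> (0::real)" by (rule AE_lborel_singleton)
    then have "AE r in lborel. (r \<in> {0<..1} \<longrightarrow> P r) \<longleftrightarrow> (r \<in> {0..1} \<longrightarrow> P r)"
      by (rule eventually_mono) auto
    then show ?thesis by (rule eventually_subst)
  qed
  also have "\<dots> \<longleftrightarrow> (AE r in lebesgue. r \<in> {0..1} \<longrightarrow> P r)"
    by (simp add: AE_completion_iff)
  also have "\<dots> \<longleftrightarrow> (AE r in lebesgue_on {0..1}. P r)"
    by (subst AE_restrict_space_iff) auto
  finally show ?thesis .
qed

lemma AE_dA_cmod:
  assumes "AE r in lebesgue_on {0..1}. P r"
  shows "AE z in dA. P (cmod z)"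
proof -
  have "AE r in distr disk_borel_measure borel cmod. P r"
    unfolding distr_disk_borel_cmod AE_radial_measure_iff by (rule assms)
  then obtain N where N: "{r. \<not> P r} \<subseteq> N" "N \<in> null_sets (distr disk_borel_measure borel cmod)"
    by (auto simp: eventually_ae_filter)
  have "cmod -` N \<inter> space disk_borel_measure \<in> null_sets disk_borel_measure"
    using N(2) by (subst (asm) null_sets_distr_iff) (auto simp: disk_borel_measure_def)
  then have "AE z in disk_borel_measure. P (cmod z)"
    by (rule AE_I') (use N(1) in auto)
  then show ?thesis by (rule AE_dA_of_borel)
qed

text \<open>Both the set above \<open>E\<close> and its complement in the disk are, up to null sets, countable unions of
  compact sets. Their images under \<^const>\<open>cmod\<close> are Borel and leave uncovered only a Borel set \<open>N\<close> whose
  preimage is null, hence \<open>N\<close> is null.\<close>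

lemma radial_lebesgue_set:
  assumes "cmod -` E \<inter> disk \<in> sets lebesgue"
  shows "E \<inter> {0..<1} \<in> sets lebesgue"
proof -
  have *: "\<exists>U T. U \<in> sets borel \<and> U \<subseteq> cmod ` S \<and> T \<in> null_sets lebesgue \<and> S \<subseteq> cmod -` U \<union> T"
    if S: "S \<in> sets lebesgue" for S :: "complex set"
  proof -
    obtain C T where CT: "fsigma C" "T \<in> null_sets lebesgue" "C \<union> T = S"
      using lebesgue_set_almost_fsigma[OF S] by metis
    then obtain K :: "nat \<Rightarrow> complex set" where K: "range K \<subseteq> Collect compact" "C = \<Union>(range K)"
      using fsigma_Union_compact by metis
    have "compact (cmod ` K n)" for n
      using K(1) by (intro compact_continuous_image continuous_intros) auto
    then have "(\<Union>n. cmod ` K n) \<in> sets borel"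
      by (intro sets.countable_UN) (auto intro: borel_compact)
    then show ?thesis using CT K by (intro exI[of _ "\<Union>n. cmod ` K n"] exI[of _ T]) auto
  qed
  obtain U1 T1 where 1: "U1 \<in> sets borel" "U1 \<subseteq> cmod ` (cmod -` E \<inter> disk)" "T1 \<in> null_sets lebesgue"
      "cmod -` E \<inter> disk \<subseteq> cmod -` U1 \<union> T1"
    using *[OF assms] by metis
  have "disk - cmod -` E \<inter> disk \<in> sets lebesgue" using assms by auto
  then obtain U2 T2 where 2: "U2 \<in> sets borel" "U2 \<subseteq> cmod ` (disk - cmod -` E \<inter> disk)"
      "T2 \<in> null_sets lebesgue"
      "disk - cmod -` E \<inter> disk \<subseteq> cmod -` U2 \<union> T2"
    using * by metis
  define N where "N = {0..<1} - U1 - U2"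
  have Nb: "N \<in> sets borel" using 1 2 by (auto simp: N_def)
  have sub: "cmod -` N \<inter> disk \<subseteq> T1 \<union> T2" using 1(4) 2(4) by (auto simp: N_def)
  have cNb: "cmod -` N \<in> sets borel"
    using measurable_sets[of cmod borel borel N] Nb by simp
  have "T1 \<union> T2 \<in> null_sets lebesgue" using 1 2 by auto
  then have "cmod -` N \<inter> disk \<in> null_sets lebesgue"
    using null_sets_subset[OF _ _ sub] cNb by (auto simp: sets_completionI_sets)
  then have "emeasure lborel (cmod -` N \<inter> disk) = 0"
    using cNb by (auto simp: null_sets_def)
  then have "emeasure radial_measure N = 0"
    unfolding distr_disk_borel_cmod[symmetric] using Nb cNb
    by (subst emeasure_distr)
        (auto simp: emeasure_disk_borel disk_borel_measure_def[THEN arg_cong, of space])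
  then have "AE r in radial_measure. r \<notin> N"
    using Nb by (intro AE_not_in) (auto simp: null_sets_def)
  then have "AE r in lebesgue_on {0..1}. r \<notin> N" by (simp add: AE_radial_measure_iff)
  then have "AE r in lebesgue. r \<notin> N"
    by (subst (asm) AE_restrict_space_iff) (auto elim!: eventually_mono simp: N_def)
  then have Nn: "N \<in> null_sets lebesgue"
    using Nb AE_iff_null_sets[of N lebesgue] by (simp add: sets_completionI_sets)
  have "E \<inter> {0..<1} = U1 \<union> (E \<inter> N)"
    using 1(2) 2(2) by (auto simp: N_def)
  moreover have "E \<inter> N \<in> null_sets lebesgue"
    using Nn by (meson completion.complete2 inf_le2)
  ultimately show ?thesis
    using 1(1) by (auto simp: sets_completionI_sets)
qed

text \<open>The open disk sees only radii below 1, hence the cut-off at \<open>{0..<1}\<close>; the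
  value at 1 is added in \<open>radial_measurable\<close>.\<close>

lemma radial_measurable_aux:
  fixes \<phi> :: "real \<Rightarrow> complex"
  assumes "(\<lambda>z. \<phi> (cmod z)) \<in> borel_measurable dA"
  shows "(\<lambda>r. indicator {0..<1} r *\<^sub>R \<phi> r) \<in> borel_measurable lebesgue"
proof (rule borel_measurableI)
    fix S :: "complex set" assume S: "open S"
    have "cmod -` (\<phi> -` S) \<inter> disk \<in> sets (lebesgue_on disk)"
      using measurable_sets[OF assms, of S] S by (simp add: dA_density vimage_def)
    then have "cmod -` (\<phi> -` S) \<inter> disk \<in> sets lebesgue"
      by (subst (asm) sets_restrict_space_iff) auto
    then have *: "\<phi> -` S \<inter> {0..<1} \<in> sets lebesgue" by (rule radial_lebesgue_set)
    have "(\<lambda>r. indicator {0..<1} r *\<^sub>R \<phi> r) -` S \<inter> space lebesgue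
       = (\<phi> -` S \<inter> {0..<1}) \<union> (if 0 \<in> S then - {0..<1} else {})"
      by (auto simp: indicator_def of_bool_def split: if_splits)
    also have "\<dots> \<in> sets lebesgue"
      using * by (intro sets.Un) (auto intro!: sets_completionI_sets)
    finally show "(\<lambda>r. indicator {0..<1} r *\<^sub>R \<phi> r) -` S \<inter> space lebesgue \<in> sets lebesgue" .
  qed

lemma radial_measurable:
  fixes \<phi> :: "real \<Rightarrow> complex"
  assumes "(\<lambda>z. \<phi> (cmod z)) \<in> borel_measurable dA"
  shows "\<phi> \<in> borel_measurable (lebesgue_on {0..1})"
proof -
  have "(\<lambda>r. indicator {0..<1} r *\<^sub>R \<phi> r + indicator {1} r *\<^sub>R \<phi> 1) \<in> borel_measurable lebesgue"
    using radial_measurable_aux[OF assms]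
    by (rule borel_measurable_add) (intro measurable_completion, measurable)
  also have "(\<lambda>r. indicator {0..<1} r *\<^sub>R \<phi> r + indicator {1} r *\<^sub>R \<phi> 1)
      = (\<lambda>r. indicator {0..1} r *\<^sub>R \<phi> r)"
    by (auto simp: indicator_def fun_eq_iff)
  finally show ?thesis
    by (subst borel_measurable_restrict_space_iff) auto
qed

text \<open>A radial symbol is only Lebesgue measurable, while rotation and push-forward are applied
  to Borel integrands. Changing the symbol on a null set of radii bridges the gap.\<close>

lemma radial_borel_representative:
  fixes \<phi> :: "real \<Rightarrow> complex"
  assumes "(\<lambda>z. \<phi> (cmod z)) \<in> borel_measurable dA"
  obtains \<psi> where "\<psi> \<in> borel_measurable borel" "AE r in lebesgue_on {0..1}. \<phi> r = \<psi> r"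
proof -
  have f: "(\<lambda>r. indicator {0..<1} r *\<^sub>R \<phi> r) \<in> borel_measurable lebesgue"
    by (rule radial_measurable_aux[OF assms])
  then obtain \<psi> where \<psi>: "\<psi> \<in> borel_measurable lborel"
      "AE r in lborel. indicator {0..<1} r *\<^sub>R \<phi> r = \<psi> r"
  proof -
    let ?f = "\<lambda>r. indicator {0..<1} r *\<^sub>R \<phi> r"
    have "(\<lambda>r. Re (?f r)) \<in> borel_measurable lebesgue" "(\<lambda>r. Im (?f r)) \<in> borel_measurable lebesgue"
      using f by measurable
    then obtain g h where "g \<in> borel_measurable lborel" "AE r in lborel. Re (?f r) = g r"
      "h \<in> borel_measurable lborel" "AE r in lborel. Im (?f r) = h r"
      using completion_ex_borel_measurable_real[of "\<lambda>r. Re (?f r)" lborel]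
        completion_ex_borel_measurable_real[of "\<lambda>r. Im (?f r)" lborel] by blast
    moreover from this have "AE r in lborel. ?f r = Complex (g r) (h r)"
      by (auto simp: complex_eq_iff)
    ultimately show ?thesis
      by (intro that[of "\<lambda>r. Complex (g r) (h r)"]) (auto simp: Complex_eq)
  qed
  have "AE r in lborel. r \<noteq> (1::real)" by (rule AE_lborel_singleton)
  with \<psi>(2) have "AE r in lborel. r \<in> {0..1} \<longrightarrow> \<phi> r = \<psi> r"
    by eventually_elim (auto simp: indicator_def)
  then have "AE r in lebesgue. r \<in> {0..1} \<longrightarrow> \<phi> r = \<psi> r"
    by (rule AE_completion)
  then have "AE r in lebesgue_on {0..1}. \<phi> r = \<psi> r"
    by (subst AE_restrict_space_iff) auto
  with \<psi> show ?thesis by (intro that) auto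
qed

lemma emeasure_dA_space: "emeasure dA disk = 1"
proof -
  have "emeasure dA disk = ennreal (1 / pi) * emeasure lborel (disk :: complex set)"
    unfolding dA_def by (simp add: emeasure_restrict_space)
  also have "\<dots> = 1"
    by (simp add: emeasure_ball unit_ball_vol_2 ennreal_mult[symmetric])
  finally show ?thesis .
qed

lemma finite_measure_dA: "finite_measure dA"
  by (rule finite_measureI) (simp add: emeasure_dA_space)

lemma integrable_radial_measure_iff:
  fixes f :: "real \<Rightarrow> complex"
  assumes [measurable]: "f \<in> borel_measurable borel"
  shows "integrable radial_measure f \<longleftrightarrow> integrable (lebesgue_on {0..1}) (\<lambda>r. of_real r * f r)"
proof -
  have "integrable radial_measure f
      \<longleftrightarrow> integrable lborel (\<lambda>r. 2 *\<^sub>R (indicator {0..1} r *\<^sub>R (of_real r * f r)))"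
    unfolding radial_measure_def
    by (subst integrable_density)
      (auto simp: indicator_def scaleR_conv_of_real mult_ac intro!:
          Bochner_Integration.integrable_cong)
  also have "\<dots> \<longleftrightarrow> integrable lborel (\<lambda>r. indicator {0..1} r *\<^sub>R (of_real r * f r))"
    (is "integrable _ (\<lambda>r. 2 *\<^sub>R ?h r) \<longleftrightarrow> _")
  proof
    assume "integrable lborel (\<lambda>r. 2 *\<^sub>R ?h r)"
    then have "integrable lborel (\<lambda>r. (1/2) *\<^sub>R 2 *\<^sub>R ?h r)"
      by (rule integrable_scaleR_right)
    moreover have "(\<lambda>r. (1/2) *\<^sub>R 2 *\<^sub>R ?h r) = ?h"
      by (simp only: scaleR_scaleR) simp
    ultimately show "integrable lborel ?h" by (simp only:)
  qed (rule integrable_scaleR_right)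
  also have "\<dots> \<longleftrightarrow> integrable lebesgue (\<lambda>r. indicator {0..1} r *\<^sub>R (of_real r * f r))"
    by (intro integrable_completion[symmetric]) measurable
  also have "\<dots> \<longleftrightarrow> integrable (lebesgue_on {0..1}) (\<lambda>r. of_real r * f r)"
    by (subst integrable_restrict_space) auto
  finally show ?thesis .
qed

lemma integral_radial_measure_eq:
  fixes f :: "real \<Rightarrow> complex"
  assumes [measurable]: "f \<in> borel_measurable borel"
  shows "(LINT r|radial_measure. f r) = 2 * (LINT r|lebesgue_on {0..1}. of_real r * f r)"
proof -
  have "(LINT r|radial_measure. f r)
      = (LINT r|lborel. 2 *\<^sub>R (indicator {0..1} r *\<^sub>R (of_real r * f r)))"
    unfolding radial_measure_def
    by (subst integral_density)
      (auto simp: indicator_def scaleR_conv_of_real mult_ac intro!: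
          Bochner_Integration.integral_cong)
  also have "\<dots> = 2 * (LINT r|lborel. indicator {0..1} r *\<^sub>R (of_real r * f r))"
    by (subst integral_scaleR_right) (simp add: scaleR_conv_of_real)
  also have "(LINT r|lborel. indicator {0..1} r *\<^sub>R (of_real r * f r))
      = (LINT r|lebesgue. indicator {0..1} r *\<^sub>R (of_real r * f r))"
    by (intro integral_completion[symmetric]) measurable
  also have "\<dots> = (LINT r|lebesgue_on {0..1}. of_real r * f r)"
    by (subst integral_restrict_space) auto
  finally show ?thesis .
qed

lemma borel_representative:
  fixes \<phi> :: "real \<Rightarrow> complex"
  assumes "integrable dA (\<lambda>z. \<phi> (cmod z))"
  obtains \<psi> where "\<psi> \<in> borel_measurable borel" "AE r in lebesgue_on {0..1}. \<phi> r = \<psi> r"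
     "integrable radial_measure \<psi>"
proof -
  obtain \<psi> where \<psi>[measurable]: "\<psi> \<in> borel_measurable borel"
      and AE: "AE r in lebesgue_on {0..1}. \<phi> r = \<psi> r"
    using radial_borel_representative borel_measurable_integrable[OF assms] by metis
  have m: "(\<lambda>z. \<psi> (cmod z)) \<in> borel_measurable borel" by measurable
  have "integrable dA (\<lambda>z. \<psi> (cmod z))"
    using assms m AE_dA_cmod[OF AE]
        by (subst integrable_cong_AE[symmetric]) (auto intro: borel_measurable_dAI)
  then have "integrable disk_borel_measure (\<lambda>z. \<psi> (cmod z))"
    by (subst (asm) integrable_dA_iff_borel[OF m])
  then have "integrable radial_measure \<psi>"
    unfolding distr_disk_borel_cmod[symmetric] by (subst integrable_distr_eq) auto
  then show ?thesis using that \<psi> AE by blast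
qed

lemma radial_integrable:
  fixes \<phi> :: "real \<Rightarrow> complex"
  assumes "integrable dA (\<lambda>z. \<phi> (cmod z))"
  shows "integrable (lebesgue_on {0..1}) (\<lambda>r. of_real r * \<phi> r)"
proof -
  obtain \<psi> where \<psi>[measurable]: "\<psi> \<in> borel_measurable borel"
      and AE: "AE r in lebesgue_on {0..1}. \<phi> r = \<psi> r"
     and int: "integrable radial_measure \<psi>"
    using borel_representative[OF assms] by metis
  have [measurable]: "\<phi> \<in> borel_measurable (lebesgue_on {0..1})"
    by (rule radial_measurable[OF borel_measurable_integrable[OF assms]])
  have [measurable]: "\<psi> \<in> borel_measurable (lebesgue_on {0..1})"
    by (intro measurable_restrict_space1 measurable_completion) measurable
  have [measurable]: "complex_of_real \<in> borel_measurable (lebesgue_on {0..1})"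
    by (intro measurable_restrict_space1 measurable_completion) measurable
  have "integrable (lebesgue_on {0..1}) (\<lambda>r. of_real r * \<psi> r)"
    using int by (subst (asm) integrable_radial_measure_iff) auto
  then show ?thesis
    using AE by (subst integrable_cong_AE[of _ _ "\<lambda>r. of_real r * \<psi> r"]) auto
qed

lemma integral_dA_rotate:
  fixes f :: "complex \<Rightarrow> complex"
  assumes [measurable]: "f \<in> borel_measurable borel" and "cmod c = 1"
  shows "(LINT z|dA. f (c * z)) = (LINT z|dA. f z)"
proof -
  have m: "(*) c \<in> disk_borel_measure \<rightarrow>\<^sub>M disk_borel_measure" by measurable
  have "(LINT z|dA. f z) = (LINT z|distr disk_borel_measure disk_borel_measure ((*) c). f z)"
    by (simp add: integral_dA_eq_borel distr_disk_borel_rotate[OF assms(2)])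
  also have "\<dots> = (LINT z|disk_borel_measure. f (c * z))"
    by (rule integral_distr[OF m]) measurable
  also have "\<dots> = (LINT z|dA. f (c * z))"
    by (rule integral_dA_eq_borel[symmetric]) measurable
  finally show ?thesis by simp
qed

lemma integral_dA_radial:
  fixes f :: "real \<Rightarrow> complex"
  assumes [measurable]: "f \<in> borel_measurable borel"
  shows "(LINT z|dA. f (cmod z)) = 2 * (LINT r|lebesgue_on {0..1}. of_real r * f r)"
proof -
  have "(LINT z|dA. f (cmod z)) = (LINT z|disk_borel_measure. f (cmod z))"
    by (rule integral_dA_eq_borel) measurable
  also have "\<dots> = (LINT r|distr disk_borel_measure borel cmod. f r)"
    by (rule integral_distr[symmetric]) measurable
  also have "\<dots> = 2 * (LINT r|lebesgue_on {0..1}. of_real r * f r)"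
    by (simp add: distr_disk_borel_cmod integral_radial_measure_eq)
  finally show ?thesis .
qed

lemma integrable_dA_radial_iff:
  fixes f :: "real \<Rightarrow> complex"
  assumes [measurable]: "f \<in> borel_measurable borel"
  shows "integrable dA (\<lambda>z. f (cmod z)) \<longleftrightarrow> integrable (lebesgue_on {0..1}) (\<lambda>r. of_real r * f r)"
proof -
  have "integrable dA (\<lambda>z. f (cmod z)) \<longleftrightarrow> integrable disk_borel_measure (\<lambda>z. f (cmod z))"
    by (rule integrable_dA_iff_borel) measurable
  also have "\<dots> \<longleftrightarrow> integrable (distr disk_borel_measure borel cmod) f"
    by (rule integrable_distr_eq[symmetric]) measurable
  also have "\<dots> \<longleftrightarrow> integrable (lebesgue_on {0..1}) (\<lambda>r. of_real r * f r)"
    by (simp add: distr_disk_borel_cmod integrable_radial_measure_iff)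
  finally show ?thesis .
qed

section \<open>Moments of quasihomogeneous symbols\<close>

lemma cis_Arg_powi: "z \<noteq> 0 \<Longrightarrow> cis (of_int k * Arg z) = sgn z powi k"
  using cis_Arg[of z] cis_power_int[of "Arg z" k] by (simp add: mult.commute)

lemma AE_dA_nonzero: "AE z in dA. z \<noteq> 0"
proof -
  have "AE z in lborel. z \<noteq> (0::complex)" by (rule AE_lborel_singleton)
  then have "AE z in disk_borel_measure. z \<noteq> 0"
    unfolding disk_borel_measure_def by (subst AE_density) auto
  then show ?thesis by (rule AE_dA_of_borel)
qed

lemma borel_measurable_powi [measurable]: "(\<lambda>z::complex. z powi k) \<in> borel_measurable borel"
  by (cases "k \<ge> 0") (auto simp: power_int_def)

lemma borel_measurable_sgn_complex [measurable]:
    "(sgn :: complex \<Rightarrow> complex) \<in> borel_measurable borel"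
  unfolding sgn_eq by measurable

text \<open>Only the origin needs the exceptional set besides the radii: there
  \<open>cis (of_int k * Arg z)\<close> is 1, but \<open>sgn z powi k\<close> is 0 for nonzero
  \<open>k\<close>.\<close>

lemma quasihomogeneous_AE:
  assumes "AE r in lebesgue_on {0..1}. \<phi> r = \<psi> r"
  shows "AE z in dA. quasihomogeneous k \<phi> z = sgn z powi k * \<psi> (cmod z)"
  using AE_dA_cmod[OF assms] AE_dA_nonzero
  by eventually_elim (simp add: quasihomogeneous_def cis_Arg_powi)

lemma quasihomogeneous_measurable:
  fixes \<phi> :: "real \<Rightarrow> complex"
  assumes "(\<lambda>z. \<phi> (cmod z)) \<in> borel_measurable dA"
  shows "quasihomogeneous k \<phi> \<in> borel_measurable dA"
proof -
  have "(\<lambda>z. cis (of_int k * Arg z)) = (\<lambda>z. if z = 0 then 1 else sgn z powi k)"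
    by (auto simp: cis_Arg_powi Arg_zero)
  moreover have "(\<lambda>z::complex. if z = 0 then 1 else sgn z powi k) \<in> borel_measurable borel"
    by measurable
  ultimately have "(\<lambda>z. cis (of_int k * Arg z)) \<in> borel_measurable borel" by simp
  then have m: "(\<lambda>z. cis (of_int k * Arg z)) \<in> borel_measurable dA"
    by (rule borel_measurable_dAI)
  show ?thesis unfolding quasihomogeneous_def by (rule borel_measurable_times[OF m assms])
qed

lemma quasihomogeneous_integrable:
  fixes \<phi> :: "real \<Rightarrow> complex"
  assumes "integrable dA (\<lambda>z. \<phi> (cmod z))"
  shows "integrable dA (quasihomogeneous k \<phi>)"
  using integrable_norm[OF assms]
  by (rule Bochner_Integration.integrable_bound)
    (use quasihomogeneous_measurable borel_measurable_integrable[OF assms] in blast,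
      simp add: quasihomogeneous_def norm_mult)

text \<open>If the total frequency \<open>i\<close> is nonzero, rotating by \<open>\<pi> / i\<close> changes the sign of the integral.\<close>

lemma moment_quasihomogeneous:
  fixes \<phi> :: "real \<Rightarrow> complex"
  assumes "integrable dA (\<lambda>z. \<phi> (cmod z))"
  shows "(LINT w|dA. quasihomogeneous k \<phi> w * w ^ n * cnj w ^ j) =
     (if int n + k = int j then 2 * mellin \<phi> (of_nat (n + j + 2)) else 0)"
proof -
  obtain \<psi> where \<psi>[measurable]: "\<psi> \<in> borel_measurable borel"
      and AE: "AE r in lebesgue_on {0..1}. \<phi> r = \<psi> r"
    using borel_representative[OF assms] by metis
  define i where "i = k + int n - int j"
  define g where "g = (\<lambda>r. \<psi> r * of_real r ^ (n + j))"
  have [measurable]: "g \<in> borel_measurable borel" unfolding g_def by measurable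
  have "(LINT w|dA. quasihomogeneous k \<phi> w * w ^ n * cnj w ^ j)
      = (LINT w|dA. sgn w powi i * g (cmod w))"
  proof (rule integral_cong_AE)
    show "AE w in dA. quasihomogeneous k \<phi> w * w ^ n * cnj w ^ j = sgn w powi i * g (cmod w)"
      using quasihomogeneous_AE[OF AE, of k] AE_dA_nonzero
    proof eventually_elim
      fix w :: complex assume *: "quasihomogeneous k \<phi> w = sgn w powi k * \<psi> (cmod w)" "w \<noteq> 0"
      have s: "w = sgn w * cmod w" using *(2) by (simp add: sgn_eq)
      have "norm (sgn w) = 1" using *(2) by (simp add: norm_sgn)
      then have c: "cnj (sgn w) = inverse (sgn w)"
        using complex_norm_square[of "sgn w"] by (intro inverse_unique[symmetric]) simp
      have "w ^ n = sgn w powi (int n) * of_real (cmod w) ^ n"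
        by (subst s) (simp only: power_mult_distrib power_int_of_nat)
      moreover have "cnj w = cnj (sgn w) * of_real (cmod w)"
        by (subst s) (simp only: complex_cnj_mult complex_cnj_complex_of_real)
      then have "cnj w ^ j = sgn w powi (- int j) * of_real (cmod w) ^ j"
        by (simp add: c power_mult_distrib power_int_minus power_inverse)
      moreover have "sgn w powi i = sgn w powi k * sgn w powi (int n) * sgn w powi (- int j)"
        using *(2) by (simp add: i_def power_int_add power_int_diff power_int_minus sgn_zero_iff
            divide_inverse)
      ultimately show "quasihomogeneous k \<phi> w * w ^ n * cnj w ^ j = sgn w powi i * g (cmod w)"
        by (simp add: *(1) g_def power_add mult_ac)
    qed
    have [measurable]: "quasihomogeneous k \<phi> \<in> borel_measurable dA"
      by (intro quasihomogeneous_measurable borel_measurable_integrable[OF assms])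
    have [measurable]: "(\<lambda>w. w ^ n * cnj w ^ j) \<in> borel_measurable dA"
      by (intro borel_measurable_dAI borel_measurable_continuous_onI continuous_intros)
    show "(\<lambda>w. quasihomogeneous k \<phi> w * w ^ n * cnj w ^ j) \<in> borel_measurable dA"
      unfolding mult.assoc by measurable
    show "(\<lambda>w. sgn w powi i * g (cmod w)) \<in> borel_measurable dA"
      by (rule borel_measurable_dAI) measurable
  qed
  also have "\<dots> = (if i = 0 then 2 * mellin \<phi> (of_nat (n + j + 2)) else 0)"
  proof (cases "i = 0")
    case True
    have "(LINT w|dA. g (cmod w)) = 2 * (LINT r|lebesgue_on {0..1}. of_real r * g r)"
      by (rule integral_dA_radial) measurable
    also have "(LINT r|lebesgue_on {0..1}. of_real r * g r) = mellin \<phi> (of_nat (n + j + 2))"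
      unfolding mellin_def
    proof (rule integral_cong_AE)
      show "AE r in lebesgue_on {0..1}. of_real r * g r
          = \<phi> r * of_real r powr (of_nat (n + j + 2) - 1)"
        using AE
      proof eventually_elim
        fix r assume r: "\<phi> r = \<psi> r"
        \<comment> \<open>The exponent is at least 1, so at r = 0 the convention that
          \<open>powr\<close> has value 0 agrees with the ordinary power.\<close>
        have "of_real r powr (of_nat (n + j + 2) - 1) = complex_of_real r powr of_nat (Suc (n + j))"
          by (simp add: algebra_simps)
        also have "\<dots> = (if r = 0 then 0 else of_real r ^ Suc (n + j))"
          using powr_nat'[of "of_real r :: complex" "Suc (n + j)"] by simp
        finally show "of_real r * g r = \<phi> r * of_real r powr (of_nat (n + j + 2) - 1)"
          by (simp add: g_def r)
      qed
      have [measurable]: "\<phi> \<in> borel_measurable (lebesgue_on {0..1})"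
        by (rule radial_measurable[OF borel_measurable_integrable[OF assms]])
      show "(\<lambda>r. of_real r * g r) \<in> borel_measurable (lebesgue_on {0..1})"
        by (intro measurable_restrict_space1 measurable_completion) measurable
      have [measurable]: "(\<lambda>r. complex_of_real r powr (of_nat (n + j + 2) - 1))
          \<in> borel_measurable (lebesgue_on {0..1})"
        by (intro measurable_restrict_space1 measurable_completion) measurable
      show "(\<lambda>r. \<phi> r * of_real r powr (of_nat (n + j + 2) - 1))
          \<in> borel_measurable (lebesgue_on {0..1})"
        by measurable
    qed
    finally show ?thesis using True by simp
  next
    case False
    define c where "c = cis (pi / of_int i)"
    have c: "c powi i = -1" using False by (simp add: c_def cis_power_int)
    have nc: "cmod c = 1" by (simp add: c_def)
    have "(LINT w|dA. sgn w powi i * g (cmod w))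
        = (LINT w|dA. sgn (c * w) powi i * g (cmod (c * w)))"
      by (rule integral_dA_rotate[symmetric]) (use nc in measurable)
    also have "\<dots> = (LINT w|dA. - (sgn w powi i * g (cmod w)))"
      using nc by (intro Bochner_Integration.integral_cong)
        (auto simp: sgn_mult power_int_mult_distrib norm_mult c sgn_eq[of c])
    finally show ?thesis using False by simp
  qed
  finally show ?thesis by (auto simp: i_def algebra_simps)
qed

section \<open>Zeros of bounded functions on a half-plane\<close>

text \<open>A disk automorphism moves the zero \<open>s\<close> to the origin and reduces this to
  the Schwarz lemma. That lemma needs a bound strictly below 1, so \<open>g\<close> is divided by
  some \<open>M' > M\<close>, and \<open>M'\<close> then tends to \<open>M\<close>.\<close>

lemma Schwarz_Pick_zero:
  assumes hol: "g holomorphic_on ball 0 1" and le: "\<And>w. cmod w < 1 \<Longrightarrow> cmod (g w) \<le> M"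
    and s: "cmod s < 1" "g s = 0" and w: "cmod w < 1"
  shows "cmod (g w) \<le> M * cmod ((w - s) / (1 - cnj s * w))"
proof -
  have "M \<ge> 0" using le[of 0] norm_ge_zero[of "g 0"] by (simp del: norm_ge_zero)
  have *: "cmod (g w) \<le> M' * cmod ((w - s) / (1 - cnj s * w))" if "M' > M" for M'
  proof -
    define f where "f = (\<lambda>u. g (Moebius_function 0 (-s) u) / of_real M')"
    have M': "M' > 0" using that \<open>M \<ge> 0\<close> by simp
    have "f holomorphic_on ball 0 1" unfolding f_def
      using Moebius_function_holomorphic[of "-s" 0] Moebius_function_norm_lt_1[of "-s" _ 0] s M'
      by (intro holomorphic_intros holomorphic_on_compose_gen[OF _ hol, unfolded o_def]) auto
    moreover have "f 0 = 0" using s by (simp add: f_def Moebius_function_simple)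
    moreover have "cmod (f u) < 1" if "cmod u < 1" for u
      using le[of "Moebius_function 0 (-s) u"] Moebius_function_norm_lt_1[of "-s" u 0] that s M'
          \<open>M' > M\<close>
      by (simp add: f_def norm_divide)
    ultimately have "cmod (f (Moebius_function 0 s w)) \<le> cmod (Moebius_function 0 s w)"
      using Moebius_function_norm_lt_1[of s w 0] s w by (intro Schwarz_Lemma(1)) auto
    moreover have "Moebius_function 0 (-s) (Moebius_function 0 s w) = w"
      using s w by (intro Moebius_function_compose) auto
    ultimately show ?thesis
      using M' by (simp add: f_def norm_divide pos_divide_le_eq mult.commute)
        (simp add: Moebius_function_simple norm_divide mult.commute)
  qed
  show ?thesis
  proof (rule field_le_epsilon)
    fix e :: real assume "e > 0"
    let ?b = "cmod ((w - s) / (1 - cnj s * w))"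
    have b: "?b < 1"
      using Moebius_function_norm_lt_1[of s w 0] s w by (simp add: Moebius_function_simple)
    have "cmod (g w) \<le> (M + e) * ?b" using \<open>e > 0\<close> by (intro *) simp
    also have "\<dots> \<le> M * ?b + e" using b \<open>e > 0\<close> by (simp add: distrib_right mult_left_le)
    finally show "cmod (g w) \<le> M * ?b + e" .
  qed
qed

text \<open>Zeros are divided out one at a time. By \<open>Schwarz_Pick_zero\<close> the quotient by
  a Blaschke factor is still bounded by the same \<open>M\<close> off the zero, and by continuity at
  the zero, so the induction hypothesis applies to it.\<close>

lemma Blaschke_bound:
  assumes "finite S" "S \<subseteq> ball 0 1"
    and "g holomorphic_on ball 0 1" "\<And>w. cmod w < 1 \<Longrightarrow> cmod (g w) \<le> M"
    and "\<And>s. s \<in> S \<Longrightarrow> g s = 0" and "cmod w < 1"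
  shows "cmod (g w) \<le> M * (\<Prod>s\<in>S. cmod ((w - s) / (1 - cnj s * w)))"
  using assms
proof (induction S arbitrary: g w rule: finite_induct)
  case empty
  then show ?case by simp
next
  case (insert s S)
  let ?b = "\<lambda>w. (w - s) / (1 - cnj s * w)"
  have s: "cmod s < 1" "g s = 0" using insert.prems by auto
  \<comment> \<open>The quotient of \<open>g\<close> by the Blaschke factor at \<open>s\<close>,
    with the removable singularity filled by the derivative.\<close>
  define h where "h = (\<lambda>w. (if w = s then deriv g s else (g w - g s) / (w - s)) * (1 - cnj s * w))"
  have holh: "h holomorphic_on ball 0 1"
    unfolding h_def by (intro holomorphic_on_mult pole_lemma_open insert.prems holomorphic_intros)
        auto
  have nz: "1 - cnj s * u \<noteq> 0" if "cmod u < 1" for u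
  proof
    assume "1 - cnj s * u = 0"
    then have "cmod (cnj s * u) = 1" by (metis eq_iff_diff_eq_0 norm_one)
    moreover have "cmod s * cmod u < 1 * 1"
      using s that by (intro mult_strict_mono') auto
    ultimately show False by (simp add: norm_mult)
  qed
  have gh: "g u = ?b u * h u" if "cmod u < 1" for u
    using nz[OF that] s by (simp add: h_def)
  have le: "cmod (h u) \<le> M" if u: "cmod u < 1" for u
  proof -
    have 1: "cmod (h v) \<le> M" if v: "cmod v < 1" "v \<noteq> s" for v
    proof -
      have b: "cmod (?b v) > 0" using v nz by auto
      have "cmod (?b v) * cmod (h v) \<le> M * cmod (?b v)"
        using Schwarz_Pick_zero[OF insert.prems(2,3) s v(1)]
        unfolding gh[OF v(1)] norm_mult[of "?b v"] by simp
      then show ?thesis using b by (simp add: mult.commute)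
    qed
    show ?thesis
    proof (cases "u = s")
      case True
      have "continuous (at s) (\<lambda>v. cmod (h v))"
        using holomorphic_on_imp_continuous_on[OF holh] s
        by (intro continuous_norm) (simp add: continuous_on_interior interior_open)
      then have "((\<lambda>v. cmod (h v)) \<longlongrightarrow> cmod (h s)) (at s)" by (simp add: continuous_at)
      moreover have "\<forall>\<^sub>F v in at s. cmod v < 1 \<and> v \<noteq> s"
      proof -
        have "\<forall>\<^sub>F v in at s. v \<in> ball 0 1" using s by (intro eventually_at_in_open') auto
        then show ?thesis using eventually_neq_at_within[of s s UNIV]
          by eventually_elim auto
      qed
      then have "\<forall>\<^sub>F v in at s. cmod (h v) \<le> M" by eventually_elim (use 1 in auto)
      ultimately show ?thesis using True by (auto intro: tendsto_upperbound)
    qed (use 1 u in auto)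
  qed
  have "cmod (h w) \<le> M * (\<Prod>s\<in>S. cmod ((w - s) / (1 - cnj s * w)))"
  proof (rule insert.IH)
    fix t assume t: "t \<in> S"
    then have "cmod t < 1" "t \<noteq> s" "g t = 0" using insert by auto
    then show "h t = 0" using gh[of t] nz[of t] by auto
  qed (use insert.prems le holh in auto)
  then have "cmod (?b w) * cmod (h w)
      \<le> cmod (?b w) * (M * (\<Prod>s\<in>S. cmod ((w - s) / (1 - cnj s * w))))"
    by (intro mult_left_mono) auto
  then show ?case
    unfolding gh[OF insert.prems(5)] norm_mult[of "?b w"] prod.insert[OF insert.hyps(1,2)]
    by (simp only: mult.left_commute)
qed

text \<open>The Cayley transform turns the Blaschke factor of a real zero into the half-plane factor
  with poles reflected in the imaginary axis.\<close>

lemma Cayley_real: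
  assumes "Re z > 0" "s > 0"
  defines "w \<equiv> (z - 1) / (z + 1)" and "t \<equiv> (complex_of_real s - 1) / (of_real s + 1)"
  shows "cmod ((w - t) / (1 - cnj t * w)) = cmod ((z - of_real s) / (z + of_real s))"
proof -
  have nz: "z + 1 \<noteq> 0" "complex_of_real s + 1 \<noteq> 0" "z + of_real s \<noteq> 0"
    using assms(1,2) by (auto simp: complex_eq_iff)
  have "cnj t = t" by (simp add: t_def)
  moreover have "w - t = 2 * (z - of_real s) / ((z + 1) * (of_real s + 1))"
    unfolding w_def t_def using nz by (simp add: field_simps)
  moreover have "1 - t * w = 2 * (z + of_real s) / ((z + 1) * (of_real s + 1))"
    unfolding w_def t_def using nz by (simp add: divide_simps) (simp add: algebra_simps)
  ultimately have "(w - t) / (1 - cnj t * w) = (z - of_real s) / (z + of_real s)"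
    using nz by (simp del: right_diff_distrib_numeral distrib_left_numeral)
  then show ?thesis by simp
qed

lemma Cayley_norm:
  assumes "Re z > 0"
  shows "cmod ((z - 1) / (z + 1)) < 1"
proof -
  have "(cmod (z - 1))\<^sup>2 < (cmod (z + 1))\<^sup>2"
    using assms by (simp only: cmod_power2) (simp add: power2_eq_square algebra_simps)
  then have "cmod (z - 1) < cmod (z + 1)" by (simp add: power_less_imp_less_base)
  moreover from this have "cmod (z + 1) > 0" by (meson le_less_trans norm_ge_zero)
  ultimately show ?thesis by (simp add: norm_divide)
qed

text \<open>The squared modulus is 1 - 4 s Re z / |z + s|^2, and 1 - x <= exp(- x). In exponential
  form a product of such factors is controlled by a sum.\<close>

lemma half_plane_factor_bound:
  assumes "Re z > 0" "s > 0"
  shows "cmod ((z - of_real s) / (z + of_real s)) \<le> exp (- (2 * Re z * s / (cmod z + s)\<^sup>2))"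
proof -
  let ?q = "cmod ((z - of_real s) / (z + of_real s))"
  have p: "cmod (z + of_real s) > 0" using assms by (auto simp: complex_eq_iff)
  have "(cmod (z - of_real s))\<^sup>2 = (cmod (z + of_real s))\<^sup>2 - 4 * Re z * s"
    by (simp only: cmod_power2) (simp add: power2_eq_square algebra_simps)
  then have "?q\<^sup>2 = 1 - 4 * Re z * s / (cmod (z + of_real s))\<^sup>2"
    using p by (simp add: norm_divide power_divide field_simps)
  also have "\<dots> \<le> 1 - 4 * Re z * s / (cmod z + s)\<^sup>2"
  proof -
    have "cmod (z + of_real s) \<le> cmod z + s"
      using norm_triangle_ineq[of z "of_real s"] assms by simp
    then have "(cmod (z + of_real s))\<^sup>2 \<le> (cmod z + s)\<^sup>2" by (intro power_mono) auto
    then show ?thesis using p assms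
      by (intro diff_left_mono divide_left_mono) (auto intro!: mult_pos_pos add_nonneg_pos)
  qed
  also have "\<dots> \<le> exp (- (4 * Re z * s / (cmod z + s)\<^sup>2))"
    using exp_ge_add_one_self[of "- (4 * Re z * s / (cmod z + s)\<^sup>2)"] by simp
  also have "\<dots> = (exp (- (2 * Re z * s / (cmod z + s)\<^sup>2)))\<^sup>2"
    by (simp add: exp_double[symmetric] )
  finally show ?thesis by (rule power2_le_imp_le) simp
qed

lemma not_summable_harmonic_shift: "c > 0 \<Longrightarrow> \<not> summable (\<lambda>j. c / real (Suc j))"
proof
  assume "c > 0" "summable (\<lambda>j. c / real (Suc j))"
  then have "summable (\<lambda>j. inverse (real (Suc j)))"
    using summable_mult[of "\<lambda>j. c / real (Suc j)" "1/c"]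
        by (simp add: field_simps inverse_eq_divide)
  then have "summable (\<lambda>j. inverse (real j))" by (subst (asm) summable_Suc_iff)
  then show False using not_summable_harmonic[where 'a = real] by simp
qed

text \<open>The first \<open>n\<close> zeros give |H(z)| <= M exp(- a (1 + 1/2 + ... + 1/n)) with
  \<open>a > 0\<close> independent of \<open>n\<close>. Divergence of the harmonic series leaves
  only H(z) = 0.\<close>

lemma half_plane_uniqueness_0:
  assumes hol: "H holomorphic_on {z. Re z > 0}" and le: "\<And>z. Re z > 0 \<Longrightarrow> cmod (H z) \<le> M"
    and t: "t > 0" and p: "p > 0" and zeros: "\<And>j::nat. H (of_real (t + p * real j)) = 0"
    and z: "Re z > 0"
  shows "H z = 0"
proof -
  define g where "g = (\<lambda>w. H ((1 + w) / (1 - w)))"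
  define S where "S = (\<lambda>j::nat. t + p * real j)"
  define c where "c = (\<lambda>s. (complex_of_real s - 1) / (of_real s + 1))"
  have S: "S j > 0" for j using t p by (simp add: S_def add_pos_nonneg)
  have inv: "(1 + (u - 1) / (u + 1)) / (1 - (u - 1) / (u + 1)) = u" if "Re u > 0" for u
  proof -
    have "u + 1 \<noteq> 0" using that by (auto simp: complex_eq_iff)
    then show ?thesis by (simp add: divide_simps)
  qed
  have Re: "Re ((1 + w) / (1 - w)) > 0" if "cmod w < 1" for w
  proof -
    have "(Re w)\<^sup>2 + (Im w)\<^sup>2 < 1"
      using that by (simp add: cmod_power2[symmetric] abs_square_less_1)
    moreover have "w \<noteq> 1" using that by auto
    then have "(1 - Re w)\<^sup>2 + (Im w)\<^sup>2 > 0"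
      by (auto simp: sum_power2_gt_zero_iff complex_eq_iff)
    ultimately show ?thesis
      by (simp add: Re_divide power2_eq_square[symmetric] zero_less_divide_iff)
        (simp add: power2_eq_square algebra_simps)
  qed
  have holg: "g holomorphic_on ball 0 1" unfolding g_def
    using Re by (intro holomorphic_on_compose_gen[OF _ hol, unfolded o_def] holomorphic_intros) auto
  have leg: "cmod (g w) \<le> M" if "cmod w < 1" for w
    unfolding g_def using Re[OF that] by (rule le)
  have "c (S j) = c (S k) \<Longrightarrow> j = k" for j k
  proof -
    assume "c (S j) = c (S k)"
    moreover have "Re (complex_of_real (S j)) > 0" "Re (complex_of_real (S k)) > 0" using S by auto
    ultimately have "complex_of_real (S j) = of_real (S k)" unfolding c_def by (metis inv)
    then show "j = k" using p by (simp add: S_def)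
  qed
  then have inj: "inj_on (\<lambda>j. c (S j)) A" for A by (auto intro: inj_onI)
  \<comment> \<open>Two estimates are combined here: \<open>S j \<ge> t\<close> bounds
    \<open>S j / (cmod z + S j)\<close> from below by its value at \<open>t\<close>, and
    \<open>S j \<le> (t + p) * real (Suc j)\<close> produces the harmonic term.\<close>
  define a where "a = 2 * Re z * (t / (cmod z + t))\<^sup>2 / (t + p)"
  have "cmod z + t > 0" using t by (simp add: add_nonneg_pos)
  then have a: "a > 0" unfolding a_def using z t p by (auto intro!: mult_pos_pos divide_pos_pos)
  have bound: "cmod (H z) \<le> M * exp (- (\<Sum>j<n. a / real (Suc j)))" for n
  proof -
    let ?w = "(z - 1) / (z + 1)"
    have "M \<ge> 0" using le[OF z] norm_ge_zero by (rule order_trans[rotated])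
    have "cmod (g ?w) \<le> M * (\<Prod>s\<in>(\<lambda>j. c (S j)) ` {..<n}. cmod ((?w - s) / (1 - cnj s * ?w)))"
    proof (rule Blaschke_bound[OF _ _ holg leg])
      show "(\<lambda>j. c (S j)) ` {..<n} \<subseteq> ball 0 1"
        using Cayley_norm[of "complex_of_real (S _)"] S by (auto simp: c_def)
      fix s assume "s \<in> (\<lambda>j. c (S j)) ` {..<n}"
      then obtain j where s: "s = c (S j)" by auto
      have "Re (complex_of_real (S j)) > 0" using S by auto
      from inv[OF this] show "g s = 0" using zeros[of j] by (simp add: g_def s c_def S_def)
    qed (use Cayley_norm[OF z] in auto)
    also have "(\<Prod>s\<in>(\<lambda>j. c (S j)) ` {..<n}. cmod ((?w - s) / (1 - cnj s * ?w)))
        = (\<Prod>j<n. cmod ((z - of_real (S j)) / (z + of_real (S j))))"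
      unfolding prod.reindex[OF inj] o_def unfolding c_def
      by (intro prod.cong refl Cayley_real z S)
    also have "\<dots> \<le> (\<Prod>j<n. exp (- (a / real (Suc j))))"
    proof (intro prod_mono conjI norm_ge_zero)
      fix j
      have "a / real (Suc j) \<le> 2 * Re z * S j / (cmod z + S j)\<^sup>2"
      proof -
        have "t / (cmod z + t) \<le> S j / (cmod z + S j)"
        proof -
          have "t * cmod z \<le> S j * cmod z"
            using p by (intro mult_right_mono) (auto simp: S_def)
          then show ?thesis
            using \<open>cmod z + t > 0\<close> S[of j] add_nonneg_pos[OF norm_ge_zero[of z] S[of j]]
            by (simp add: pos_divide_le_eq pos_le_divide_eq distrib_left mult.commute)
        qed
        then have "(t / (cmod z + t))\<^sup>2 \<le> (S j / (cmod z + S j))\<^sup>2"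
          using t by (intro power_mono) auto
        moreover have "S j \<le> (t + p) * real (Suc j)"
          using t p by (simp add: S_def algebra_simps)
        ultimately have "2 * Re z * (t / (cmod z + t))\<^sup>2 / ((t + p) * real (Suc j))
            \<le> 2 * Re z * (S j / (cmod z + S j))\<^sup>2 / S j"
          using z S[of j] t p by (intro frac_le mult_left_mono mult_nonneg_nonneg) auto
        also have "\<dots> = 2 * Re z * S j / (cmod z + S j)\<^sup>2"
          using S[of j] by (simp add: power2_eq_square)
        finally show ?thesis by (simp add: a_def)
      qed
      then have "exp (- (2 * Re z * S j / (cmod z + S j)\<^sup>2)) \<le> exp (- (a / real (Suc j)))" by simp
      with half_plane_factor_bound[OF z S[of j]]
      show "cmod ((z - of_real (S j)) / (z + of_real (S j))) \<le> exp (- (a / real (Suc j)))"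
        by linarith
    qed
    finally have "cmod (g ?w) \<le> M * (\<Prod>j<n. exp (- (a / real (Suc j))))"
      using \<open>M \<ge> 0\<close> by (simp add: mult_left_mono)
    then show ?thesis by (simp add: g_def inv[OF z] exp_sum[symmetric] sum_negf)
  qed
  show ?thesis
  proof (rule ccontr)
    assume nz: "H z \<noteq> 0"
    \<comment> \<open>If \<open>H z\<close> were nonzero, taking logarithms in \<open>bound\<close>
      would bound the partial sums of a harmonic series by \<open>B\<close>.\<close>
    define B where "B = ln (M / cmod (H z))"
    have "summable (\<lambda>j. a / real (Suc j))"
    proof (rule bounded_imp_summable[where B = B])
      fix n
      let ?s = "\<Sum>j<Suc n. a / real (Suc j)"
      have "M > 0" using nz bound[of 0] by (simp add: less_le_trans[of 0 "cmod (H z)"])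
      have "exp ?s \<le> M / cmod (H z)"
        using bound[of "Suc n"] nz by (simp add: exp_minus field_simps)
      then have "?s \<le> B" unfolding B_def using nz \<open>M > 0\<close> by (subst ln_ge_iff) auto
      then show "(\<Sum>j\<le>n. a / real (Suc j)) \<le> B" by (simp only: lessThan_Suc_atMost)
    qed (use a in \<open>simp add: less_imp_le\<close>)
    then show False using not_summable_harmonic_shift[OF a] by blast
  qed
qed

text \<open>Polynomial growth is divided away by \<open>z ^ L\<close>, which has no zero in the
  half-plane because \<open>\<sigma> \<ge> 0\<close>; a translation then gives the previous
  lemma.\<close>

lemma half_plane_uniqueness:
  assumes hol: "H holomorphic_on {z. Re z > \<sigma>}" and \<sigma>: "\<sigma> \<ge> 0"
    and le: "\<And>z. Re z > \<sigma> \<Longrightarrow> cmod (H z) \<le> M * cmod z ^ L"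
    and t: "t > \<sigma>" and p: "p > 0" and zeros: "\<And>j::nat. H (of_real (t + p * real j)) = 0"
    and z: "Re z > \<sigma>"
  shows "H z = 0"
proof -
  define h where "h = (\<lambda>z. H (z + of_real \<sigma>) / (z + of_real \<sigma>) ^ L)"
  have nz: "z + of_real \<sigma> \<noteq> 0" if "Re z > 0" for z
    using that \<sigma> by (auto simp: complex_eq_iff)
  have "h (z - of_real \<sigma>) = 0"
  proof (rule half_plane_uniqueness_0[OF _ _ _ p, where t = "t - \<sigma>" and M = M and H = h and z
      = "z - of_real \<sigma>"])
    show "h holomorphic_on {z. 0 < Re z}" unfolding h_def
      by (intro holomorphic_intros holomorphic_on_compose_gen[OF _ hol, unfolded o_def])
          (use nz in auto)
    show "cmod (h z) \<le> M" if "Re z > 0" for z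
      using le[of "z + of_real \<sigma>"] nz[OF that] that
          by (simp add: h_def norm_divide norm_power field_simps)
    show "t - \<sigma> > 0" "Re (z - of_real \<sigma>) > 0" using t z by auto
    show "h (of_real (t - \<sigma> + p * real j)) = 0" for j
      using zeros[of j] by (simp add: h_def)
  qed
  then show ?thesis using nz[of "z - of_real \<sigma>"] z by (auto simp: h_def)
qed

section \<open>Gamma ratios\<close>

text \<open>Gamma is the limit of \<open>Gamma_series\<close>, and there the bound holds factor by
  factor: since \<alpha> <= \<beta>, each |w + \<beta> + j| / |w + \<alpha> + j| is at most its
  counterpart at the real point \<open>x0\<close>. This gives uniformity in the half-plane without
  asymptotics.\<close>

lemma Gamma_ratio_bound:
  fixes \<alpha> \<beta> x0 :: real and w :: complex
  assumes "\<alpha> \<le> \<beta>" "x0 + \<alpha> > 0" "Re w \<ge> x0"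
  shows "cmod (Gamma (w + of_real \<alpha>) / Gamma (w + of_real \<beta>)) \<le> Gamma (x0 + \<alpha>) / Gamma (x0 + \<beta>)"
proof (rule tendsto_le[OF sequentially_bot])
  have nz: "w + of_real \<beta> \<notin> \<int>\<^sub>\<le>\<^sub>0"
    using assms by (auto elim!: nonpos_Ints_cases simp: complex_eq_iff)
  have nz': "x0 + \<beta> \<notin> \<int>\<^sub>\<le>\<^sub>0"
    using assms by (auto elim!: nonpos_Ints_cases)
  show "(\<lambda>n. cmod (Gamma_series (w + of_real \<alpha>) n / Gamma_series (w + of_real \<beta>) n))
       \<longlonglongrightarrow> cmod (Gamma (w + of_real \<alpha>) / Gamma (w + of_real \<beta>))"
    using nz by (intro tendsto_intros Gamma_series_LIMSEQ) (simp add: Gamma_eq_zero_iff)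
  show "(\<lambda>n. Gamma_series (x0 + \<alpha>) n / Gamma_series (x0 + \<beta>) n)
       \<longlonglongrightarrow> Gamma (x0 + \<alpha>) / Gamma (x0 + \<beta>)"
    using nz' by (intro tendsto_intros Gamma_series_LIMSEQ) (simp add: Gamma_eq_zero_iff)
  show "\<forall>\<^sub>F n in sequentially. cmod (Gamma_series (w + of_real \<alpha>) n
      / Gamma_series (w + of_real \<beta>) n)
      \<le> Gamma_series (x0 + \<alpha>) n / Gamma_series (x0 + \<beta>) n"
  proof (intro always_eventually allI)
    fix n
    \<comment> \<open>The quotient of the exponential factors of the two series; its modulus does
      not depend on \<open>w\<close>.\<close>
    define E where "E = exp ((\<alpha> - \<beta>) * ln (real n))"
    have pz: "w + of_real \<alpha> + of_nat j \<noteq> 0" "w + of_real \<beta> + of_nat j \<noteq> 0" for j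
      using assms by (auto simp: complex_eq_iff)
    have pr: "x0 + \<alpha> + of_nat j > 0" "x0 + \<beta> + of_nat j > 0" for j
      using assms by auto
    have "cmod (exp ((w + of_real \<alpha>) * of_real (ln (real n))))
        / cmod (exp ((w + of_real \<beta>) * of_real (ln (real n)))) = E"
      unfolding E_def by (simp add: exp_diff[symmetric] algebra_simps)
    then have "cmod (Gamma_series (w + of_real \<alpha>) n / Gamma_series (w + of_real \<beta>) n)
       = E * (cmod (pochhammer (w + of_real \<beta>) (n + 1))
           / cmod (pochhammer (w + of_real \<alpha>) (n + 1)))"
      unfolding Gamma_series_def norm_divide norm_mult by (auto simp: field_simps)
    also have "cmod (pochhammer (w + of_real \<beta>) (n + 1)) / cmod (pochhammer (w + of_real \<alpha>) (n + 1))
      = (\<Prod>j<n+1. cmod (w + of_real \<beta> + of_nat j) / cmod (w + of_real \<alpha> + of_nat j))"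
      unfolding pochhammer_prod prod_norm[symmetric] prod_dividef by (simp add: atLeast0LessThan)
    also have "\<dots> \<le> (\<Prod>j<n+1. (x0 + \<beta> + of_nat j) / (x0 + \<alpha> + of_nat j))"
    proof (intro prod_mono conjI)
      fix j
      let ?u = "w + of_real \<alpha> + of_nat j"
      have u: "x0 + \<alpha> + of_nat j \<le> cmod ?u"
        using complex_Re_le_cmod[of ?u] assms by simp
      have "cmod (w + of_real \<beta> + of_nat j) \<le> cmod ?u + (\<beta> - \<alpha>)"
        using norm_triangle_ineq[of ?u "of_real (\<beta> - \<alpha>)"] assms(1)
        unfolding norm_of_real by (simp add: algebra_simps)
      then have "cmod (w + of_real \<beta> + of_nat j) / cmod ?u \<le> 1 + (\<beta> - \<alpha>) / cmod ?u"
        using pz(1)[of j] by (simp add: field_simps)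
      also have "\<dots> \<le> 1 + (\<beta> - \<alpha>) / (x0 + \<alpha> + of_nat j)"
        using u pr(1)[of j] assms(1) by (intro add_left_mono divide_left_mono mult_pos_pos) auto
      also have "\<dots> = (x0 + \<beta> + of_nat j) / (x0 + \<alpha> + of_nat j)"
        using pr(1)[of j] by (simp add: field_simps)
      finally show "cmod (w + of_real \<beta> + of_nat j) / cmod ?u
          \<le> (x0 + \<beta> + of_nat j) / (x0 + \<alpha> + of_nat j)" .
    qed auto
    also have "\<dots> = pochhammer (x0 + \<beta>) (n + 1) / pochhammer (x0 + \<alpha>) (n + 1)"
      unfolding pochhammer_prod prod_dividef by (simp add: atLeast0LessThan)
    also have "E * \<dots> = Gamma_series (x0 + \<alpha>) n / Gamma_series (x0 + \<beta>) n"
    proof -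
      have "exp ((x0 + \<alpha>) * ln (real n)) / exp ((x0 + \<beta>) * ln (real n)) = E"
        unfolding E_def by (simp add: exp_diff[symmetric] algebra_simps)
      then show ?thesis unfolding Gamma_series_def by (auto simp: field_simps)
    qed
    finally show "cmod (Gamma_series (w + of_real \<alpha>) n / Gamma_series (w + of_real \<beta>) n)
      \<le> Gamma_series (x0 + \<alpha>) n / Gamma_series (x0 + \<beta>) n"
      by (simp add: E_def mult_left_mono)
  qed
qed

section \<open>The Mellin transform of an integrable function\<close>

abbreviation unit_leb :: "real measure" where
  "unit_leb \<equiv> lebesgue_on {0..1}"

text \<open>A normalization in which integrability of \<open>g\<close> matches Re s >= 0. The weight
  \<open>r\<close> and the shift by 2 relating it to \<open>mellin\<close> come from the area
  element r dr.\<close>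

definition unit_mellin :: "(real \<Rightarrow> complex) \<Rightarrow> complex \<Rightarrow> complex" where
  "unit_mellin g s = (LINT r|unit_leb. g r * of_real r powr s)"

lemma mellin_eq_unit_mellin: "mellin \<phi> z = unit_mellin (\<lambda>r. of_real r * \<phi> r) (z - 2)"
  unfolding mellin_def unit_mellin_def
proof (rule Bochner_Integration.integral_cong)
  fix r :: real
  have "of_real r powr (z - 1) = of_real r powr (z - 2) * of_real r powr 1"
    using powr_add[of "complex_of_real r" "z - 2" 1] by simp
  then show "\<phi> r * of_real r powr (z - 1) = of_real r * \<phi> r * of_real r powr (z - 2)"
    by (cases "r = 0") auto
qed simp

lemma powr_measurable_unit [measurable]:
    "(\<lambda>r. complex_of_real r powr s) \<in> borel_measurable unit_leb"
  by (intro measurable_restrict_space1 measurable_completion) measurable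

lemma norm_of_real_powr_le_1:
  assumes "0 \<le> r" "r \<le> 1" "Re s \<ge> 0"
  shows "cmod (of_real r powr s) \<le> 1"
proof (cases "r = 0")
  case False
  then have "cmod (of_real r powr s) = r powr Re s"
    using assms by (simp add: norm_powr_real_powr)
  then show ?thesis using assms powr_le1[of "Re s" r] by simp
qed auto

lemma integrable_unit_mellin:
  assumes "integrable unit_leb g" "Re s \<ge> 0"
  shows "integrable unit_leb (\<lambda>r. g r * of_real r powr s)"
proof (rule Bochner_Integration.integrable_bound[OF integrable_norm[OF assms(1)]])
  have [measurable]: "g \<in> borel_measurable unit_leb" using assms(1) by auto
  show "(\<lambda>r. g r * of_real r powr s) \<in> borel_measurable unit_leb" by measurable
  show "AE r in unit_leb. norm (g r * of_real r powr s) \<le> norm (norm (g r))"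
    using norm_of_real_powr_le_1[OF _ _ assms(2)]
    by (intro AE_I2) (auto simp: norm_mult mult_left_le)
qed

lemma unit_mellin_bound:
  assumes "integrable unit_leb g" "Re s \<ge> 0"
  shows "cmod (unit_mellin g s) \<le> (LINT r|unit_leb. cmod (g r))"
proof -
  have "cmod (unit_mellin g s) \<le> (LINT r|unit_leb. cmod (g r * of_real r powr s))"
    unfolding unit_mellin_def by (rule integral_norm_bound)
  also have "\<dots> \<le> (LINT r|unit_leb. cmod (g r))"
    using integrable_unit_mellin[OF assms] assms(1) norm_of_real_powr_le_1[OF _ _ assms(2)]
    by (intro integral_mono integrable_norm) (auto simp: norm_mult mult_left_le)
  finally show ?thesis .
qed

text \<open>Dominated convergence with majorant |g| works up to and including the line Re s = 0;
  this is what carries identities to the boundary Re z = 2.\<close>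

lemma unit_mellin_tendsto:
  assumes g: "integrable unit_leb g" and s: "\<And>n. Re (s n) \<ge> 0" "s \<longlonglongrightarrow> a"
  shows "(\<lambda>n. unit_mellin g (s n)) \<longlonglongrightarrow> unit_mellin g a"
  unfolding unit_mellin_def
proof (rule integral_dominated_convergence)
  have [measurable]: "g \<in> borel_measurable unit_leb" using g by auto
  show "(\<lambda>r. g r * of_real r powr a) \<in> borel_measurable unit_leb"
    "\<And>i. (\<lambda>r. g r * of_real r powr s i) \<in> borel_measurable unit_leb" by measurable
  show "integrable unit_leb (\<lambda>r. cmod (g r))" using g by (rule integrable_norm)
  show "AE r in unit_leb. (\<lambda>i. g r * of_real r powr s i) \<longlonglongrightarrow> g r * of_real r powr a"
  proof (intro AE_I2)
    fix r :: real
    show "(\<lambda>i. g r * of_real r powr s i) \<longlonglongrightarrow> g r * of_real r powr a"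
      using s(2) by (cases "r = 0") (auto simp: powr_def intro!: tendsto_intros)
  qed
  show "AE r in unit_leb. norm (g r * of_real r powr s i) \<le> cmod (g r)" for i
    using norm_of_real_powr_le_1[OF _ _ s(1)]
    by (intro AE_I2) (auto simp: norm_mult mult_left_le)
qed

text \<open>Expanding r^w = r^s0 exp((w - s0) ln r) and integrating term by term gives a power
  series on the ball of radius Re s0 around s0. These balls cover the right half-plane.\<close>

lemma unit_mellin_holomorphic:
  assumes g: "integrable unit_leb g"
  shows "unit_mellin g holomorphic_on {s. Re s > 0}"
proof -
  have gm [measurable]: "g \<in> borel_measurable unit_leb" using g by auto
  have lnm [measurable]: "(\<lambda>r. complex_of_real (ln r)) \<in> borel_measurable unit_leb"
    by (intro measurable_restrict_space1 measurable_completion) measurable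
  have *: "unit_mellin g holomorphic_on ball s0 (Re s0)" if s0: "Re s0 > 0" for s0
  proof (rule power_series_holomorphic)
    define u where "u = (\<lambda>n r. of_real r powr s0 * of_real (ln r) ^ n / fact n)"
    define a where "a = (\<lambda>n. LINT r|unit_leb. g r * u n r)"
    have [measurable]: "u n \<in> borel_measurable unit_leb" for n unfolding u_def by measurable
    have norm_u: "cmod (u n r) = r powr Re s0 * \<bar>ln r\<bar> ^ n / fact n" if "0 \<le> r" "r \<le> 1" for n r
      using that by (cases "r = 0")
          (auto simp: u_def norm_mult norm_divide norm_power norm_powr_real_powr)
    \<comment> \<open>For d <= Re s0 the full sum is r^(Re s0) exp(d |ln r|) <= 1. This one estimate
      yields both integrability of the terms and the majorant |g| for the partial sums.\<close>
    have sum_le: "(\<Sum>n<N. d ^ n * cmod (u n r)) \<le> 1" if "0 \<le> r" "r \<le> 1" "0 \<le> d" "d \<le> Re s0" for N r d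
    proof (cases "r = 0")
      case False
      then have r: "0 < r" "r \<le> 1" using that by auto
      have "(\<Sum>n<N. d ^ n * cmod (u n r)) = r powr Re s0 * (\<Sum>n<N. (d * \<bar>ln r\<bar>) ^ n / fact n)"
        using that by (simp add: norm_u sum_distrib_left power_mult_distrib algebra_simps)
      also have "(\<Sum>n<N. (d * \<bar>ln r\<bar>) ^ n / fact n) \<le> exp (d * \<bar>ln r\<bar>)"
        using that summable_exp_generic[of "d * \<bar>ln r\<bar>"]
        unfolding exp_def by (simp add: divide_inverse mult.commute) (intro sum_le_suminf, auto)
      also have "exp (d * \<bar>ln r\<bar>) \<le> exp (Re s0 * \<bar>ln r\<bar>)"
        using that by (simp add: mult_right_mono)
      also have "r powr Re s0 * exp (Re s0 * \<bar>ln r\<bar>) = 1"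
        using r by (simp add: powr_def exp_add[symmetric])
      finally show ?thesis by (simp add: mult_left_mono)
    qed (simp add: u_def)
    have int: "integrable unit_leb (\<lambda>r. g r * u n r)" for n
    proof (rule Bochner_Integration.integrable_bound)
      show "integrable unit_leb (\<lambda>r. inverse (Re s0 ^ n) * cmod (g r))"
        using g by (intro integrable_mult_right integrable_norm)
      show "AE r in unit_leb. norm (g r * u n r) \<le> norm (inverse (Re s0 ^ n) * cmod (g r))"
      proof (intro AE_I2)
        fix r assume "r \<in> space unit_leb"
        then have r: "0 \<le> r" "r \<le> 1" by auto
        have "Re s0 ^ n * cmod (u n r) \<le> (\<Sum>n<Suc n. Re s0 ^ n * cmod (u n r))"
          using s0 by (subst sum.lessThan_Suc) (simp add: sum_nonneg)
        also have "\<dots> \<le> 1" by (rule sum_le[OF r]) (use s0 in auto)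
        finally have "cmod (u n r) \<le> inverse (Re s0 ^ n)"
          using s0 by (simp add: field_simps)
        then show "norm (g r * u n r) \<le> norm (inverse (Re s0 ^ n) * cmod (g r))"
          using s0 by (simp add: norm_mult mult.commute mult_left_mono)
      qed
    qed measurable
    fix w assume w: "w \<in> ball s0 (Re s0)"
    define d where "d = cmod (w - s0)"
    have d: "0 \<le> d" "d \<le> Re s0" using w by (auto simp: d_def dist_norm norm_minus_commute)
    have "(\<lambda>N. LINT r|unit_leb. (\<Sum>n<N. (g r * u n r) * (w - s0) ^ n)) \<longlonglongrightarrow> unit_mellin g w"
      unfolding unit_mellin_def
    proof (rule integral_dominated_convergence)
      show "(\<lambda>r. g r * of_real r powr w) \<in> borel_measurable unit_leb"
        "\<And>i. (\<lambda>r. \<Sum>n<i. g r * u n r * (w - s0) ^ n) \<in> borel_measurable unit_leb" by measurable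
      show "integrable unit_leb (\<lambda>r. cmod (g r))" using g by (rule integrable_norm)
      show "AE r in unit_leb. (\<lambda>i. \<Sum>n<i. g r * u n r * (w - s0) ^ n) \<longlonglongrightarrow> g r * of_real r powr w"
      proof (intro AE_I2)
        fix r assume "r \<in> space unit_leb"
        then have r: "0 \<le> r" "r \<le> 1" by auto
        have "(\<lambda>n. ((w - s0) * of_real (ln r)) ^ n /\<^sub>R fact n) sums exp ((w - s0) * of_real (ln r))"
          by (rule exp_converges)
        then have "(\<lambda>n. g r * of_real r powr s0 * (((w - s0) * of_real (ln r)) ^ n /\<^sub>R fact n)) sums
            (g r * of_real r powr s0 * exp ((w - s0) * of_real (ln r)))"
          by (rule sums_mult)
        also have "g r * of_real r powr s0 * exp ((w - s0) * of_real (ln r))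
            = g r * of_real r powr w"
        proof (cases "r = 0")
          case False
          then show ?thesis
            using r by (simp add: powr_def Ln_of_real exp_add[symmetric] algebra_simps)
        qed auto
        also have "(\<lambda>n. g r * of_real r powr s0 * (((w - s0) * of_real (ln r)) ^ n /\<^sub>R fact n))
          = (\<lambda>n. g r * u n r * (w - s0) ^ n)"
          by (auto simp: u_def fun_eq_iff power_mult_distrib scaleR_conv_of_real divide_inverse
              mult_ac)
        finally show "(\<lambda>i. \<Sum>n<i. g r * u n r * (w - s0) ^ n) \<longlonglongrightarrow> g r * of_real r powr w"
          by (simp add: sums_def)
      qed
      show "AE r in unit_leb. norm (\<Sum>n<i. g r * u n r * (w - s0) ^ n) \<le> cmod (g r)" for i
      proof (intro AE_I2)
        fix r assume "r \<in> space unit_leb"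
        then have r: "0 \<le> r" "r \<le> 1" by auto
        have "norm (\<Sum>n<i. g r * u n r * (w - s0) ^ n) \<le> (\<Sum>n<i. cmod (g r) * (d ^ n * cmod (u n r)))"
          by (intro sum_norm_le) (simp add: norm_mult norm_power d_def mult_ac)
        also have "\<dots> = cmod (g r) * (\<Sum>n<i. d ^ n * cmod (u n r))" by (simp add: sum_distrib_left)
        also have "\<dots> \<le> cmod (g r) * 1" by (intro mult_left_mono sum_le r d) auto
        finally show "norm (\<Sum>n<i. g r * u n r * (w - s0) ^ n) \<le> cmod (g r)" by simp
      qed
    qed
    moreover have "(LINT r|unit_leb. (\<Sum>n<N. (g r * u n r) * (w - s0) ^ n))
        = (\<Sum>n<N. a n * (w - s0) ^ n)" for N
      by (subst Bochner_Integration.integral_sum) (auto simp: a_def int)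
    ultimately show "(\<lambda>n. a n * (w - s0) ^ n) sums unit_mellin g w"
      by (simp add: sums_def)
  qed
  have "unit_mellin g holomorphic_on (\<Union>s0\<in>{s. Re s > 0}. ball s0 (Re s0))"
    by (rule holomorphic_on_UN_open) (use * in auto)
  then show ?thesis by (rule holomorphic_on_subset) auto
qed

text \<open>Zero moments annihilate polynomials, hence continuous functions by Weierstrass, hence
  indicators of rays by dominated convergence. The positive and negative parts of \<open>h\<close>
  are then densities of the same measure.\<close>

lemma moments_zero_real:
  fixes h :: "real \<Rightarrow> real"
  assumes h: "integrable unit_leb h" and mom: "\<And>n::nat. (LINT r|unit_leb. h r * r ^ n) = 0"
  shows "AE r in unit_leb. h r = 0"
proof -
  have [measurable]: "h \<in> borel_measurable unit_leb" using h by auto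
  have bint: "integrable unit_leb (\<lambda>r. h r * f r)"
    if "f \<in> borel_measurable borel" "\<And>r. r \<in> {0..1} \<Longrightarrow> \<bar>f r\<bar> \<le> B" for f B
  proof (rule Bochner_Integration.integrable_bound)
    have "B \<ge> 0" using that(2)[of 0] by auto
    show "integrable unit_leb (\<lambda>r. B * norm (h r))" using h
        by (intro integrable_mult_right integrable_norm)
    have [measurable]: "f \<in> borel_measurable unit_leb"
      by (intro measurable_restrict_space1 measurable_completion) (use that in auto)
    show "(\<lambda>r. h r * f r) \<in> borel_measurable unit_leb" by measurable
    show "AE r in unit_leb. norm (h r * f r) \<le> norm (B * norm (h r))"
      using that(2) \<open>B \<ge> 0\<close>
          by (intro AE_I2) (auto simp: abs_mult mult.commute[of "\<bar>h _\<bar>"] intro!: mult_right_mono)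
  qed
  have poly: "(LINT r|unit_leb. h r * f r) = 0" if fp: "real_polynomial_function f" for f
  proof -
    obtain a n where f: "f = (\<lambda>x. \<Sum>i\<le>n. a i * x ^ i)"
      using fp unfolding real_polynomial_function_iff_sum by blast
    have 1: "integrable unit_leb (\<lambda>r. h r * r ^ i)" for i
      by (rule bint[of _ 1]) (auto simp: power_le_one)
    have "(LINT r|unit_leb. h r * f r) = (LINT r|unit_leb. (\<Sum>i\<le>n. a i * (h r * r ^ i)))"
      unfolding f by (simp add: sum_distrib_left mult_ac)
    also have "\<dots> = 0" using 1 by (subst Bochner_Integration.integral_sum) (auto simp: mom)
    finally show ?thesis .
  qed
  have cont: "(LINT r|unit_leb. h r * f r) = 0" if f: "continuous_on UNIV f" for f
  proof (rule ccontr)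
    assume nz: "(LINT r|unit_leb. h r * f r) \<noteq> 0"
    define I where "I = (LINT r|unit_leb. \<bar>h r\<bar>)"
    have "I \<ge> 0" unfolding I_def by simp
    \<comment> \<open>Chosen so that \<open>e * I\<close> stays below the integral assumed nonzero;
      the added 1 covers \<open>I = 0\<close>.\<close>
    define e where "e = \<bar>LINT r|unit_leb. h r * f r\<bar> / (I + 1)"
    have e: "e > 0" using nz \<open>I \<ge> 0\<close> by (simp add: e_def)
    obtain p where p: "real_polynomial_function p" "\<And>x. x \<in> {0..1} \<Longrightarrow> \<bar>f x - p x\<bar> < e"
      using Stone_Weierstrass_real_polynomial_function[of "{0..1}" f e] e continuous_on_subset[OF f]
          by auto
    have pc: "continuous_on UNIV p"
      using p(1) continuous_real_polymonial_function by (auto simp: continuous_on_eq_continuous_at)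
    have m: "f \<in> borel_measurable borel" "p \<in> borel_measurable borel"
      using f pc by (auto intro: borel_measurable_continuous_onI)
    have ex: "\<exists>B. \<forall>r\<in>{0..1}. \<bar>q r\<bar> \<le> B" if "continuous_on UNIV q" for q :: "real \<Rightarrow> real"
      using compact_imp_bounded[OF
          compact_continuous_image[OF continuous_on_subset[OF that] compact_Icc[of 0 1]]]
      by (auto simp: bounded_iff)
    obtain Bf Bp where "\<forall>r\<in>{0..1}. \<bar>f r\<bar> \<le> Bf" "\<forall>r\<in>{0..1}. \<bar>p r\<bar> \<le> Bp"
      using ex[OF f] ex[OF pc] by blast
    then have i1: "integrable unit_leb (\<lambda>r. h r * f r)"
        and i2: "integrable unit_leb (\<lambda>r. h r * p r)"
      using bint m by blast+
    have "(LINT r|unit_leb. h r * f r) = (LINT r|unit_leb. h r * f r - h r * p r)"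
      using i1 i2 poly[OF p(1)] by (subst Bochner_Integration.integral_diff) auto
    also have "\<bar>\<dots>\<bar> \<le> (LINT r|unit_leb. \<bar>h r * f r - h r * p r\<bar>)"
      using integral_norm_bound[of unit_leb "\<lambda>r. h r * f r - h r * p r"] by simp
    also have "\<dots> \<le> (LINT r|unit_leb. e * \<bar>h r\<bar>)"
    proof (rule integral_mono)
      fix r assume "r \<in> space unit_leb"
      then have "\<bar>f r - p r\<bar> \<le> e" using p(2)[of r] by auto
      then have "\<bar>h r\<bar> * \<bar>f r - p r\<bar> \<le> \<bar>h r\<bar> * e" by (rule mult_left_mono) auto
      then show "\<bar>h r * f r - h r * p r\<bar> \<le> e * \<bar>h r\<bar>"
        by (simp add: abs_mult[symmetric] algebra_simps)
    qed (use i1 i2 h in auto)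
    also have "\<dots> = e * I" unfolding I_def by simp
    also have "e * I < \<bar>LINT r|unit_leb. h r * f r\<bar>"
      using \<open>I \<ge> 0\<close> nz by (simp add: e_def field_simps)
    finally show False by simp
  qed
  have ind: "(LINT r|unit_leb. h r * indicator {a<..} r) = 0" for a
  proof (rule LIMSEQ_unique)
    \<comment> \<open>Continuous ramps, steepening to the indicator of the ray.\<close>
    define f where "f = (\<lambda>n r. min 1 (max 0 (real n * (r - a))))"
    have fc: "continuous_on UNIV (f n)" for n unfolding f_def by (intro continuous_intros)
    show "(\<lambda>n. LINT r|unit_leb. h r * f n r) \<longlonglongrightarrow> (LINT r|unit_leb. h r * indicator {a<..} r)"
    proof (rule integral_dominated_convergence)
      have [measurable]: "f n \<in> borel_measurable unit_leb" for n
        by (intro measurable_restrict_space1 measurable_completion)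
            (auto simp: borel_measurable_continuous_onI[OF fc])
      have [measurable]: "indicator {a<..} \<in> borel_measurable unit_leb"
        by (intro measurable_restrict_space1 measurable_completion) auto
      show "(\<lambda>r. h r * indicator {a<..} r) \<in> borel_measurable unit_leb"
        "\<And>n. (\<lambda>r. h r * f n r) \<in> borel_measurable unit_leb" by measurable
      show "integrable unit_leb (\<lambda>r. \<bar>h r\<bar>)" using h by simp
      show "AE r in unit_leb. norm (h r * f n r) \<le> \<bar>h r\<bar>" for n
        by (intro AE_I2) (auto simp: abs_mult f_def intro!: mult_left_le)
      show "AE r in unit_leb. (\<lambda>n. h r * f n r) \<longlonglongrightarrow> h r * indicator {a<..} r"
      proof (intro AE_I2 tendsto_intros)
        fix r
        show "(\<lambda>n. f n r) \<longlonglongrightarrow> indicator {a<..} r"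
        proof (cases "r > a")
          case True
          then have "\<forall>\<^sub>F n in sequentially. real n * (r - a) \<ge> 1" by real_asymp
          then have "\<forall>\<^sub>F n in sequentially. f n r = indicator {a<..} r"
            by eventually_elim (use True in \<open>auto simp: f_def\<close>)
          then show ?thesis by (rule tendsto_eventually)
        next
          case False
          then have "real n * (r - a) \<le> 0" for n by (intro mult_nonneg_nonpos) auto
          then have "f n r = indicator {a<..} r" for n using False by (simp add: f_def)
          then show ?thesis by simp
        qed
      qed
    qed
    show "(\<lambda>n. LINT r|unit_leb. h r * f n r) \<longlonglongrightarrow> 0"
      by (simp add: cont fc)
  qed
  let ?g = "\<lambda>r. indicator {0..1} r * h r"
  have g: "integrable lebesgue ?g"
    using h by (subst (asm) integrable_restrict_space) auto
  then obtain h' where h' [measurable]: "h' \<in> borel_measurable lborel"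
      and AE: "AE r in lborel. ?g r = h' r"
    using completion_ex_borel_measurable_real[OF borel_measurable_integrable[OF g]] by blast
  have AE': "AE r in lebesgue. ?g r = h' r" by (rule AE_completion[OF AE])
  have "integrable lebesgue h'"
    by (rule integrable_cong_AE_imp[OF g measurable_completion[OF h']])
        (use AE' in \<open>auto elim!: eventually_mono\<close>)
  then have hint: "integrable lborel h'"
    by (subst (asm) integrable_completion) auto
  have zero: "(LINT r|lborel. h' r * indicator {a<..} r) = 0" for a
  proof -
    have "(LINT r|lborel. h' r * indicator {a<..} r) = (LINT r|lebesgue. h' r * indicator {a<..} r)"
      by (rule integral_completion[symmetric]) measurable
    also have "\<dots> = (LINT r|lebesgue. ?g r * indicator {a<..} r)"
    proof (rule integral_cong_AE)
      have ind: "(indicator {a<..} :: real \<Rightarrow> real) \<in> borel_measurable lebesgue"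
        by (intro measurable_completion) auto
      show "(\<lambda>r. h' r * indicator {a<..} r) \<in> borel_measurable lebesgue"
        by (intro borel_measurable_times ind measurable_completion[OF h'])
      show "(\<lambda>r. ?g r * indicator {a<..} r) \<in> borel_measurable lebesgue"
        by (intro borel_measurable_times[OF _ ind] borel_measurable_integrable[OF g])
    qed (use AE' in \<open>auto elim!: eventually_mono\<close>)
    also have "\<dots> = (LINT r|unit_leb. h r * indicator {a<..} r)"
      by (subst integral_restrict_space) (auto simp: mult_ac)
    finally show ?thesis by (simp add: ind)
  qed
  \<comment> \<open>\<open>ennreal\<close> truncates negative values to 0, so the two densities are
    the positive and negative parts of \<open>h'\<close>.\<close>
  have "density lborel (\<lambda>r. ennreal (h' r)) = density lborel (\<lambda>r. ennreal (- h' r))"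
  proof (rule measure_eqI_lessThan)
    fix a
    let ?k = "\<lambda>r. h' r * indicator {a<..} r"
    have k: "integrable lborel ?k" using integrable_mult_indicator[of "{a<..}" lborel h'] hint
        by (simp add: mult.commute)
    have 1: "emeasure (density lborel (\<lambda>r. ennreal (h' r))) {a<..} = (\<integral>\<^sup>+r. ennreal (?k r) \<partial>lborel)"
      by (subst emeasure_density) (auto intro!: nn_integral_cong simp: indicator_def)
    have 2: "emeasure (density lborel (\<lambda>r. ennreal (- h' r))) {a<..}
        = (\<integral>\<^sup>+r. ennreal (- ?k r) \<partial>lborel)"
      by (subst emeasure_density) (auto intro!: nn_integral_cong simp: indicator_def)
    have f: "(\<integral>\<^sup>+r. ennreal (?k r) \<partial>lborel) \<noteq> \<infinity>" "(\<integral>\<^sup>+r. ennreal (- ?k r) \<partial>lborel) \<noteq> \<infinity>"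
      using k by (auto simp: real_integrable_def)
    then show "emeasure (density lborel (\<lambda>r. ennreal (h' r))) {a<..} < \<infinity>"
      by (simp add: 1 less_top)
    have "enn2real (\<integral>\<^sup>+r. ennreal (?k r) \<partial>lborel) = enn2real (\<integral>\<^sup>+r. ennreal (- ?k r) \<partial>lborel)"
      using zero[of a] real_lebesgue_integral_def[OF k] by simp
    then show "emeasure (density lborel (\<lambda>r. ennreal (h' r))) {a<..}
        = emeasure (density lborel (\<lambda>r. ennreal (- h' r))) {a<..}"
      unfolding 1 2 using f by (metis ennreal_enn2real_if infinity_ennreal_def)
  qed auto
  then have "AE r in lborel. ennreal (h' r) = ennreal (- h' r)"
    by (intro sigma_finite_measure.density_unique[OF sigma_finite_lborel]) auto
  with AE have "AE r in lborel. ?g r = 0"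
  proof eventually_elim
    fix r assume "?g r = h' r" "ennreal (h' r) = ennreal (- h' r)"
    then show "?g r = 0" by (cases "h' r \<ge> 0") (auto simp: ennreal_neg ennreal_eq_0_iff)
  qed
  then have "AE r in lebesgue. ?g r = 0" by (rule AE_completion)
  then have "AE r in lebesgue. r \<in> {0..1} \<longrightarrow> h r = 0"
    by eventually_elim (auto simp: indicator_def)
  then show ?thesis by (subst AE_restrict_space_iff) auto
qed

text \<open>The missing low moments are handled by passing to r^n0 g, whose moments all vanish; this
  loses information at r = 0 only. Positivity of \<open>n0\<close> makes \<open>powr\<close> and the
  ordinary power agree at r = 0.\<close>

lemma moments_zero:
  fixes g :: "real \<Rightarrow> complex"
  assumes g: "integrable unit_leb g" and mom: "\<And>n::nat. n \<ge> n0 \<Longrightarrow> unit_mellin g (of_nat n) = 0"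
      and "n0 > 0"
  shows "AE r in unit_leb. r = 0 \<or> g r = 0"
proof -
  define h where "h = (\<lambda>r. g r * of_real r ^ n0)"
  have [measurable]: "g \<in> borel_measurable unit_leb" using g by auto
  have pw: "complex_of_real r powr of_nat n = of_real r ^ n" if "n \<ge> n0" for r n
    using that \<open>n0 > 0\<close> powr_nat'[of "of_real r :: complex" n] by auto
  have h: "integrable unit_leb h"
    using integrable_unit_mellin[OF g, of "of_nat n0"] by (simp add: h_def pw)
  have hn: "integrable unit_leb (\<lambda>r. h r * of_real r ^ n)" for n
    using integrable_unit_mellin[OF g, of "of_nat (n0 + n)"]
    by (simp only: pw[of "n0 + n"] h_def power_add mult_ac) (simp add: mult_ac)
  have z: "(LINT r|unit_leb. h r * of_real r ^ n) = 0" for n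
    using mom[of "n0 + n"] unfolding unit_mellin_def
    by (simp only: pw[of "n0 + n"]) (simp add: h_def power_add mult_ac)
  have "(LINT r|unit_leb. Re (h r) * r ^ n) = Re (LINT r|unit_leb. h r * of_real r ^ n)" for n
    using hn[of n] by (subst integral_Re[symmetric]) (auto simp flip: of_real_power)
  moreover have "(LINT r|unit_leb. Im (h r) * r ^ n) = Im (LINT r|unit_leb. h r * of_real r ^ n)"
      for n
    using hn[of n] by (subst integral_Im[symmetric]) (auto simp flip: of_real_power)
  ultimately have "AE r in unit_leb. Re (h r) = 0" "AE r in unit_leb. Im (h r) = 0"
    using h by (auto intro!: moments_zero_real simp: z)
  then show ?thesis
    by eventually_elim (auto simp: h_def complex_eq_iff[of "g _
        * _"] complex_eq_iff[of "g _"] zero_complex.code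
      dest: complex_eq_iff[of "g _ * _" 0, THEN iffD2, OF conjI])
qed

section \<open>The Mellin transform of a radial symbol\<close>

definition radial_L1 :: "(real \<Rightarrow> complex) \<Rightarrow> bool" where
  "radial_L1 \<phi> \<longleftrightarrow> integrable unit_leb (\<lambda>r. of_real r * \<phi> r)"

lemma mellin_moments_zero:
  assumes "radial_L1 \<phi>" "\<And>n::nat. n \<ge> n0 \<Longrightarrow> mellin \<phi> (of_nat n) = 0"
  shows "AE r in unit_leb. \<phi> r = 0"
proof -
  have "AE r in unit_leb. r = 0 \<or> of_real r * \<phi> r = 0"
  proof (rule moments_zero[where ?n0.0 = "n0 + 1"])
    fix n assume "n \<ge> n0 + 1"
    then have "mellin \<phi> (of_nat (n + 2)) = 0" by (intro assms(2)) auto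
    then show "unit_mellin (\<lambda>r. of_real r * \<phi> r) (of_nat n) = 0"
      by (simp add: mellin_eq_unit_mellin)
  qed (use assms in \<open>auto simp: radial_L1_def\<close>)
  moreover have "AE r in lborel. r \<noteq> (0::real)" by (rule AE_lborel_singleton)
  then have "AE r in lebesgue. r \<noteq> (0::real)" by (rule AE_completion)
  then have "AE r in unit_leb. r \<noteq> 0" by (subst AE_restrict_space_iff) auto
  ultimately show ?thesis by eventually_elim auto
qed

lemma mellin_holomorphic:
  assumes "radial_L1 \<phi>"
  shows "mellin \<phi> holomorphic_on {z. Re z > 2}"
  unfolding mellin_eq_unit_mellin using assms
  by (intro holomorphic_on_compose_gen[OF _ unit_mellin_holomorphic, unfolded o_def]
      holomorphic_intros)
    (auto simp: radial_L1_def)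

lemma mellin_bounded:
  assumes "radial_L1 \<phi>"
  obtains M where "\<And>z. Re z \<ge> 2 \<Longrightarrow> cmod (mellin \<phi> z) \<le> M"
proof
  show "cmod (mellin \<phi> z) \<le> (LINT r|unit_leb. cmod (of_real r * \<phi> r))" if "Re z \<ge> 2" for z
    unfolding mellin_eq_unit_mellin using assms that
        by (intro unit_mellin_bound) (auto simp: radial_L1_def)
qed

lemma mellin_tendsto:
  assumes "radial_L1 \<phi>" "\<And>n. Re (s n) \<ge> 2" "s \<longlonglongrightarrow> a"
  shows "(\<lambda>n. mellin \<phi> (s n)) \<longlonglongrightarrow> mellin \<phi> a"
  unfolding mellin_eq_unit_mellin using assms
  by (intro unit_mellin_tendsto) (auto simp: radial_L1_def intro!: tendsto_intros)

text \<open>Analytic continuation reaches the open half-plane Re z > 2, and approach from the right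
  reaches its boundary. With entire \<open>p\<close> and \<open>q\<close> in place of quotients, no
  pole can obstruct the continuation.\<close>

lemma mellin_identity_extend:
  assumes \<phi>: "radial_L1 \<phi>" and p: "p holomorphic_on UNIV" and q: "q holomorphic_on UNIV"
    and eq: "\<And>z. Re z > \<sigma> \<Longrightarrow> mellin \<phi> z * p z = q z" and z: "Re z \<ge> 2"
  shows "mellin \<phi> z * p z = q z"
proof -
  have gt: "mellin \<phi> z * p z = q z" if z: "Re z > 2" for z
  proof -
    define w where "w = complex_of_real (max \<sigma> 2 + 1)"
    define H where "H = (\<lambda>z. mellin \<phi> z * p z - q z)"
    have "H z = 0"
    proof (rule analytic_continuation_open[where f = H and g = "\<lambda>_. 0" and s
        = "{z. Re z > max \<sigma> 2}" and s' = "{z. Re z > 2}"])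
      show "{z. Re z > max \<sigma> 2} \<noteq> {}" by (auto intro!: exI[of _ w] simp: w_def)
      show "connected {z. Re z > 2}" by (simp add: convex_connected convex_halfspace_Re_gt)
      show "H holomorphic_on {z. Re z > 2}" unfolding H_def
        by (intro holomorphic_intros mellin_holomorphic \<phi> holomorphic_on_subset[OF p]
            holomorphic_on_subset[OF q]) auto
      show "open {z. Re z > max \<sigma> 2}" "open {z. Re z > 2}" by (rule open_halfspace_Re_gt)+
    qed (use z eq in \<open>auto simp: H_def\<close>)
    then show ?thesis by (simp add: H_def)
  qed
  define s where "s = (\<lambda>n. z + of_real (inverse (real (Suc n))))"
  have s2: "Re (s n) > 2" for n
  proof -
    have "inverse (real (Suc n)) > 0" by simp
    then show ?thesis using z unfolding s_def plus_complex.sel Re_complex_of_real by linarith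
  qed
  have "(\<lambda>n. inverse (real (Suc n))) \<longlonglongrightarrow> 0" by (rule LIMSEQ_inverse_real_of_nat)
  then have "s \<longlonglongrightarrow> z + of_real 0" unfolding s_def by (intro tendsto_intros)
  then have s: "s \<longlonglongrightarrow> z" by simp
  have ps: "(\<lambda>n. p (s n)) \<longlonglongrightarrow> p z" and qs: "(\<lambda>n. q (s n)) \<longlonglongrightarrow> q z"
    using s holomorphic_on_imp_continuous_on[OF p] holomorphic_on_imp_continuous_on[OF q]
    by (auto intro: continuous_on_tendsto_compose)
  have "(\<lambda>n. mellin \<phi> (s n) * p (s n)) \<longlonglongrightarrow> mellin \<phi> z * p z"
    by (intro tendsto_intros mellin_tendsto \<phi> s ps) (use z s2 in \<open>auto intro: less_imp_le\<close>)
  moreover have "mellin \<phi> (s n) * p (s n) = q (s n)" for n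
  proof (rule gt)
    show "2 < Re (s n)" by (rule s2)
  qed
  ultimately show ?thesis using qs LIMSEQ_unique by auto
qed

lemma mellin_cong_AE:
  assumes "radial_L1 \<phi>" "radial_L1 \<psi>" "AE r in unit_leb. \<phi> r = \<psi> r"
  shows "mellin \<phi> z = mellin \<psi> z"
  unfolding mellin_eq_unit_mellin unit_mellin_def
proof (rule integral_cong_AE)
  have [measurable]: "(\<lambda>r. of_real r * \<phi> r) \<in> borel_measurable unit_leb"
      "(\<lambda>r. of_real r * \<psi> r) \<in> borel_measurable unit_leb"
    using assms(1,2) by (auto simp: radial_L1_def)
  show "(\<lambda>r. of_real r * \<phi> r * of_real r powr (z - 2)) \<in> borel_measurable unit_leb"
    "(\<lambda>r. of_real r * \<psi> r * of_real r powr (z - 2)) \<in> borel_measurable unit_leb" by measurable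
  show "AE r in unit_leb. of_real r * \<phi> r * of_real r powr (z - 2)
      = of_real r * \<psi> r * of_real r powr (z - 2)"
    using assms(3) by eventually_elim simp
qed

lemma integral_unit_powr:
  assumes "a > - 1"
  shows "integrable unit_leb (\<lambda>r. r powr a)" "(LINT r|unit_leb. r powr a) = 1 / (a + 1)"
proof -
  have "((\<lambda>r. r powr a) has_integral 1 powr (a + 1) / (a + 1)) {0..1}"
    using has_integral_powr_from_0[OF assms, of 1] by simp
  then have i: "((\<lambda>r. r powr a) has_integral 1 / (a + 1)) {0..1}" by simp
  have "(\<lambda>r. r powr a) absolutely_integrable_on {0..1}"
    by (rule nonnegative_absolutely_integrable_1) (use i in auto)
  then show *: "integrable unit_leb (\<lambda>r. r powr a)"
    by (simp add: integrable_restrict_space set_integrable_def)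
  show "(LINT r|unit_leb. r powr a) = 1 / (a + 1)"
    using lebesgue_integral_eq_integral[OF *] i by (auto simp: integral_unique)
qed

lemma radial_L1_powr:
  assumes "m > - 2"
  shows "radial_L1 (\<lambda>r. of_real (r powr m))"
proof -
  have "integrable unit_leb (\<lambda>r. complex_of_real (r powr (m + 1)))"
    using integral_unit_powr(1)[of "m + 1"] assms by (intro integrable_of_real) auto
  moreover have "r * r powr m = r powr (m + 1)" if "0 \<le> r" for r
    using that by (cases "r = 0") (auto simp: powr_add)
  ultimately show ?thesis unfolding radial_L1_def
    by (subst Bochner_Integration.integrable_cong[where g = "\<lambda>r. complex_of_real (r powr (m + 1))"])
      (auto simp flip: of_real_mult)
qed

lemma mellin_powr_real:
  assumes "m + s > 0"
  shows "mellin (\<lambda>r. of_real (r powr m)) (of_real s) = 1 / of_real (s + m)"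
proof -
  have "mellin (\<lambda>r. of_real (r powr m)) (of_real s)
      = (LINT r|unit_leb. complex_of_real (r powr (m + s - 1)))"
    unfolding mellin_def
  proof (rule Bochner_Integration.integral_cong)
    fix r assume "r \<in> space unit_leb"
    then have "r \<ge> 0" by auto
    then have "complex_of_real r powr (of_real s - 1) = of_real (r powr (s - 1))"
      using powr_of_real[of r "s - 1"] by simp
    moreover have "r powr m * r powr (s - 1) = r powr (m + s - 1)"
      by (simp add: powr_add[symmetric] algebra_simps)
    ultimately show "of_real (r powr m) * of_real r powr (of_real s - 1)
        = complex_of_real (r powr (m + s - 1))"
      by (metis of_real_mult)
  qed simp
  also have "\<dots> = of_real (1 / (s + m))"
    using integral_unit_powr[of "m + s - 1"] assms
        by (subst integral_complex_of_real) (simp add: add.commute)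
  finally show ?thesis by simp
qed

lemma mellin_diff:
  assumes "radial_L1 \<phi>" "radial_L1 \<psi>" "Re z \<ge> 2"
  shows "mellin (\<lambda>r. \<phi> r - C * \<psi> r) z = mellin \<phi> z - C * mellin \<psi> z" "radial_L1 (\<lambda>r. \<phi> r - C * \<psi> r)"
proof -
  have 1: "integrable unit_leb (\<lambda>r. C * (of_real r * \<psi> r))"
    using assms(2) unfolding radial_L1_def by (rule integrable_mult_right)
  then have "integrable unit_leb (\<lambda>r. of_real r * \<phi> r - C * (of_real r * \<psi> r))"
    using assms(1) unfolding radial_L1_def by (intro Bochner_Integration.integrable_diff)
  then show "radial_L1 (\<lambda>r. \<phi> r - C * \<psi> r)"
    by (simp add: radial_L1_def algebra_simps)
  have "unit_mellin (\<lambda>r. of_real r * (\<phi> r - C * \<psi> r)) s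
      = unit_mellin (\<lambda>r. of_real r * \<phi> r) s - C * unit_mellin (\<lambda>r. of_real r * \<psi> r) s"
    if "Re s \<ge> 0" for s
    using integrable_unit_mellin[OF assms(1)[unfolded radial_L1_def] that]
        integrable_unit_mellin[OF assms(2)[unfolded radial_L1_def] that]
    unfolding unit_mellin_def
    by (subst integral_mult_right_zero[symmetric], subst
        Bochner_Integration.integral_diff[symmetric])
      (auto simp: algebra_simps intro!: Bochner_Integration.integral_cong)
  then show "mellin (\<lambda>r. \<phi> r - C * \<psi> r) z = mellin \<phi> z - C * mellin \<psi> z"
    unfolding mellin_eq_unit_mellin using assms(3) by simp
qed

text \<open>C / (z + b) is the transform of C r^b, and the moments from some index on determine a
  radial symbol almost everywhere.\<close>

lemma AE_eq_of_mellin: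
  assumes "radial_L1 \<phi>" "b > - 2"
      and eq: "\<And>n::nat. n \<ge> n0 \<Longrightarrow> mellin \<phi> (of_nat n) = C / (of_nat n + of_real b)"
  shows "AE r in unit_leb. \<phi> r = C * of_real (r powr b)"
proof -
  have L: "radial_L1 (\<lambda>r. of_real (r powr b))" using assms(2) by (rule radial_L1_powr)
  have "AE r in unit_leb. \<phi> r - C * of_real (r powr b) = 0"
  proof (rule mellin_moments_zero[where ?n0.0 = "n0 + 2"])
    show "radial_L1 (\<lambda>r. \<phi> r - C * of_real (r powr b))"
      using mellin_diff(2)[OF assms(1) L, of 2] by simp
    fix n assume n: "n \<ge> n0 + 2"
    then have "mellin (\<lambda>r. \<phi> r - C * of_real (r powr b)) (of_nat n)
        = mellin \<phi> (of_nat n) - C * mellin (\<lambda>r. of_real (r powr b)) (of_nat n)"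
      by (intro mellin_diff assms L) auto
    also have "mellin (\<lambda>r. of_real (r powr b)) (of_nat n) = 1 / of_real (real n + b)"
      using mellin_powr_real[of b "real n"] n assms(2) by simp
    finally show "mellin (\<lambda>r. \<phi> r - C * of_real (r powr b)) (of_nat n) = 0"
      using eq[of n] n by simp
  qed
  then show ?thesis by eventually_elim simp
qed

section \<open>The recurrence and its Gamma quotient solution\<close>

text \<open>The parameters are \<open>a = \<bar>k1\<bar>\<close> and \<open>s = sgn k1 * k2\<close>. Writing the denominators with the entire function
  \<^const>\<open>rGamma\<close> makes the functional equation hold also where they vanish.\<close>

definition gquot :: "real \<Rightarrow> real \<Rightarrow> real \<Rightarrow> complex \<Rightarrow> complex" where
  "gquot a m s z =
     Gamma ((z + of_real s) / (2 * of_real a)) * Gamma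
         ((z + of_real m + of_real a - of_real s) / (2 * of_real a)) *
     rGamma ((z + 2 * of_real a - of_real s) / (2 * of_real a)) * rGamma
         ((z + of_real m + of_real a + of_real s) / (2 * of_real a))"

definition recur :: "real \<Rightarrow> real \<Rightarrow> real \<Rightarrow> (complex \<Rightarrow> complex) \<Rightarrow> complex \<Rightarrow> bool" where
  "recur a m s F z \<longleftrightarrow>
     (z + of_real s) * (z + of_real m + of_real a - of_real s) * F z =
     (z + 2 * of_real a - of_real s) * (z + of_real m + of_real a + of_real s) * F
         (z + 2 * of_real a)"

lemma Re_pos_nonpos_Ints: "Re z > 0 \<Longrightarrow> z \<notin> \<int>\<^sub>\<le>\<^sub>0"
  by (auto elim!: nonpos_Ints_cases)

lemma Re_divide_pos_real:
  assumes "Re z > 0" "a > 0" shows "Re (z / (2 * of_real a)) > 0"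
proof -
  have "z / (2 * of_real a) = z / of_real (2 * a)" by simp
  then show ?thesis using assms by (simp only: Re_divide_of_real) simp
qed

text \<open>Each of the four linear factors is used up by one Gamma factor: w Gamma(w) = Gamma(w +
  1) in the numerator, w rGamma(w + 1) = rGamma(w) in the denominator. The latter holds everywhere,
  so only the numerator arguments are kept off the poles.\<close>

lemma recur_gquot:
  assumes a: "a > 0" and 1: "Re z + s > 0" and 2: "Re z + m + a - s > 0"
  shows "recur a m s (\<lambda>z. C * gquot a m s z) z"
proof -
  \<comment> \<open>In units of \<open>p\<close> the step \<open>2 * a\<close> becomes a shift by
    1.\<close>
  define p where "p = 2 * complex_of_real a"
  have p: "p \<noteq> 0" using a by (simp add: p_def)
  define w1 where "w1 = (z + of_real s) / p"
  define w2 where "w2 = (z + of_real m + of_real a - of_real s) / p"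
  define w3 where "w3 = (z + p - of_real s) / p"
  define w4 where "w4 = (z + of_real m + of_real a + of_real s) / p"
  have n: "w1 \<notin> \<int>\<^sub>\<le>\<^sub>0" "w2 \<notin> \<int>\<^sub>\<le>\<^sub>0"
    unfolding w1_def w2_def p_def
        by (intro Re_pos_nonpos_Ints Re_divide_pos_real; use assms in simp)+
  have q1: "gquot a m s z = Gamma w1 * Gamma w2 * rGamma w3 * rGamma w4"
    unfolding gquot_def w1_def w2_def w3_def w4_def p_def ..
  have sh: "(z + p + of_real s) / p = w1 + 1"
      "(z + p + of_real m + of_real a - of_real s) / p = w2 + 1"
    "(z + p + p - of_real s) / p = w3 + 1" 
        "(z + p + of_real m + of_real a + of_real s) / p = w4 + 1"
    using p by (simp_all add: w1_def w2_def w3_def w4_def p_def[symmetric] field_simps)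
  have q2: "gquot a m s (z + p)
      = w1 * Gamma w1 * (w2 * Gamma w2) * rGamma (w3 + 1) * rGamma (w4 + 1)"
    unfolding gquot_def p_def[symmetric] sh using n by (simp add: Gamma_plus1)
  have e: "z + of_real s = p * w1" "z + of_real m + of_real a - of_real s = p * w2"
    "z + p - of_real s = p * w3" "z + of_real m + of_real a + of_real s = p * w4"
    using p by (simp_all add: w1_def w2_def w3_def w4_def)
  show ?thesis unfolding recur_def p_def[symmetric] e q1 q2
    by (simp add: rGamma_plus1[of w3, symmetric] rGamma_plus1[of w4, symmetric] mult_ac)
qed

lemma gquot_nonzero:
  assumes a: "a > 0" and "Re z + s > 0" "Re z + m + a - s > 0" "Re z + 2 * a - s > 0"
      "Re z + m + a + s > 0"
  shows "gquot a m s z \<noteq> 0"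
proof -
  have "(z + of_real s) / (2 * of_real a) \<notin> \<int>\<^sub>\<le>\<^sub>0"
      "(z + of_real m + of_real a - of_real s) / (2 * of_real a) \<notin> \<int>\<^sub>\<le>\<^sub>0"
    "(z + 2 * of_real a - of_real s) / (2 * of_real a) \<notin> \<int>\<^sub>\<le>\<^sub>0"
        "(z + of_real m + of_real a + of_real s) / (2 * of_real a) \<notin> \<int>\<^sub>\<le>\<^sub>0"
    by (intro Re_pos_nonpos_Ints Re_divide_pos_real; use assms in simp)+
  then show ?thesis by (simp add: gquot_def Gamma_eq_zero_iff rGamma_eq_zero_iff)
qed

section \<open>Growth of the Gamma quotient\<close>

lemma norm_pochhammer_le: "cmod (pochhammer w L) \<le> (cmod w + real L) ^ L"
proof -
  have "cmod (pochhammer w L) = (\<Prod>j<L. cmod (w + of_nat j))"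
    by (simp add: pochhammer_prod prod_norm atLeast0LessThan)
  also have "\<dots> \<le> (\<Prod>j<L. cmod w + real L)"
  proof (intro prod_mono conjI norm_ge_zero)
    fix j assume "j \<in> {..<L}"
    then show "cmod (w + of_nat j) \<le> cmod w + real L"
      using norm_triangle_ineq[of w "of_nat j"] by simp
  qed
  finally show ?thesis by simp
qed

text \<open>The Gammas are paired crosswise. The pair with offsets \<alpha>1 <= \<beta>2, an
  inequality equivalent to m + a >= 0, is bounded. In the other pair \<alpha>2 may exceed \<beta>1;
  raising \<beta>1 by the integer \<open>L\<close> repairs this at the price of a Pochhammer symbol
  of degree \<open>L\<close>. Beyond \<sigma> all four arguments have positive real part.\<close>

lemma gquot_bound:
  assumes a: "a > 0" and ma: "m + a \<ge> 0" and \<sigma>: "\<sigma> = \<bar>s\<bar> + 2"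
  obtains B L where "B \<ge> 0" "\<And>z. Re z > \<sigma> \<Longrightarrow> cmod (gquot a m s z) \<le> B * cmod z ^ L"
proof -
  define x0 where "x0 = \<sigma> / (2 * a)"
  define \<alpha>1 where "\<alpha>1 = s / (2 * a)"
  define \<beta>2 where "\<beta>2 = (m + a + s) / (2 * a)"
  define \<alpha>2 where "\<alpha>2 = (m + a - s) / (2 * a)"
  define \<beta>1 where "\<beta>1 = (2 * a - s) / (2 * a)"
  define L where "L = nat \<lceil>\<alpha>2 - \<beta>1\<rceil>"
  have L: "\<alpha>2 \<le> \<beta>1 + real L" unfolding L_def by linarith
  define B1 where "B1 = Gamma (x0 + \<alpha>1) / Gamma (x0 + \<beta>2)"
  define B2 where "B2 = Gamma (x0 + \<alpha>2) / Gamma (x0 + (\<beta>1 + real L))"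
  define c where "c = 1 / (2 * a) + \<bar>\<beta>1\<bar> + real L"
  have pos: "x0 + \<alpha>1 > 0" "x0 + \<alpha>2 > 0" "x0 + \<beta>1 > 0" "x0 + \<beta>2 > 0"
    using a ma by (auto simp: x0_def \<alpha>1_def \<alpha>2_def \<beta>1_def \<beta>2_def \<sigma> add_divide_distrib[symmetric]
        intro!: divide_pos_pos)
  have B: "B1 \<ge> 0" "B2 \<ge> 0" unfolding B1_def B2_def using pos
      by (auto intro!: divide_nonneg_pos Gamma_real_nonneg Gamma_real_pos)
  have c: "c \<ge> 0" using a by (simp add: c_def)
  have "cmod (gquot a m s z) \<le> (B1 * B2 * c ^ L) * cmod z ^ L" if z: "Re z > \<sigma>" for z
  proof -
    define w where "w = z / of_real (2 * a)"
    have Rw: "Re w \<ge> x0" using z a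
        by (simp only: w_def x0_def Re_divide_of_real) (simp add: divide_right_mono)
    have z1: "cmod z \<ge> 1" using complex_Re_le_cmod[of z] z \<sigma> by linarith
    have args: "(z + of_real s) / (2 * of_real a) = w + of_real \<alpha>1"
       "(z + of_real m + of_real a - of_real s) / (2 * of_real a) = w + of_real \<alpha>2"
       "(z + 2 * of_real a - of_real s) / (2 * of_real a) = w + of_real \<beta>1"
       "(z + of_real m + of_real a + of_real s) / (2 * of_real a) = w + of_real \<beta>2"
      by (simp_all add: w_def \<alpha>1_def \<alpha>2_def \<beta>1_def \<beta>2_def add_divide_distrib diff_divide_distrib)
    have g: "gquot a m s z
        = (Gamma (w + of_real \<alpha>1) / Gamma (w + of_real \<beta>2)) *
        (Gamma (w + of_real \<alpha>2) / Gamma (w + of_real \<beta>1))"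
      unfolding gquot_def args by (simp add: rGamma_inverse_Gamma divide_inverse mult_ac)
    have nb: "w + of_real \<beta>1 \<notin> \<int>\<^sub>\<le>\<^sub>0" using Rw pos by (intro Re_pos_nonpos_Ints) simp
    have "Gamma (w + of_real \<beta>1 + of_nat L)
        = pochhammer (w + of_real \<beta>1) L * Gamma (w + of_real \<beta>1)"
      using pochhammer_Gamma[OF nb, of L] nb by (simp add: Gamma_eq_zero_iff)
    moreover have "w + of_real \<beta>1 + of_nat L \<notin> \<int>\<^sub>\<le>\<^sub>0" using Rw pos
        by (intro Re_pos_nonpos_Ints) simp
    then have "Gamma (w + of_real \<beta>1 + of_nat L) \<noteq> 0" by (simp add: Gamma_eq_zero_iff)
    ultimately have g2: "Gamma (w + of_real \<alpha>2) / Gamma (w + of_real \<beta>1) =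
        Gamma (w + of_real \<alpha>2) / Gamma (w + of_real (\<beta>1 + real L)) * pochhammer (w + of_real \<beta>1) L"
      by (simp add: field_simps add.assoc)
    have "cmod (pochhammer (w + of_real \<beta>1) L) \<le> (cmod (w + of_real \<beta>1) + real L) ^ L"
      by (rule norm_pochhammer_le)
    also have "\<dots> \<le> (c * cmod z) ^ L"
    proof (intro power_mono)
      have "cmod (w + of_real \<beta>1) + real L \<le> cmod w + (\<bar>\<beta>1\<bar> + real L) * 1"
        using norm_triangle_ineq[of w "of_real \<beta>1"] by simp
      also have "\<dots> \<le> cmod w + (\<bar>\<beta>1\<bar> + real L) * cmod z"
        using z1 by (intro add_left_mono mult_left_mono) auto
      also have "cmod w = 1 / (2 * a) * cmod z" using a
          by (simp only: w_def norm_divide norm_of_real) simp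
      finally show "cmod (w + of_real \<beta>1) + real L \<le> c * cmod z" by (simp add: c_def algebra_simps)
    qed simp
    finally have 3: "cmod (pochhammer (w + of_real \<beta>1) L) \<le> (c * cmod z) ^ L" .
    have 1: "cmod (Gamma (w + of_real \<alpha>1) / Gamma (w + of_real \<beta>2)) \<le> B1"
      unfolding B1_def by (rule Gamma_ratio_bound)
          (use pos Rw a ma in \<open>auto simp: \<alpha>1_def \<beta>2_def divide_right_mono\<close>)
    have 2: "cmod (Gamma (w + of_real \<alpha>2) / Gamma (w + of_real (\<beta>1 + real L))) \<le> B2"
      unfolding B2_def by (rule Gamma_ratio_bound) (use pos Rw L in auto)
    have "cmod (gquot a m s z) = cmod (Gamma (w + of_real \<alpha>1) / Gamma (w + of_real \<beta>2)) *
       (cmod (Gamma (w + of_real \<alpha>2) / Gamma (w + of_real (\<beta>1 + real L)))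
           * cmod (pochhammer (w + of_real \<beta>1) L))"
      unfolding g g2 by (simp only: norm_mult)
    also have "\<dots> \<le> B1 * (B2 * (c * cmod z) ^ L)"
      by (intro mult_mono 1 2 3 B mult_nonneg_nonneg zero_le_power c) auto
    finally show ?thesis by (simp add: power_mult_distrib mult_ac)
  qed
  then show ?thesis using B c by (intro that[of "B1 * B2 * c ^ L" L]) auto
qed

text \<open>\<open>C\<close> is fitted at the first point of the progression, and the recurrence
  carries the equality along it. The difference then vanishes on the progression and grows
  polynomially, so \<open>half_plane_uniqueness\<close> applies.\<close>

lemma recur_imp_gquot:
  assumes \<phi>: "radial_L1 \<phi>" and a: "a > 0" and ma: "m + a \<ge> 0" and \<sigma>: "\<sigma> = \<bar>s\<bar> + 2" and t: "t > \<sigma>"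
    and E: "\<And>j::nat. recur a m s (mellin \<phi>) (of_real (t + 2 * a * real j))"
  obtains C where "\<And>z. Re z > \<sigma> \<Longrightarrow> mellin \<phi> z = C * gquot a m s z"
proof -
  let ?z = "\<lambda>j::nat. complex_of_real (t + 2 * a * real j)"
  have Rz: "Re (?z j) > \<sigma>" for j
  proof -
    have "2 * a * real j \<ge> 0" using a by simp
    then show ?thesis using t unfolding Re_complex_of_real by linarith
  qed
  have pos: "Re z + s > 0" "Re z + m + a - s > 0" "Re z + 2 * a - s > 0" "Re z + m + a + s > 0"
      if "Re z > \<sigma>" for z
    using that a ma \<sigma> by auto
  define C where "C = mellin \<phi> (?z 0) / gquot a m s (?z 0)"
  define H where "H = (\<lambda>z. mellin \<phi> z - C * gquot a m s z)"
  have H0: "H (?z j) = 0" for j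
  proof (induction j)
    case 0
    then show ?case using gquot_nonzero[OF a pos[OF Rz[of 0]]] by (simp add: H_def C_def)
  next
    case (Suc j)
    have s: "?z j + 2 * of_real a = ?z (Suc j)" by (simp add: algebra_simps)
    \<comment> \<open>The coefficient of F(z + 2 a) in the recurrence; it is nonzero here, so a zero
      of \<open>H\<close> at one point passes to the next.\<close>
    define A where "A = (?z j + 2 * of_real a - of_real s)
        * (?z j + of_real m + of_real a + of_real s)"
    have "A \<noteq> 0" unfolding A_def using pos(3,4)[OF Rz[of j]] by (auto simp: complex_eq_iff)
    have "A * H (?z (Suc j))
        = (?z j + of_real s) * (?z j + of_real m + of_real a - of_real s) * H (?z j)"
      using E[of j] recur_gquot[OF a pos(1,2)[OF Rz[of j]], of C]
      unfolding recur_def s A_def H_def by (simp only: right_diff_distrib)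
    then show ?case using Suc \<open>A \<noteq> 0\<close> by simp
  qed
  obtain B L where B: "B \<ge> 0" "\<And>z. Re z > \<sigma> \<Longrightarrow> cmod (gquot a m s z) \<le> B * cmod z ^ L"
    using gquot_bound[OF a ma \<sigma>] by blast
  obtain M where M: "\<And>z. Re z \<ge> 2 \<Longrightarrow> cmod (mellin \<phi> z) \<le> M" using mellin_bounded[OF \<phi>] by blast
  have "M \<ge> 0" using M[of 2] norm_ge_zero[of "mellin \<phi> 2"] by (simp del: norm_ge_zero)
  have "H z = 0" if z: "Re z > \<sigma>" for z
  proof (rule half_plane_uniqueness[where p = "2 * a" and t = t and H = H and M
      = "M + cmod C * B" and L = L])
    show "H holomorphic_on {z. Re z > \<sigma>}"
      unfolding H_def gquot_def
    proof (intro holomorphic_intros holomorphic_on_subset[OF mellin_holomorphic[OF \<phi>]])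
      show "z \<in> {z. Re z > \<sigma>} \<Longrightarrow> (z + of_real s) / (2 * of_real a) \<notin> \<int>\<^sub>\<le>\<^sub>0" for z
        by (intro Re_pos_nonpos_Ints Re_divide_pos_real a) (use pos in auto)
      show "z \<in> {z. Re z > \<sigma>} \<Longrightarrow> (z + of_real m + of_real a - of_real s) / (2 * of_real a) \<notin> \<int>\<^sub>\<le>\<^sub>0"
          for z
        by (intro Re_pos_nonpos_Ints Re_divide_pos_real a) (use pos in auto)
    qed (use a \<sigma> in auto)
    show "cmod (H z) \<le> (M + cmod C * B) * cmod z ^ L" if z: "Re z > \<sigma>" for z
    proof -
      have "cmod z \<ge> 1" using complex_Re_le_cmod[of z] z \<sigma> by linarith
      then have 1: "1 \<le> cmod z ^ L" by (rule one_le_power)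
      have "cmod (H z) \<le> cmod (mellin \<phi> z) + cmod C * cmod (gquot a m s z)"
        unfolding H_def using norm_triangle_ineq4[of "mellin \<phi> z" "C * gquot a m s z"]
            by (simp add: norm_mult)
      also have "\<dots> \<le> M * 1 + cmod C * (B * cmod z ^ L)"
        using M[of z] B(2)[OF z] z \<sigma> by (intro add_mono mult_left_mono) auto
      also have "\<dots> \<le> M * cmod z ^ L + cmod C * (B * cmod z ^ L)"
        using 1 \<open>M \<ge> 0\<close> by (intro add_right_mono mult_left_mono)
      finally show ?thesis by (simp add: algebra_simps)
    qed
    show "H (complex_of_real (t + 2 * a * real j)) = 0" for j by (rule H0)
  qed (use a t z \<sigma> in auto)
  then show ?thesis by (intro that[of C]) (simp add: H_def)
qed

text \<open>Multiplied out with reciprocal Gammas, both sides make sense at the poles of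
  \<open>gquot\<close>, so the identity persists there. Since the transform is finite, a pole in Re
  z >= 2 becomes a condition on the parameters.\<close>

lemma gquot_identity:
  assumes \<phi>: "radial_L1 \<phi>" and a: "a > 0" and ma: "m + a \<ge> 0"
    and eq: "\<And>z. Re z > \<bar>s\<bar> + 2 \<Longrightarrow> mellin \<phi> z = C * gquot a m s z" and z: "Re z \<ge> 2"
  shows "mellin \<phi> z * (rGamma ((z + of_real s) / (2 * of_real a))
      * rGamma ((z + of_real m + of_real a - of_real s) / (2 * of_real a)))
    = C * (rGamma ((z + 2 * of_real a - of_real s) / (2 * of_real a))
        * rGamma ((z + of_real m + of_real a + of_real s) / (2 * of_real a)))"
proof (rule mellin_identity_extend[OF \<phi> _ _ _ z])
  fix z :: complex assume z: "Re z > \<bar>s\<bar> + 2"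
  have "(z + of_real s) / (2 * of_real a) \<notin> \<int>\<^sub>\<le>\<^sub>0"
      "(z + of_real m + of_real a - of_real s) / (2 * of_real a) \<notin> \<int>\<^sub>\<le>\<^sub>0"
    by (intro Re_pos_nonpos_Ints Re_divide_pos_real; use z a ma in simp)+
  then show "mellin \<phi> z
      * (rGamma ((z + of_real s) / (2 * of_real a))
      * rGamma ((z + of_real m + of_real a - of_real s) / (2 * of_real a)))
    = C * (rGamma ((z + 2 * of_real a - of_real s) / (2 * of_real a))
        * rGamma ((z + of_real m + of_real a + of_real s) / (2 * of_real a)))"
    unfolding eq[OF z] gquot_def by (simp add: rGamma_inverse_Gamma Gamma_eq_zero_iff field_simps)
qed (use a in \<open>auto intro!: holomorphic_intros\<close>)

lemma mellin_gquot_extend: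
  assumes \<phi>: "radial_L1 \<phi>" and a: "a > 0" and ma: "m + a \<ge> 0"
    and eq: "\<And>z. Re z > \<bar>s\<bar> + 2 \<Longrightarrow> mellin \<phi> z = C * gquot a m s z"
    and z: "Re z \<ge> 2" "Re z + s > 0" "Re z + m + a - s > 0"
  shows "mellin \<phi> z = C * gquot a m s z"
proof -
  have "(z + of_real s) / (2 * of_real a) \<notin> \<int>\<^sub>\<le>\<^sub>0"
      "(z + of_real m + of_real a - of_real s) / (2 * of_real a) \<notin> \<int>\<^sub>\<le>\<^sub>0"
    by (intro Re_pos_nonpos_Ints Re_divide_pos_real; use z a ma in simp)+
  then have "Gamma ((z + of_real s) / (2 * of_real a)) * rGamma ((z + of_real s) / (2 * of_real a))
      = 1"
    "Gamma ((z + of_real m + of_real a - of_real s) / (2 * of_real a))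
        * rGamma ((z + of_real m + of_real a - of_real s) / (2 * of_real a)) = 1"
    by (simp_all add: rGamma_inverse_Gamma Gamma_eq_zero_iff)
  moreover have "F = C * (G1 * G2 * R3 * R4)"
    if "G1 * R1 = 1" "G2 * R2 = 1" "F * (R1 * R2) = C * (R3 * R4)"
        for F G1 G2 R1 R2 R3 R4 :: complex
  proof -
    have "F = F * (G1 * R1) * (G2 * R2)" using that(1,2) by simp
    also have "\<dots> = F * (R1 * R2) * (G1 * G2)" by (simp only: mult_ac)
    also have "\<dots> = C * (R3 * R4) * (G1 * G2)" by (simp only: that(3))
    finally show ?thesis by (simp only: mult_ac)
  qed
  ultimately show ?thesis
    using gquot_identity[OF \<phi> a ma eq z(1)] unfolding gquot_def by blast
qed

lemma gquot_Gamma: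
  "gquot a m s z = (Gamma ((z + of_real s) / (2 * of_real a))
      * Gamma ((z + of_real m + of_real a - of_real s) / (2 * of_real a))) /
     (Gamma ((z + 2 * of_real a - of_real s) / (2 * of_real a))
         * Gamma ((z + of_real m + of_real a + of_real s) / (2 * of_real a)))"
  unfolding gquot_def rGamma_inverse_Gamma
proof -
  show "A * B * inverse C * inverse D = A * B / (C * D)" for A B C D :: complex
    by (simp add: divide_inverse)
qed

lemma Gamma_mult_rGamma_plus1: "v \<notin> \<int>\<^sub>\<le>\<^sub>0 \<Longrightarrow> Gamma v * rGamma (v + 1) = 1 / (v :: complex)"
  by (auto simp: rGamma_inverse_Gamma Gamma_plus1 Gamma_eq_zero_iff divide_simps)

text \<open>In both cases one Gamma cancels against one in the denominator: directly if s = 0,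
  crosswise if m + a = 0. What remains is Gamma(v) / Gamma(v + 1) = 1 / v.\<close>

lemma gquot_simple:
  assumes a: "a > 0" and h: "s = 0 \<or> m + a = 0" and z: "Re z > \<bar>s\<bar>" and ma: "m + a \<ge> 0"
  shows "gquot a m s z = 2 * of_real a / (z - of_real s)"
proof -
  have z0: "z - of_real s \<noteq> 0" using z by (auto simp: complex_eq_iff)
  define v where "v = (z - of_real s) / (2 * of_real a)"
  define y where "y = (z + of_real m + of_real a + of_real s) / (2 * of_real a)"
  have v: "v \<notin> \<int>\<^sub>\<le>\<^sub>0" "y \<notin> \<int>\<^sub>\<le>\<^sub>0"
    unfolding v_def y_def by (intro Re_pos_nonpos_Ints Re_divide_pos_real; use z a ma in simp)+
  have "(z + 2 * of_real a - of_real s) / (2 * of_real a) = v + 1"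
    using a by (simp add: v_def field_simps)
  moreover have "Gamma ((z + of_real s) / (2 * of_real a))
      * Gamma ((z + of_real m + of_real a - of_real s) / (2 * of_real a))
     = Gamma v * Gamma y"
    using h
  proof
    assume "m + a = 0"
    then have "of_real m + of_real a = (0 :: complex)" by (metis of_real_0 of_real_add)
    then have "z + of_real m + of_real a + x = z + x" for x
      by (metis add.assoc add.right_neutral)
    from this[of "of_real s"] this[of "- of_real s"]
    have e: "z + of_real m + of_real a + of_real s = z + of_real s"
        "z + of_real m + of_real a - of_real s = z - of_real s"
      by (simp_all only: add_uminus_conv_diff)
    show ?thesis unfolding v_def y_def e by (rule mult.commute)
  qed (simp add: v_def y_def)
  ultimately have "gquot a m s z = (Gamma v * rGamma (v + 1)) * (Gamma y * rGamma y)"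
    unfolding gquot_def y_def[symmetric] by simp
  also have "\<dots> = 1 / v"
    using v by (simp add: Gamma_mult_rGamma_plus1)
        (simp add: rGamma_inverse_Gamma Gamma_eq_zero_iff)
  also have "\<dots> = 2 * of_real a / (z - of_real s)" using a z0 by (simp add: v_def)
  finally show ?thesis .
qed

lemma mellin_gquot_simple:
  assumes \<phi>: "radial_L1 \<phi>" and a: "a > 0" and ma: "m + a \<ge> 0" and s: "s \<le> 0"
      and h: "s = 0 \<or> m + a = 0"
    and eq: "\<And>z. Re z > \<bar>s\<bar> + 2 \<Longrightarrow> mellin \<phi> z = C * gquot a m s z"
  shows "AE r in unit_leb. \<phi> r = (C * 2 * of_real a) * of_real (r powr (- s))"
proof (rule AE_eq_of_mellin[OF \<phi>, where ?n0.0 = "nat \<lceil>\<bar>s\<bar> + 2\<rceil> + 1"])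
  fix n :: nat assume "n \<ge> nat \<lceil>\<bar>s\<bar> + 2\<rceil> + 1"
  then have "real n > \<bar>s\<bar> + 2" by linarith
  then show "mellin \<phi> (of_nat n) = (C * 2 * of_real a) / (of_nat n + of_real (- s))"
    using eq[of "of_nat n"] gquot_simple[OF a h _ ma, of "of_nat n"] by simp
qed (use s in simp)

text \<open>The left side of the identity \<open>gquot_identity\<close> vanishes at \<open>z = b\<close>, so the right side must.\<close>

lemma mellin_gquot_neg:
  assumes \<phi>: "radial_L1 \<phi>" and a: "a > 0" and ma: "m + a \<ge> 0" and b: "b \<ge> 2" and C: "C \<noteq> 0"
    and eq: "\<And>z. Re z > \<bar>- b\<bar> + 2 \<Longrightarrow> mellin \<phi> z = C * gquot a m (- b) z"
  shows "m + a = 0"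
proof (rule ccontr)
  assume "m + a \<noteq> 0"
  then have ma: "m + a > 0" using ma by simp
  have r1: "rGamma ((complex_of_real b + 2 * of_real a - of_real (- b)) / (2 * of_real a)) \<noteq> 0"
    unfolding rGamma_eq_zero_iff by (intro Re_pos_nonpos_Ints Re_divide_pos_real; use b a in simp)
  have "Re (complex_of_real b + of_real m + of_real a + of_real (- b)) > 0" using ma by simp
  then have r2: "rGamma ((complex_of_real b + of_real m + of_real a + of_real (- b))
      / (2 * of_real a)) \<noteq> 0"
    unfolding rGamma_eq_zero_iff by (intro Re_pos_nonpos_Ints Re_divide_pos_real a)
  have "complex_of_real b + of_real (- b) = 0" by simp
  then have "rGamma ((complex_of_real b + of_real (- b)) / (2 * of_real a)) = 0" by simp
  then show False
    using gquot_identity[OF \<phi> a _ eq, of "of_real b"] b ma r1 r2 C by simp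
qed

text \<open>The field algebra of the next proof: \<open>A\<close>, \<open>B\<close> are Gamma
  values, \<open>P\<close>, \<open>Q\<close> the Pochhammer symbols shifting them to
  \<open>A'\<close>, \<open>B'\<close>.\<close>

lemma cross_multiply:
  assumes "P * A = A'" "Q * B = B'" "F = C * (A * B') / (B * A')" "B \<noteq> 0" "A' \<noteq> 0"
  shows "F * P = C * (Q :: 'a :: field)"
proof -
  have "F * P = C * ((P * A) * (Q * B)) / (B * A')" unfolding assms(2,3) by simp
  also have "\<dots> = C * Q" unfolding assms(1) using assms(4,5) by simp
  finally show ?thesis .
qed

text \<open>Here the left side of \<open>gquot_identity\<close> vanishes at \<open>z = b - m - a\<close>, which forces a zero of one of the
  two factors on the right and hence the special form of \<open>m\<close>.\<close>

lemma mellin_gquot_pos: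
  assumes \<phi>: "radial_L1 \<phi>" and a: "a > 0" and ma: "m + a \<ge> 0" and b: "b \<ge> m + a + 2" and C: "C \<noteq> 0"
    and eq: "\<And>z. Re z > \<bar>b\<bar> + 2 \<Longrightarrow> mellin \<phi> z = C * gquot a m b z"
  obtains n :: nat where "m = (2 * of_nat n + 1) * a"
    "\<And>z. Re z \<ge> 2 \<Longrightarrow> mellin \<phi> z = C * pochhammer ((z - of_real b) / (2 * of_real a) + 1) n /
           pochhammer ((z + of_real b) / (2 * of_real a)) (Suc n)"
proof -
  define x where "x = complex_of_real (b - m - a)"
  have "Re x \<ge> 2" using b by (simp add: x_def)
  from gquot_identity[OF \<phi> a ma eq this]
  have "rGamma ((x + 2 * of_real a - of_real b) / (2 * of_real a))
      * rGamma ((x + of_real m + of_real a + of_real b) / (2 * of_real a)) = 0"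
    using C by (simp add: x_def)
  moreover have "rGamma ((x + of_real m + of_real a + of_real b) / (2 * of_real a)) \<noteq> 0"
    unfolding rGamma_eq_zero_iff
        by (intro Re_pos_nonpos_Ints Re_divide_pos_real; use b ma a in \<open>simp add: x_def\<close>)
  ultimately have "(x + 2 * of_real a - of_real b) / (2 * of_real a) \<in> \<int>\<^sub>\<le>\<^sub>0"
    by (simp add: rGamma_eq_zero_iff)
  then obtain n where "(x + 2 * of_real a - of_real b) / (2 * of_real a) = - of_nat n"
    by (auto elim: nonpos_Ints_cases')
  then have "x + 2 * of_real a - of_real b = of_real (- real n * (2 * a))"
    using a by (simp add: field_simps)
  then have "complex_of_real (a - m) = of_real (- real n * (2 * a))"
    by (simp add: x_def)
  then have "a - m = - real n * (2 * a)" by (simp only: of_real_eq_iff)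
  then have m: "m = (2 * of_nat n + 1) * a" by (simp add: algebra_simps)
  let ?u = "\<lambda>z. (z - of_real b) / (2 * complex_of_real a)"
      and ?v = "\<lambda>z. (z + of_real b) / (2 * complex_of_real a)"
  have vn: "?v z \<notin> \<int>\<^sub>\<le>\<^sub>0" if "Re z \<ge> 2" for z
    by (intro Re_pos_nonpos_Ints Re_divide_pos_real; use that b ma a in simp)
  have pn: "pochhammer (?v z) (Suc n) \<noteq> 0" if "Re z \<ge> 2" for z
    using vn[OF that] by (metis pochhammer_eq_0_imp_nonpos_Int)
  have "mellin \<phi> z * pochhammer (?v z) (Suc n) = C * pochhammer (?u z + 1) n" if z: "Re z \<ge> 2" for z
  proof (rule mellin_identity_extend[OF \<phi> _ _ _ z])
    fix z assume z: "Re z > \<bar>b\<bar> + 2"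
    \<comment> \<open>For this \<open>m\<close> the arguments above and below differ by
      \<open>n\<close> and \<open>Suc n\<close>, so the Gamma quotients are Pochhammer
      symbols.\<close>
    have ar: "(z + 2 * of_real a - of_real b) / (2 * of_real a) = ?u z + 1"
      "(z + of_real m + of_real a - of_real b) / (2 * of_real a) = ?u z + 1 + of_nat n"
      "(z + of_real m + of_real a + of_real b) / (2 * of_real a) = ?v z + of_nat (Suc n)"
      using a by (simp_all add: m field_simps)
    have un: "?u z + 1 \<notin> \<int>\<^sub>\<le>\<^sub>0" unfolding ar(1)[symmetric]
      by (intro Re_pos_nonpos_Ints Re_divide_pos_real; use z b ma a in simp)
    have vn: "?v z \<notin> \<int>\<^sub>\<le>\<^sub>0" by (rule vn) (use z in simp)
    have v'n: "?v z + of_nat (Suc n) \<notin> \<int>\<^sub>\<le>\<^sub>0"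
      unfolding ar(3)[symmetric]
      by (intro Re_pos_nonpos_Ints Re_divide_pos_real; use z b ma a in simp)
    have "pochhammer (?v z) (Suc n) * Gamma (?v z) = Gamma (?v z + of_nat (Suc n))"
      using pochhammer_Gamma[OF vn, of "Suc n"] vn by (simp add: Gamma_eq_zero_iff del: of_nat_Suc)
    moreover have "pochhammer (?u z + 1) n * Gamma (?u z + 1) = Gamma (?u z + 1 + of_nat n)"
      using pochhammer_Gamma[OF un, of n] un by (simp add: Gamma_eq_zero_iff)
    moreover have "mellin \<phi> z
        = C * (Gamma (?v z) * Gamma (?u z + 1 + of_nat n)) /
        (Gamma (?u z + 1) * Gamma (?v z + of_nat (Suc n)))"
      using eq[OF z] unfolding gquot_Gamma ar by simp
    moreover have "Gamma (?u z + 1) \<noteq> 0" "Gamma (?v z + of_nat (Suc n)) \<noteq> 0"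
      using un v'n by (simp_all add: Gamma_eq_zero_iff del: of_nat_Suc)
    ultimately show "mellin \<phi> z * pochhammer (?v z) (Suc n) = C * pochhammer (?u z + 1) n"
      by (rule cross_multiply)
  qed (use a in \<open>auto intro!: holomorphic_intros simp: pochhammer_prod\<close>)
  then have "mellin \<phi> z = C * pochhammer (?u z + 1) n / pochhammer (?v z) (Suc n)" if "Re z \<ge> 2"
      for z
    using pn[OF that] that by (simp add: eq_divide_eq)
  then show ?thesis using m that by blast
qed

text \<open>Pochhammer symbols telescope: in the normalized variables both sides reduce to
  \<open>C * pochhammer (u + 1) (Suc n) / pochhammer (v + 1) n\<close>.\<close>

lemma recur_pochhammer:
  assumes a: "a > 0" and b: "Re z + b > 0" and m: "m = (2 * of_nat n + 1) * a"
    and F: "\<And>z. Re z + b > 0 \<Longrightarrow> F z = C * pochhammer ((z - of_real b) / (2 * of_real a) + 1) n /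
           pochhammer ((z + of_real b) / (2 * of_real a)) (Suc n)"
  shows "recur a m b F z"
proof -
  define p where "p = 2 * complex_of_real a"
  have p: "p \<noteq> 0" using a by (simp add: p_def)
  define u where "u = (z - of_real b) / p"
  define v where "v = (z + of_real b) / p"
  have "Re v > 0" unfolding v_def p_def by (intro Re_divide_pos_real) (use a b in auto)
  then have "v \<noteq> 0" "v + 1 + of_nat n \<noteq> 0" by (auto simp: complex_eq_iff)
  moreover have "pochhammer (v + 1) n \<noteq> 0"
    using Re_pos_nonpos_Ints[of "v + 1"] \<open>Re v > 0\<close> by (auto dest: pochhammer_eq_0_imp_nonpos_Int)
  ultimately have vn: "v \<noteq> 0" "v + 1 + of_nat n \<noteq> 0" "pochhammer (v + 1) n \<noteq> 0" by auto
  have F1: "F z = C * pochhammer (u + 1) n / pochhammer v (Suc n)"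
    unfolding F[OF b] u_def v_def p_def ..
  have sh: "(z + p - of_real b) / p = u + 1" "(z + p + of_real b) / p = v + 1"
    using p by (simp_all add: u_def v_def field_simps)
  have "Re (z + p) + b > 0" using b a by (simp add: p_def)
  then have F2: "F (z + p) = C * pochhammer (u + 1 + 1) n / pochhammer (v + 1) (Suc n)"
    by (subst F) (simp_all add: p_def[symmetric] sh)
  have mp: "of_real m + of_real a = of_nat (Suc n) * p" by (simp add: m p_def algebra_simps)
  have e: "z + of_real b = p * v" "z + of_real m + of_real a - of_real b = p * (u + 1 + of_nat n)"
    "z + p - of_real b = p * (u + 1)"
        "z + of_real m + of_real a + of_real b = p * (v + 1 + of_nat n)"
  proof -
    have pu: "p * u = z - of_real b" "p * v = z + of_real b" using p by (simp_all add: u_def v_def)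
    then show "z + of_real b = p * v" "z + p - of_real b = p * (u + 1)"
        by (simp_all add: algebra_simps)
    have "z + of_real m + of_real a - of_real b = p * u + (of_real m + of_real a)"
      "z + of_real m + of_real a + of_real b = p * v + (of_real m + of_real a)"
          by (simp_all add: pu)
    then show "z + of_real m + of_real a - of_real b = p * (u + 1 + of_nat n)"
      "z + of_real m + of_real a + of_real b = p * (v + 1 + of_nat n)"
      unfolding mp by (simp_all add: algebra_simps)
  qed
  have "v * ((u + 1 + of_nat n) * (C * pochhammer (u + 1) n / pochhammer v (Suc n)))
      = C * pochhammer (u + 1) (Suc n) / pochhammer (v + 1) n"
    using vn(1) unfolding pochhammer_rec[of v] pochhammer_rec'[of "u + 1"] by simp
  moreover have "(u + 1)
      * ((v + 1 + of_nat n) * (C * pochhammer (u + 1 + 1) n / pochhammer (v + 1) (Suc n)))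
      = C * pochhammer (u + 1) (Suc n) / pochhammer (v + 1) n"
    using vn(2) unfolding pochhammer_rec'[of "v + 1"] pochhammer_rec[of "u + 1"] by simp
  ultimately show ?thesis
    unfolding recur_def p_def[symmetric] e F1 F2 by (simp only: mult_ac)
qed

section \<open>Power series on the disk\<close>

definition taylor_coef :: "(complex \<Rightarrow> complex) \<Rightarrow> nat \<Rightarrow> complex" where
  "taylor_coef f n = (deriv ^^ n) f 0 / fact n"

definition has_series :: "(complex \<Rightarrow> complex) \<Rightarrow> (nat \<Rightarrow> complex) \<Rightarrow> bool" where
  "has_series f b \<longleftrightarrow> (\<forall>z\<in>disk. (\<lambda>n. b n * z ^ n) sums f z)"

text \<open>On a smaller disc all partial sums of a power series are uniformly bounded, which
  justifies termwise integration. The cut-off is removed afterwards by letting the radius tend to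
  1.\<close>

abbreviation disc_ind :: "real \<Rightarrow> complex \<Rightarrow> complex" where
  "disc_ind \<rho> w \<equiv> indicator {..<\<rho>} (cmod w)"

lemma has_series_holomorphic: "has_series f b \<Longrightarrow> f holomorphic_on disk"
  by (rule power_series_holomorphic[where a = b]) (auto simp: has_series_def)

lemma holomorphic_disk_measurable: "f holomorphic_on disk \<Longrightarrow> f \<in> borel_measurable dA"
  unfolding measurable_dA
  by (rule continuous_imp_measurable_on_sets_lebesgue)
      (auto intro: holomorphic_on_imp_continuous_on)

lemma has_series_taylor_coef: "f holomorphic_on disk \<Longrightarrow> has_series f (taylor_coef f)"
  using holomorphic_power_series[of f 0 1] by (auto simp: has_series_def taylor_coef_def)

lemma disc_ind_measurable [measurable]: "disc_ind \<rho> \<in> borel_measurable dA"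
  by (rule borel_measurable_dAI) measurable

lemma mellin_disc_ind:
  assumes "0 < \<rho>" "\<rho> < 1" "s > 0"
  shows "mellin (indicator {..<\<rho>}) (of_nat s) = of_real (\<rho> ^ s / real s)"
proof -
  obtain n where s: "s = Suc n" using assms(3) by (cases s) auto
  have fi: "((\<lambda>r. r ^ n) has_integral (\<rho> ^ s / real s - 0 ^ s / real s)) {0..\<rho>}"
  proof (rule fundamental_theorem_of_calculus)
    fix r
    have "((\<lambda>r. r ^ s / real s) has_real_derivative r ^ n) (at r within {0..\<rho>})"
      unfolding s by (auto intro!: derivative_eq_intros simp del: power_Suc)
    then show "((\<lambda>r. r ^ s / real s) has_vector_derivative r ^ n) (at r within {0..\<rho>})"
      by (simp add: has_real_derivative_iff_has_vector_derivative)
  qed (use assms in auto)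
  have ai: "(\<lambda>r. r ^ n) absolutely_integrable_on {0..\<rho>}"
    by (rule nonnegative_absolutely_integrable_1) (use fi in auto)
  then have "integrable lebesgue (\<lambda>r. indicator {0..\<rho>} r *\<^sub>R r ^ n)"
      by (simp add: set_integrable_def)
  have "mellin (indicator {..<\<rho>}) (of_nat s)
      = (LINT r|lebesgue. complex_of_real (indicator {0..\<rho>} r *\<^sub>R r ^ n))"
    unfolding mellin_def
  proof (subst integral_restrict_space, simp, rule integral_cong_AE)
    have "AE r in lborel. r \<noteq> \<rho>" "AE r in lborel. r \<noteq> (0::real)" by (rule AE_lborel_singleton)+
    then have "AE r in lebesgue. r \<noteq> \<rho>" "AE r in lebesgue. r \<noteq> (0::real)"
        by (auto intro: AE_completion)
    then show "AE r in lebesgue. indicator {0..1} r *\<^sub>R (indicator {..<\<rho>} r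
        * of_real r powr (of_nat s - 1))
       = complex_of_real (indicator {0..\<rho>} r *\<^sub>R r ^ n)"
    proof eventually_elim
      fix r :: real assume "r \<noteq> \<rho>" "r \<noteq> 0"
      then show "indicator {0..1} r *\<^sub>R (indicator {..<\<rho>} r * of_real r powr (of_nat s - 1))
       = complex_of_real (indicator {0..\<rho>} r *\<^sub>R r ^ n)"
        using assms by (auto simp: s indicator_def powr_nat' of_real_power)
    qed
    show "(\<lambda>r. complex_of_real (indicator {0..\<rho>} r *\<^sub>R r ^ n)) \<in> borel_measurable lebesgue"
      "(\<lambda>r. indicator {0..1} r *\<^sub>R (indicator {..<\<rho>} r * complex_of_real r powr (of_nat s - 1)))
          \<in> borel_measurable lebesgue"
      by (intro measurable_completion, measurable)+
  qed
  also have "\<dots> = of_real (LINT r|lebesgue. indicator {0..\<rho>} r *\<^sub>R r ^ n)"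
    by (rule integral_complex_of_real)
  also have "(LINT r|lebesgue. indicator {0..\<rho>} r *\<^sub>R r ^ n) = integral {0..\<rho>} (\<lambda>r. r ^ n)"
    using set_lebesgue_integral_eq_integral(2)[OF ai] by (simp add: set_lebesgue_integral_def)
  also have "\<dots> = \<rho> ^ s / real s" using fi assms(3) by (auto simp: integral_unique)
  finally show ?thesis .
qed

lemma integrable_dA_bounded:
  fixes f :: "complex \<Rightarrow> complex"
  assumes "f \<in> borel_measurable dA" "\<And>z. z \<in> disk \<Longrightarrow> cmod (f z) \<le> B"
  shows "integrable dA f"
  by (rule finite_measure.integrable_const_bound[OF finite_measure_dA _ assms(1)])
    (use assms(2) in \<open>auto intro!: AE_I2\<close>)

text \<open>The indicator of a smaller disc is itself a radial symbol, so
  \<open>moment_quasihomogeneous\<close> with \<open>k = 0\<close> gives the orthogonality of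
  monomials on it.\<close>

lemma disc_moment:
  assumes "0 < \<rho>" "\<rho> < 1"
  shows "(LINT w|dA. disc_ind \<rho> w * w ^ n * cnj w ^ j)
      = (if n = j then of_real (\<rho> ^ (2 * n + 2) / (real n + 1)) else 0)"
proof -
  have "integrable dA (disc_ind \<rho>)"
    by (rule integrable_dA_bounded[where B = 1, OF disc_ind_measurable]) (auto simp: indicator_def)
  from moment_quasihomogeneous[OF this, of 0 n j]
  have 1: "(LINT w|dA. disc_ind \<rho> w * w ^ n * cnj w ^ j)
      = (if n = j then 2 * mellin (indicator {..<\<rho>}) (of_nat (n + j + 2)) else 0)"
    by (simp add: quasihomogeneous_def)
  have 2: "mellin (indicator {..<\<rho>}) (of_nat (n + n + 2))
      = of_real (\<rho> ^ (n + n + 2) / real (n + n + 2))"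
    by (rule mellin_disc_ind[OF assms]) simp
  have 3: "2 * (\<rho> ^ (n + n + 2) / real (n + n + 2)) = \<rho> ^ (2 * n + 2) / (real n + 1)"
    unfolding mult_2[of n] by (simp add: divide_simps)
  have "2 * mellin (indicator {..<\<rho>}) (of_nat (n + n + 2))
      = of_real (2 * (\<rho> ^ (n + n + 2) / real (n + n + 2)))"
    unfolding 2 by (simp only: of_real_mult of_real_numeral)
  then show ?thesis unfolding 1 3 by auto
qed

lemma partial_sums_bound:
  assumes "has_series f b" "0 < \<rho>" "\<rho> < 1"
  shows "\<exists>B\<ge>0. \<forall>w. cmod w < \<rho> \<longrightarrow> cmod (f w) \<le> B \<and> (\<forall>N. cmod (\<Sum>n<N. b n * w ^ n) \<le> B)"
proof -
  \<comment> \<open>A point strictly between \<rho> and 1: convergence there makes the series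
    absolutely convergent at \<rho>.\<close>
  define x where "x = complex_of_real ((1 + \<rho>) / 2)"
  have "cmod x = (1 + \<rho>) / 2" unfolding x_def norm_of_real using assms by simp
  then have "summable (\<lambda>n. b n * x ^ n)"
    using assms by (auto simp: has_series_def sums_iff dist_norm)
  then have sm: "summable (\<lambda>n. norm (b n * of_real \<rho> ^ n))"
    by (rule powser_insidea) (use assms \<open>cmod x = _\<close> in auto)
  define B where "B = (\<Sum>n. norm (b n * of_real \<rho> ^ n))"
  have 1: "cmod (\<Sum>n<N. b n * w ^ n) \<le> B" if "cmod w < \<rho>" for N w
  proof -
    have "cmod (\<Sum>n<N. b n * w ^ n) \<le> (\<Sum>n<N. norm (b n * of_real \<rho> ^ n))"
      using that assms by (intro sum_norm_le)
          (auto simp: norm_mult norm_power intro!: mult_left_mono power_mono)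
    also have "\<dots> \<le> B" unfolding B_def by (rule sum_le_suminf[OF sm]) auto
    finally show ?thesis .
  qed
  have "cmod (f w) \<le> B" if "cmod w < \<rho>" for w
  proof -
    have "(\<lambda>N. \<Sum>n<N. b n * w ^ n) \<longlonglongrightarrow> f w"
      using assms that by (auto simp: has_series_def sums_def)
    then show ?thesis using 1[OF that] by (intro Lim_bounded[OF tendsto_norm]) auto
  qed
  moreover have "B \<ge> 0" using 1[of 0 0] assms by simp
  ultimately show ?thesis using 1 by blast
qed

lemma disc_inner:
  assumes f: "has_series f b" and \<rho>: "0 < \<rho>" "\<rho> < 1"
  shows "(LINT w|dA. disc_ind \<rho> w * f w * cnj w ^ j)
      = b j * of_real (\<rho> ^ (2 * j + 2) / (real j + 1))"
proof (rule LIMSEQ_unique)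
  obtain B where B: "\<And>N w. cmod w < \<rho> \<Longrightarrow> cmod (\<Sum>n<N. b n * w ^ n) \<le> B"
      "\<And>w. cmod w < \<rho> \<Longrightarrow> cmod (f w) \<le> B" "B \<ge> 0"
    using partial_sums_bound[OF f \<rho>] by auto
  have [measurable]: "f \<in> borel_measurable dA"
    by (intro holomorphic_disk_measurable has_series_holomorphic[OF f])
  have [measurable]: "(\<lambda>w. w ^ n) \<in> borel_measurable dA" "(\<lambda>w. cnj w ^ n) \<in> borel_measurable dA"
      for n
    by (intro borel_measurable_dAI borel_measurable_continuous_onI continuous_intros)+
  show "(\<lambda>N. LINT w|dA. disc_ind \<rho> w * (\<Sum>n<N. b n * w ^ n) * cnj w ^ j)
      \<longlonglongrightarrow> (LINT w|dA. disc_ind \<rho> w * f w * cnj w ^ j)"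
  proof (rule integral_dominated_convergence[where w = "\<lambda>_. B"])
    show "(\<lambda>w. disc_ind \<rho> w * f w * cnj w ^ j) \<in> borel_measurable dA"
      "\<And>N. (\<lambda>w. disc_ind \<rho> w * (\<Sum>n<N. b n * w ^ n) * cnj w ^ j) \<in> borel_measurable dA" by measurable
    show "integrable dA (\<lambda>_. B)" using finite_measure_dA
        by (simp add: finite_measure.integrable_const)
    show "AE w in dA. (\<lambda>N. disc_ind \<rho> w * (\<Sum>n<N. b n * w ^ n) * cnj w ^ j)
        \<longlonglongrightarrow> disc_ind \<rho> w * f w * cnj w ^ j"
      using f by (intro AE_I2 tendsto_intros) (auto simp: has_series_def sums_def)
    show "AE w in dA. norm (disc_ind \<rho> w * (\<Sum>n<N. b n * w ^ n) * cnj w ^ j) \<le> B" for N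
    proof (intro AE_I2)
      fix w assume "w \<in> space dA"
      then have "cmod w ^ j \<le> 1" by (intro power_le_one) auto
      then have "cmod (\<Sum>n<N. b n * w ^ n) * cmod w ^ j \<le> B" if "cmod w < \<rho>"
        using mult_mono[OF B(1)[OF that, of N] \<open>cmod w ^ j \<le> 1\<close>] B(3) by simp
      then show "norm (disc_ind \<rho> w * (\<Sum>n<N. b n * w ^ n) * cnj w ^ j) \<le> B"
        using B(3) by (auto simp: indicator_def norm_mult norm_power)
    qed
  qed
  have int: "integrable dA (\<lambda>w. disc_ind \<rho> w * w ^ n * cnj w ^ j)" for n
  proof (rule integrable_dA_bounded[where B = 1])
    fix w :: complex assume "w \<in> disk"
    then have "cmod w ^ n \<le> 1" "cmod w ^ j \<le> 1" by (auto intro!: power_le_one)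
    then show "cmod (disc_ind \<rho> w * w ^ n * cnj w ^ j) \<le> 1"
      by (auto simp: indicator_def norm_mult norm_power mult_le_one)
  qed measurable
  have S: "(LINT w|dA. disc_ind \<rho> w * (\<Sum>n<N. b n * w ^ n) * cnj w ^ j)
     = (\<Sum>n<N. b n * (if n = j then of_real (\<rho> ^ (2 * n + 2) / (real n + 1)) else 0))" for N
  proof -
    have "(LINT w|dA. disc_ind \<rho> w * (\<Sum>n<N. b n * w ^ n) * cnj w ^ j)
      = (LINT w|dA. (\<Sum>n<N. b n * (disc_ind \<rho> w * w ^ n * cnj w ^ j)))"
      by (intro Bochner_Integration.integral_cong)
          (auto simp: sum_distrib_left sum_distrib_right mult_ac)
    also have "\<dots> = (\<Sum>n<N. b n * (LINT w|dA. disc_ind \<rho> w * w ^ n * cnj w ^ j))"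
      by (subst Bochner_Integration.integral_sum) (auto intro!: integrable_mult_right int)
    finally show ?thesis unfolding disc_moment[OF \<rho>] .
  qed
  have "(\<lambda>N. if j < N then b j * of_real (\<rho> ^ (2 * j + 2) / (real j + 1)) else 0)
      \<longlonglongrightarrow> b j * of_real (\<rho> ^ (2 * j + 2) / (real j + 1))"
    by (rule tendsto_eventually, rule eventually_mono[OF eventually_gt_at_top[of j]]) simp
  also have "(\<lambda>N. if j < N then b j * of_real (\<rho> ^ (2 * j + 2) / (real j + 1)) else 0)
     = (\<lambda>N. LINT w|dA. disc_ind \<rho> w * (\<Sum>n<N. b n * w ^ n) * cnj w ^ j)"
    unfolding S by (auto simp: fun_eq_iff if_distrib[of "\<lambda>x. _ * x"] sum.delta' cong: if_cong)
  finally show "(\<lambda>N. LINT w|dA. disc_ind \<rho> w * (\<Sum>n<N. b n * w ^ n) * cnj w ^ j)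
       \<longlonglongrightarrow> b j * of_real (\<rho> ^ (2 * j + 2) / (real j + 1))" .
qed

lemma has_series_unique:
  assumes "has_series f b" "has_series f c"
  shows "b = c"
proof
  fix j
  have "complex_of_real ((1/2) ^ (2 * j + 2) / (real j + 1)) \<noteq> 0"
    by (simp only: of_real_eq_0_iff) simp
  then show "b j = c j"
    using disc_inner[OF assms(1), of "1/2" j] disc_inner[OF assms(2), of "1/2" j]
    by (simp del: of_real_divide of_real_power)
qed

lemma has_series_taylor_coef_eq: "has_series f b \<Longrightarrow> taylor_coef f = b"
  using has_series_unique has_series_taylor_coef has_series_holomorphic by blast

text \<open>Parseval on the smaller disc. Only the conjugated factor is expanded; each resulting
  integral is then given by \<open>disc_inner\<close>.\<close>

lemma disc_norm:
  assumes f: "has_series f b" and \<rho>: "0 < \<rho>" "\<rho> < 1"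
  shows "(\<lambda>n. (cmod (b n))\<^sup>2 * \<rho> ^ (2 * n + 2) / (real n + 1))
      sums (LINT w|dA. indicator {..<\<rho>} (cmod w) * (cmod (f w))\<^sup>2)"
proof -
  obtain B where B: "\<And>N w. cmod w < \<rho> \<Longrightarrow> cmod (\<Sum>n<N. b n * w ^ n) \<le> B"
      "\<And>w. cmod w < \<rho> \<Longrightarrow> cmod (f w) \<le> B" "B \<ge> 0"
    using partial_sums_bound[OF f \<rho>] by auto
  have fm [measurable]: "f \<in> borel_measurable dA"
    by (intro holomorphic_disk_measurable has_series_holomorphic[OF f])
  have cwm [measurable]: "(\<lambda>w. cnj w ^ n) \<in> borel_measurable dA" for n
    by (intro borel_measurable_dAI borel_measurable_continuous_onI continuous_intros)
  have cfm: "(\<lambda>w. cnj (f w)) \<in> borel_measurable dA"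
    by (rule measurable_compose[OF fm]) (intro borel_measurable_continuous_onI continuous_intros)
  have lim: "(\<lambda>N. LINT w|dA. disc_ind \<rho> w * f w * cnj (\<Sum>n<N. b n * w ^ n))
      \<longlonglongrightarrow> (LINT w|dA. disc_ind \<rho> w * f w * cnj (f w))"
  proof (rule integral_dominated_convergence[where w = "\<lambda>_. B * B"])
    show "(\<lambda>w. disc_ind \<rho> w * f w * cnj (f w)) \<in> borel_measurable dA"
      "\<And>N. (\<lambda>w. disc_ind \<rho> w * f w * cnj (\<Sum>n<N. b n * w ^ n)) \<in> borel_measurable dA"
      unfolding cnj_sum complex_cnj_mult complex_cnj_power
      by (intro borel_measurable_times borel_measurable_sum borel_measurable_const fm cfm cwm
          disc_ind_measurable)+
    show "integrable dA (\<lambda>_. B * B)" using finite_measure_dA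
        by (simp add: finite_measure.integrable_const)
    show "AE w in dA. (\<lambda>N. disc_ind \<rho> w * f w * cnj (\<Sum>n<N. b n * w ^ n))
        \<longlonglongrightarrow> disc_ind \<rho> w * f w * cnj (f w)"
      using f by (intro AE_I2 tendsto_intros) (auto simp: has_series_def sums_def)
    show "AE w in dA. norm (disc_ind \<rho> w * f w * cnj (\<Sum>n<N. b n * w ^ n)) \<le> B * B" for N
    proof (intro AE_I2)
      fix w
      show "norm (disc_ind \<rho> w * f w * cnj (\<Sum>n<N. b n * w ^ n)) \<le> B * B"
        using B(3) mult_mono[OF B(2) B(1), of w w N]
            by (auto simp: indicator_def norm_mult simp del: cnj_sum)
    qed
  qed
  have int: "integrable dA (\<lambda>w. disc_ind \<rho> w * f w * cnj w ^ j)" for j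
  proof (rule integrable_dA_bounded[where B = B])
    fix w :: complex assume "w \<in> disk"
    then have "cmod w ^ j \<le> 1" by (auto intro!: power_le_one)
    then show "cmod (disc_ind \<rho> w * f w * cnj w ^ j) \<le> B"
      using mult_mono[OF B(2) , of w "cmod w ^ j" 1] B(3)
          by (auto simp: indicator_def norm_mult norm_power)
  qed measurable
  have "(LINT w|dA. disc_ind \<rho> w * f w * cnj (\<Sum>n<N. b n * w ^ n))
     = of_real (\<Sum>n<N. (cmod (b n))\<^sup>2 * \<rho> ^ (2 * n + 2) / (real n + 1))" for N
  proof -
    have "(LINT w|dA. disc_ind \<rho> w * f w * cnj (\<Sum>n<N. b n * w ^ n))
      = (LINT w|dA. (\<Sum>n<N. cnj (b n) * (disc_ind \<rho> w * f w * cnj w ^ n)))"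
      by (intro Bochner_Integration.integral_cong)
          (auto simp: sum_distrib_left sum_distrib_right mult_ac)
    also have "\<dots> = (\<Sum>n<N. cnj (b n) * (LINT w|dA. disc_ind \<rho> w * f w * cnj w ^ n))"
      by (subst Bochner_Integration.integral_sum) (auto intro!: integrable_mult_right int)
    also have "\<dots> = of_real (\<Sum>n<N. (cmod (b n))\<^sup>2 * \<rho> ^ (2 * n + 2) / (real n + 1))"
      unfolding disc_inner[OF f \<rho>] of_real_sum
    proof (rule sum.cong[OF refl])
      fix n
      have "cnj (b n) * b n = of_real ((cmod (b n))\<^sup>2)" by (metis complex_norm_square mult.commute)
      then have "cnj (b n) * (b n * of_real (\<rho> ^ (2 * n + 2) / (real n + 1)))
          = of_real ((cmod (b n))\<^sup>2 * (\<rho> ^ (2 * n + 2) / (real n + 1)))"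
        by (simp only: mult.assoc[symmetric] of_real_mult)
      then show "cnj (b n) * (b n * of_real (\<rho> ^ (2 * n + 2) / (real n + 1)))
          = of_real ((cmod (b n))\<^sup>2 * \<rho> ^ (2 * n + 2) / (real n + 1))"
        by simp
    qed
    finally show ?thesis .
  qed
  moreover have "(LINT w|dA. disc_ind \<rho> w * f w * cnj (f w))
      = (LINT w|dA. complex_of_real (indicator {..<\<rho>} (cmod w) * (cmod (f w))\<^sup>2))"
    by (intro Bochner_Integration.integral_cong refl)
        (simp add: complex_norm_square[symmetric] mult.assoc indicator_def)
  ultimately have "(\<lambda>N. complex_of_real (\<Sum>n<N. (cmod (b n))\<^sup>2 * \<rho> ^ (2 * n + 2) / (real n + 1)))
      \<longlonglongrightarrow> of_real (LINT w|dA. indicator {..<\<rho>} (cmod w) * (cmod (f w))\<^sup>2)"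
    using lim by (simp only: integral_complex_of_real)
  then show ?thesis unfolding sums_def tendsto_of_real_iff .
qed

section \<open>The Bergman norm in terms of Taylor coefficients\<close>

definition rho :: "nat \<Rightarrow> real" where
  "rho i = 1 - 1 / (real i + 2)"

lemma rho_bounds: "0 < rho i" "rho i < 1" "i \<le> j \<Longrightarrow> rho i \<le> rho j"
  by (auto simp: rho_def field_simps)

lemma rho_lim: "rho \<longlonglongrightarrow> 1"
  unfolding rho_def by real_asymp

text \<open>z^n has squared norm 1 / (n + 1), so these are the summands of the squared Bergman
  norm.\<close>

definition wsq :: "(nat \<Rightarrow> complex) \<Rightarrow> nat \<Rightarrow> real" where
  "wsq b n = (cmod (b n))\<^sup>2 / (real n + 1)"

lemma wsq_nonneg [simp]: "0 \<le> wsq b n"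
  by (simp add: wsq_def)

lemma L2_norm_sq: "(L2_norm f)\<^sup>2 = (LINT z|dA. (cmod (f z))\<^sup>2)"
  unfolding L2_norm_def by (intro real_sqrt_pow2 integral_nonneg) auto

lemma bergman_series: "f \<in> bergman_space \<Longrightarrow> has_series f (taylor_coef f)"
  by (auto simp: bergman_space_def has_series_taylor_coef)

text \<open>In a finite partial sum the radius may tend to 1 directly; each sum is dominated by the
  integral over a smaller disc, hence by the full norm.\<close>

lemma bergman_wsq:
  assumes f: "f \<in> bergman_space"
  shows "summable (wsq (taylor_coef f))" "suminf (wsq (taylor_coef f)) \<le> (L2_norm f)\<^sup>2"
proof -
  have int: "integrable dA (\<lambda>z. (cmod (f z))\<^sup>2)"
    using f by (auto simp: bergman_space_def square_integrable_def)
  have part: "sum (wsq (taylor_coef f)) {..<N} \<le> (L2_norm f)\<^sup>2" for N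
  proof (rule LIMSEQ_le_const2)
    have "(\<lambda>i. \<Sum>n<N. (cmod (taylor_coef f n))\<^sup>2 * rho i ^ (2 * n + 2) / (real n + 1)) \<longlonglongrightarrow>
        (\<Sum>n<N. (cmod (taylor_coef f n))\<^sup>2 * 1 ^ (2 * n + 2) / (real n + 1))"
      by (intro tendsto_intros rho_lim) auto
    then show "(\<lambda>i. \<Sum>n<N. (cmod (taylor_coef f n))\<^sup>2 * rho i ^ (2 * n + 2) / (real n + 1))
        \<longlonglongrightarrow> sum (wsq (taylor_coef f)) {..<N}"
      by (simp add: wsq_def[abs_def])
    show "\<exists>N'. \<forall>i\<ge>N'. (\<Sum>n<N. (cmod (taylor_coef f n))\<^sup>2 * rho i ^ (2 * n + 2) / (real n + 1))
        \<le> (L2_norm f)\<^sup>2"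
    proof (intro exI allI impI)
      fix i
      have s: "(\<lambda>n. (cmod (taylor_coef f n))\<^sup>2 * rho i ^ (2 * n + 2) / (real n + 1))
          sums (LINT w|dA. indicator {..<rho i} (cmod w) * (cmod (f w))\<^sup>2)"
        by (rule disc_norm[OF bergman_series[OF f] rho_bounds(1,2)])
      have "(\<Sum>n<N. (cmod (taylor_coef f n))\<^sup>2 * rho i ^ (2 * n + 2) / (real n + 1))
          \<le> (LINT w|dA. indicator {..<rho i} (cmod w) * (cmod (f w))\<^sup>2)"
        unfolding sums_unique[OF s] using s rho_bounds(1)[of i]
        by (intro sum_le_suminf) (auto simp: sums_iff)
      also have "\<dots> \<le> (LINT w|dA. (cmod (f w))\<^sup>2)"
        by (intro integral_mono' int) (auto simp: indicator_def)
      finally show "(\<Sum>n<N. (cmod (taylor_coef f n))\<^sup>2 * rho i ^ (2 * n + 2) / (real n + 1))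
          \<le> (L2_norm f)\<^sup>2"
        by (simp add: L2_norm_sq)
    qed
  qed
  show "summable (wsq (taylor_coef f))"
    by (rule bounded_imp_summable[where B = "(L2_norm f)\<^sup>2"])
        (auto simp only: wsq_nonneg lessThan_Suc_atMost[symmetric] part)
  then show "suminf (wsq (taylor_coef f)) \<le> (L2_norm f)\<^sup>2"
    by (rule suminf_le_const) (rule part)
qed

text \<open>The converse inequality: exhausting the disk by radii \<open>rho i\<close>, monotone
  convergence bounds the norm integral by the coefficient sum, which also proves square
  integrability.\<close>

lemma series_bergman:
  assumes f: "has_series f b" and off: "\<And>z. z \<notin> disk \<Longrightarrow> f z = 0" and s: "summable (wsq b)"
  shows "f \<in> bergman_space" "(L2_norm f)\<^sup>2 \<le> suminf (wsq b)"
proof -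
  have fm [measurable]: "f \<in> borel_measurable dA"
    by (intro holomorphic_disk_measurable has_series_holomorphic[OF f])
  let ?g = "\<lambda>i w. ennreal (indicator {..<rho i} (cmod w) * (cmod (f w))\<^sup>2)"
  have im [measurable]: "(\<lambda>w. indicator {..<x} (cmod w) :: real) \<in> borel_measurable dA" for x
    by (rule borel_measurable_dAI) measurable
  have "(\<integral>\<^sup>+w. ennreal ((cmod (f w))\<^sup>2) \<partial>dA) = (\<integral>\<^sup>+w. (SUP i. ?g i w) \<partial>dA)"
  proof (rule nn_integral_cong)
    fix w assume "w \<in> space dA"
    then have w: "cmod w < 1" by simp
    have "\<forall>\<^sub>F i in sequentially. cmod w < rho i" using order_tendstoD(1)[OF rho_lim w] .
    then obtain i where i: "cmod w < rho i" by (auto simp: eventually_sequentially)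
    show "ennreal ((cmod (f w))\<^sup>2) = (SUP i. ?g i w)"
    proof (rule antisym)
      have "ennreal ((cmod (f w))\<^sup>2) = ?g i w" using i by simp
      also have "\<dots> \<le> (SUP i. ?g i w)" by (rule SUP_upper) simp
      finally show "ennreal ((cmod (f w))\<^sup>2) \<le> (SUP i. ?g i w)" .
      show "(SUP i. ?g i w) \<le> ennreal ((cmod (f w))\<^sup>2)"
        by (rule SUP_least) (auto simp: indicator_def intro!: ennreal_leI)
    qed
  qed
  also have "\<dots> = (SUP i. \<integral>\<^sup>+w. ?g i w \<partial>dA)"
  proof (rule nn_integral_monotone_convergence_SUP)
    show "incseq ?g"
      by (intro incseq_SucI le_funI ennreal_leI mult_right_mono)
        (auto simp: indicator_def intro: less_le_trans[OF _ rho_bounds(3)])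
  qed measurable
  also have "\<dots> \<le> ennreal (suminf (wsq b))"
  proof (rule SUP_least)
    fix i
    have sm: "(\<lambda>n. (cmod (b n))\<^sup>2 * rho i ^ (2 * n + 2) / (real n + 1))
        sums (LINT w|dA. indicator {..<rho i} (cmod w) * (cmod (f w))\<^sup>2)"
      by (rule disc_norm[OF f rho_bounds(1,2)])
    obtain B where B: "B \<ge> 0" "\<And>w. cmod w < rho i \<Longrightarrow> cmod (f w) \<le> B"
      using partial_sums_bound[OF f rho_bounds(1,2), of i] by auto
    have "integrable dA (\<lambda>w. indicator {..<rho i} (cmod w) * (cmod (f w))\<^sup>2)"
    proof (rule finite_measure.integrable_const_bound[OF finite_measure_dA, of _ "B\<^sup>2"])
      show "AE w in dA. norm (indicator {..<rho i} (cmod w) * (cmod (f w))\<^sup>2) \<le> B\<^sup>2"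
        using B by (intro AE_I2) (auto simp: indicator_def intro!: power_mono)
    qed measurable
    then have "(\<integral>\<^sup>+w. ?g i w \<partial>dA)
        = ennreal (LINT w|dA. indicator {..<rho i} (cmod w) * (cmod (f w))\<^sup>2)"
      by (intro nn_integral_eq_integral) auto
    also have "\<dots> \<le> ennreal (suminf (wsq b))"
      unfolding sums_unique[OF sm]
    proof (intro ennreal_leI suminf_le s)
      fix n
      have "rho i ^ (2 * n + 2) \<le> 1" using rho_bounds(1,2)[of i] by (intro power_le_one) auto
      then show "(cmod (b n))\<^sup>2 * rho i ^ (2 * n + 2) / (real n + 1) \<le> wsq b n"
        unfolding wsq_def by (intro divide_right_mono mult_left_le) auto
    qed (use sm in \<open>simp add: sums_iff\<close>)
    finally show "(\<integral>\<^sup>+w. ?g i w \<partial>dA) \<le> ennreal (suminf (wsq b))" .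
  qed
  finally have le: "(\<integral>\<^sup>+w. ennreal ((cmod (f w))\<^sup>2) \<partial>dA) \<le> ennreal (suminf (wsq b))" .
  have int: "integrable dA (\<lambda>w. (cmod (f w))\<^sup>2)"
    using le by (intro integrableI_nonneg) (auto simp: le_less_trans)
  show "f \<in> bergman_space"
    using int fm off has_series_holomorphic[OF f]
        by (auto simp: bergman_space_def square_integrable_def)
  show "(L2_norm f)\<^sup>2 \<le> suminf (wsq b)"
  proof -
    have "ennreal (LINT w|dA. (cmod (f w))\<^sup>2) \<le> ennreal (suminf (wsq b))"
      using le nn_integral_eq_integral[OF int] by simp
    then show ?thesis unfolding L2_norm_sq
        by (subst (asm) ennreal_le_iff) (auto intro!: suminf_nonneg s)
  qed
qed

text \<open>The term |b_n z^n| is written as a product p q, with sqrt(n + 1) moved from one factor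
  to the other, and p q <= p^2 + q^2 splits it into a term of the norm and a term of a
  differentiated geometric series.\<close>

lemma wsq_power_summable:
  assumes "summable (wsq b)" "cmod z < 1"
  shows "summable (\<lambda>n. b n * z ^ n)"
proof (rule summable_norm_cancel, rule summable_comparison_test')
  define x where "x = (cmod z)\<^sup>2"
  have "norm x < 1" using assms(2) by (simp add: x_def power_less_one_iff abs_square_less_1)
  then have "summable (\<lambda>n. of_nat (Suc n) * x ^ n)"
    using geometric_deriv_sums[of x] by (auto simp: sums_iff)
  then show "summable (\<lambda>n. wsq b n + of_nat (Suc n) * x ^ n)"
    using assms(1) by (intro summable_add)
  fix n
  define p where "p = cmod (b n) / sqrt (real (Suc n))"
  define q where "q = sqrt (real (Suc n)) * cmod z ^ n"
  have "0 \<le> p * q" by (simp add: p_def q_def)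
  then have "p * q \<le> p\<^sup>2 + q\<^sup>2"
    using sum_squares_bound[of p q] unfolding mult.assoc by linarith
  moreover have "p * q = norm (b n * z ^ n)" by (simp add: p_def q_def norm_mult norm_power)
  moreover have "p\<^sup>2 = wsq b n" "q\<^sup>2 = of_nat (Suc n) * x ^ n"
    by (simp_all add: p_def q_def wsq_def x_def power_divide power_mult_distrib
        power_mult[symmetric] mult.commute)
  ultimately show "norm (norm (b n * z ^ n)) \<le> wsq b n + of_nat (Suc n) * x ^ n" by simp
qed

definition pser :: "(nat \<Rightarrow> complex) \<Rightarrow> complex \<Rightarrow> complex" where
  "pser b = on_disk (\<lambda>z. \<Sum>n. b n * z ^ n)"

lemma pser_bergman:
  assumes "summable (wsq b)"
  shows "has_series (pser b) b" "pser b \<in> bergman_space" "taylor_coef (pser b) = b"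
      "(L2_norm (pser b))\<^sup>2 = suminf (wsq b)"
proof -
  show s: "has_series (pser b) b"
    using wsq_power_summable[OF assms]
        by (auto simp: has_series_def pser_def on_disk_def summable_sums dist_norm)
  show m: "pser b \<in> bergman_space"
      by (rule series_bergman(1)[OF s _ assms]) (simp add: pser_def on_disk_def)
  show t: "taylor_coef (pser b) = b" by (rule has_series_taylor_coef_eq[OF s])
  have "(L2_norm (pser b))\<^sup>2 \<le> suminf (wsq b)"
      by (rule series_bergman(2)[OF s _ assms]) (simp add: pser_def on_disk_def)
  then show "(L2_norm (pser b))\<^sup>2 = suminf (wsq b)" using bergman_wsq(2)[OF m] t by simp
qed

lemma bergman_pser:
  assumes "f \<in> bergman_space"
  shows "pser (taylor_coef f) = f"
proof
  fix z
  show "pser (taylor_coef f) z = f z"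
    using bergman_series[OF assms] assms
    by (cases "z \<in> disk")
        (auto simp: pser_def on_disk_def has_series_def sums_iff bergman_space_def)
qed

lemma bergman_eqI: "f \<in> bergman_space \<Longrightarrow> g \<in> bergman_space \<Longrightarrow> taylor_coef f = taylor_coef g \<Longrightarrow> f = g"
  by (metis bergman_pser)

lemma bergman_L2_norm: "f \<in> bergman_space \<Longrightarrow> (L2_norm f)\<^sup>2 = suminf (wsq (taylor_coef f))"
  using bergman_wsq(1) bergman_pser pser_bergman(4) by metis

section \<open>Linear structure on coefficients\<close>

lemma wsq_add_summable:
  assumes "summable (wsq b)" "summable (wsq c)"
  shows "summable (wsq (\<lambda>n. b n + c n))"
proof (rule summable_comparison_test')
  show "summable (\<lambda>n. 2 * wsq b n + 2 * wsq c n)" using assms by (intro summable_add summable_mult)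
  fix n
  have "(cmod (b n + c n))\<^sup>2 \<le> (cmod (b n) + cmod (c n))\<^sup>2"
      by (intro power_mono norm_triangle_ineq) auto
  also have "\<dots> \<le> 2 * (cmod (b n))\<^sup>2 + 2 * (cmod (c n))\<^sup>2"
    using sum_squares_bound[of "cmod (b n)" "cmod (c n)"] by (simp add: power2_sum)
  finally have "(cmod (b n + c n))\<^sup>2 / (real n + 1)
      \<le> (2 * (cmod (b n))\<^sup>2 + 2 * (cmod (c n))\<^sup>2) / (real n + 1)"
    by (rule divide_right_mono) simp
  then show "norm (wsq (\<lambda>n. b n + c n) n) \<le> 2 * wsq b n + 2 * wsq c n"
    by (simp add: wsq_def add_divide_distrib)
qed

lemma wsq_scale: "wsq (\<lambda>n. c * b n) n = (cmod c)\<^sup>2 * wsq b n"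
  by (simp add: wsq_def norm_mult power_mult_distrib)

lemma bergman_add:
  assumes "f \<in> bergman_space" "g \<in> bergman_space"
  shows "f + g \<in> bergman_space" "taylor_coef (f + g) = (\<lambda>n. taylor_coef f n + taylor_coef g n)"
proof -
  have s: "has_series (f + g) (\<lambda>n. taylor_coef f n + taylor_coef g n)"
    using bergman_series[OF assms(1)] bergman_series[OF assms(2)]
    by (auto simp: has_series_def distrib_right intro!: sums_add)
  show "f + g \<in> bergman_space"
    by (rule series_bergman(1)[OF s])
        (use assms bergman_wsq(1) wsq_add_summable in \<open>auto simp: bergman_space_def\<close>)
  show "taylor_coef (f + g) = (\<lambda>n. taylor_coef f n + taylor_coef g n)"
      by (rule has_series_taylor_coef_eq[OF s])
qed

lemma bergman_scale:
  assumes "f \<in> bergman_space"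
  shows "fscale c f \<in> bergman_space" "taylor_coef (fscale c f) = (\<lambda>n. c * taylor_coef f n)"
proof -
  have s: "has_series (fscale c f) (\<lambda>n. c * taylor_coef f n)"
    using bergman_series[OF assms(1)]
    by (auto simp: has_series_def fscale_def mult.assoc intro!: sums_mult)
  have "summable (\<lambda>n. wsq (\<lambda>n. c * taylor_coef f n) n)"
    unfolding wsq_scale using bergman_wsq(1)[OF assms] by (rule summable_mult)
  then show "fscale c f \<in> bergman_space"
    by (intro series_bergman(1)[OF s]) (use assms in \<open>auto simp: bergman_space_def fscale_def\<close>)
  show "taylor_coef (fscale c f) = (\<lambda>n. c * taylor_coef f n)"
      by (rule has_series_taylor_coef_eq[OF s])
qed

lemma bergman_diff:
  assumes "f \<in> bergman_space" "g \<in> bergman_space"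
  shows "f - g \<in> bergman_space" "taylor_coef (f - g) = (\<lambda>n. taylor_coef f n - taylor_coef g n)"
proof -
  have e: "f - g = f + fscale (-1) g" by (auto simp: fscale_def)
  show "f - g \<in> bergman_space"
    unfolding e by (rule bergman_add(1)[OF assms(1) bergman_scale(1)[OF assms(2)]])
  show "taylor_coef (f - g) = (\<lambda>n. taylor_coef f n - taylor_coef g n)"
    unfolding e bergman_add(2)[OF assms(1) bergman_scale(1)[OF assms(2)]]
        bergman_scale(2)[OF assms(2)] by simp
qed

text \<open>Coefficient functionals are continuous in norm. Limits and closures in the Bergman space
  are handled below through this bound.\<close>

lemma taylor_coef_norm_bound:
  assumes "f \<in> bergman_space"
  shows "cmod (taylor_coef f n) \<le> sqrt (real n + 1) * L2_norm f"
proof -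
  have "sum (wsq (taylor_coef f)) {n} \<le> suminf (wsq (taylor_coef f))"
    by (rule sum_le_suminf) (auto simp: bergman_wsq(1)[OF assms])
  then have "wsq (taylor_coef f) n \<le> (L2_norm f)\<^sup>2" using bergman_wsq(2)[OF assms] by simp
  then have "(cmod (taylor_coef f n))\<^sup>2 \<le> (sqrt (real n + 1) * L2_norm f)\<^sup>2"
    by (simp add: wsq_def pos_divide_le_eq power_mult_distrib mult.commute)
  then show ?thesis by (rule power2_le_imp_le) (simp add: L2_norm_def)
qed

lemma poly_bergman: "on_disk (poly p) = pser (coeff p)" "summable (wsq (coeff p))"
proof -
  show s: "summable (wsq (coeff p))"
    by (rule summable_finite[of "{..degree p}"]) (auto simp: wsq_def coeff_eq_0 not_le)
  show "on_disk (poly p) = pser (coeff p)"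
  proof
    fix z
    have "(\<Sum>n. coeff p n * z ^ n) = (\<Sum>n\<le>degree p. coeff p n * z ^ n)"
      by (rule suminf_finite) (auto simp: coeff_eq_0 not_le)
    then show "on_disk (poly p) z = pser (coeff p) z"
      by (simp add: on_disk_def pser_def poly_altdef)
  qed
qed

lemma on_disk_poly: "on_disk (poly p) \<in> bergman_space" "taylor_coef (on_disk (poly p)) = coeff p"
  unfolding poly_bergman(1) by (rule pser_bergman[OF poly_bergman(2)])+

section \<open>Weighted shifts and Toeplitz operators\<close>

text \<open>The weight is indexed by the output coefficient \<open>j\<close>; the guard says that
  the input coefficient \<open>j - k\<close> exists.\<close>

definition shifted :: "int \<Rightarrow> (nat \<Rightarrow> complex) \<Rightarrow> (nat \<Rightarrow> complex) \<Rightarrow> nat \<Rightarrow> complex" where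
  "shifted k w b = (\<lambda>j. if k \<le> int j then w j * b (nat (int j - k)) else 0)"

definition wshift :: "int \<Rightarrow> (nat \<Rightarrow> complex) \<Rightarrow> (complex \<Rightarrow> complex) \<Rightarrow> complex \<Rightarrow> complex" where
  "wshift k w = (\<lambda>f\<in>bergman_space. pser (shifted k w (taylor_coef f)))"

definition bounded_weight :: "int \<Rightarrow> (nat \<Rightarrow> complex) \<Rightarrow> bool" where
  "bounded_weight k w \<longleftrightarrow> (\<exists>K. \<forall>j. k \<le> int j \<longrightarrow> cmod (w j) \<le> K)"

lemma wsq_shifted_sum:
  assumes s: "summable (wsq b)" and K: "\<And>j. k \<le> int j \<Longrightarrow> cmod (w j) \<le> K"
  shows "sum (wsq (shifted k w b)) {..<N} \<le> K\<^sup>2 * (1 + \<bar>k\<bar>) * suminf (wsq b)"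
proof -
  let ?A = "{j. j < N \<and> k \<le> int j}" and ?h = "\<lambda>j. nat (int j - k)"
  have inj: "inj_on ?h ?A" by (auto simp: inj_on_def)
  have fin: "finite ?A" by (rule finite_subset[of _ "{..<N}"]) auto
  have "sum (wsq (shifted k w b)) {..<N} = sum (wsq (shifted k w b)) ?A"
    by (rule sum.mono_neutral_right) (auto simp: wsq_def shifted_def)
  also have "\<dots> \<le> (\<Sum>j\<in>?A. K\<^sup>2 * (1 + \<bar>k\<bar>) * wsq b (?h j))"
  proof (rule sum_mono)
    fix j assume "j \<in> ?A"
    then have j: "k \<le> int j" by simp
    define n where "n = ?h j"
    have n: "int n = int j - k" using j by (simp add: n_def)
    \<comment> \<open>The shift changes the norm of a monomial; this bounds the ratio of the squared
      norms, 1 / (j + 1) against 1 / (n + 1), by \<open>1 + \<bar>k\<bar>\<close>.\<close>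
    have "int n + 1 \<le> (1 + \<bar>k\<bar>) * (int j + 1)"
    proof -
      have "\<bar>k\<bar> * 1 \<le> \<bar>k\<bar> * (int j + 1)" by (intro mult_left_mono) auto
      then show ?thesis unfolding n by (simp add: distrib_right)
    qed
    then have "real_of_int (int n + 1) \<le> real_of_int ((1 + \<bar>k\<bar>) * (int j + 1))"
        by (simp only: of_int_le_iff)
    then have "real n + 1 \<le> (1 + \<bar>k\<bar>) * (real j + 1)" by simp
    then have 1: "1 / (real j + 1) \<le> (1 + \<bar>k\<bar>) / (real n + 1)" by (simp add: field_simps)
    have "K \<ge> 0" using K[OF j] norm_ge_zero[of "w j"] by linarith
    have "(cmod (w j))\<^sup>2 \<le> K\<^sup>2" using K[OF j] by (intro power_mono) auto
    then have "((cmod (w j))\<^sup>2 * (cmod (b n))\<^sup>2) * (1 / (real j + 1))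
        \<le> (K\<^sup>2 * (cmod (b n))\<^sup>2) * ((1 + \<bar>k\<bar>) / (real n + 1))"
      by (intro mult_mono 1 mult_right_mono) auto
    then show "wsq (shifted k w b) j \<le> K\<^sup>2 * (1 + \<bar>k\<bar>) * wsq b (?h j)"
      using j by (simp add: wsq_def shifted_def n_def[symmetric] norm_mult power_mult_distrib
          mult_ac)
  qed
  also have "\<dots> = K\<^sup>2 * (1 + \<bar>k\<bar>) * sum (wsq b) (?h ` ?A)"
    by (simp add: sum.reindex[OF inj] sum_distrib_left o_def)
  also have "\<dots> \<le> K\<^sup>2 * (1 + \<bar>k\<bar>) * suminf (wsq b)"
    using fin by (intro mult_left_mono sum_le_suminf s) auto
  finally show ?thesis by simp
qed

lemma wsq_shifted:
  assumes s: "summable (wsq b)" and K: "\<And>j. k \<le> int j \<Longrightarrow> cmod (w j) \<le> K"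
  shows "summable (wsq (shifted k w b))"
      "suminf (wsq (shifted k w b)) \<le> K\<^sup>2 * (1 + \<bar>k\<bar>) * suminf (wsq b)"
proof -
  show "summable (wsq (shifted k w b))"
    by (rule bounded_imp_summable[where B = "K\<^sup>2 * (1 + \<bar>k\<bar>) * suminf (wsq b)"])
      (use wsq_shifted_sum[OF s K] in \<open>auto simp only: wsq_nonneg lessThan_Suc_atMost[symmetric]\<close>)
  then show "suminf (wsq (shifted k w b)) \<le> K\<^sup>2 * (1 + \<bar>k\<bar>) * suminf (wsq b)"
    by (rule suminf_le_const) (use wsq_shifted_sum[OF s K] in auto)
qed

lemma wshift_bergman:
  assumes "bounded_weight k w" "f \<in> bergman_space"
  shows "wshift k w f \<in> bergman_space" "taylor_coef (wshift k w f) = shifted k w (taylor_coef f)"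
proof -
  obtain K where "\<And>j. k \<le> int j \<Longrightarrow> cmod (w j) \<le> K" using assms(1) by (auto simp: bounded_weight_def)
  from wsq_shifted(1)[OF bergman_wsq(1)[OF assms(2)] this]
  show "wshift k w f \<in> bergman_space" "taylor_coef (wshift k w f) = shifted k w (taylor_coef f)"
    using pser_bergman assms(2) by (auto simp: wshift_def)
qed

lemma bounded_operator_wshift:
  assumes w: "bounded_weight k w"
  shows "bounded_operator (wshift k w)"
  unfolding bounded_operator_def
proof (intro conjI ballI allI)
  show "wshift k w \<in> bergman_space \<rightarrow>\<^sub>E bergman_space"
    using wshift_bergman(1)[OF w] by (auto simp: wshift_def)
  fix f assume f: "f \<in> bergman_space"
  show "wshift k w (f + g) = wshift k w f + wshift k w g" if g: "g \<in> bergman_space" for g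
    by (rule bergman_eqI)
      (auto simp: wshift_bergman[OF w] bergman_add f g shifted_def fun_eq_iff distrib_left)
  show "wshift k w (fscale c f) = fscale c (wshift k w f)" for c
    by (rule bergman_eqI)
      (auto simp: wshift_bergman[OF w] bergman_scale f shifted_def fun_eq_iff)
next
  obtain K where K: "\<And>j. k \<le> int j \<Longrightarrow> cmod (w j) \<le> K" using w by (auto simp: bounded_weight_def)
  have "K \<ge> 0" by (rule order_trans[OF norm_ge_zero K[of "nat \<bar>k\<bar>"]]) simp
  show "\<exists>M. \<forall>f\<in>bergman_space. L2_norm (wshift k w f) \<le> M * L2_norm f"
  proof (intro exI ballI)
    fix f assume f: "f \<in> bergman_space"
    have "(L2_norm (wshift k w f))\<^sup>2 = suminf (wsq (shifted k w (taylor_coef f)))"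
      by (simp add: bergman_L2_norm wshift_bergman[OF w f])
    also have "\<dots> \<le> K\<^sup>2 * (1 + \<bar>k\<bar>) * (L2_norm f)\<^sup>2"
      unfolding bergman_L2_norm[OF f] using wsq_shifted(2)[OF bergman_wsq(1)[OF f] K] by simp
    also have "\<dots> = (K * sqrt (1 + \<bar>k\<bar>) * L2_norm f)\<^sup>2"
      by (simp add: power_mult_distrib)
    finally show "L2_norm (wshift k w f) \<le> K * sqrt (1 + \<bar>k\<bar>) * L2_norm f"
      by (rule power2_le_imp_le)
          (use \<open>K \<ge> 0\<close> in \<open>auto simp: L2_norm_def intro!: mult_nonneg_nonneg\<close>)
  qed
qed

section \<open>Density of polynomials and uniqueness of bounded extensions\<close>

lemma poly_dense:
  assumes f: "f \<in> bergman_space"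
  shows "(\<lambda>N. L2_norm (f - on_disk (poly (\<Sum>n<N. monom (taylor_coef f n) n)))) \<longlonglongrightarrow> 0"
proof -
  let ?p = "\<lambda>N. \<Sum>n<N. monom (taylor_coef f n) n"
  have c: "coeff (?p N) n = (if n < N then taylor_coef f n else 0)" for N n
    by (simp add: coeff_sum)
  have m: "f - on_disk (poly (?p N)) \<in> bergman_space" for N
    by (intro bergman_diff f on_disk_poly)
  have t: "taylor_coef (f - on_disk (poly (?p N))) = (\<lambda>n. if n < N then 0 else taylor_coef f n)"
      for N
    by (auto simp: bergman_diff f on_disk_poly c fun_eq_iff)
  have s: "summable (wsq (taylor_coef f))" by (rule bergman_wsq(1)[OF f])
  have "(L2_norm (f - on_disk (poly (?p N))))\<^sup>2
      = suminf (wsq (taylor_coef f)) - sum (wsq (taylor_coef f)) {..<N}" for N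
  proof -
    have e: "wsq (\<lambda>n. if n < N then 0 else taylor_coef f n)
        = (\<lambda>n. wsq (taylor_coef f) n - (if n < N then wsq (taylor_coef f) n else 0))"
      by (auto simp: wsq_def fun_eq_iff)
    have "(\<lambda>n. if n \<in> {..<N} then wsq (taylor_coef f) n else 0)
        sums sum (wsq (taylor_coef f)) {..<N}"
      by (rule sums_If_finite_set) simp
    then have "(\<lambda>n. wsq (taylor_coef f) n - (if n < N then wsq (taylor_coef f) n else 0))
        sums (suminf (wsq (taylor_coef f)) - sum (wsq (taylor_coef f)) {..<N})"
      using summable_sums[OF s] by (intro sums_diff) auto
    then show ?thesis unfolding bergman_L2_norm[OF m] t e by (simp add: sums_iff)
  qed
  moreover have "(\<lambda>N. suminf (wsq (taylor_coef f)) - sum (wsq (taylor_coef f)) {..<N})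
      \<longlonglongrightarrow> suminf (wsq (taylor_coef f)) - suminf (wsq (taylor_coef f))"
    by (intro tendsto_intros summable_LIMSEQ s)
  ultimately have "(\<lambda>N. (L2_norm (f - on_disk (poly (?p N))))\<^sup>2) \<longlonglongrightarrow> 0" by simp
  then have "(\<lambda>N. sqrt ((L2_norm (f - on_disk (poly (?p N))))\<^sup>2)) \<longlonglongrightarrow> sqrt 0"
      by (rule tendsto_real_sqrt)
  then show ?thesis by (simp add: L2_norm_def)
qed

lemma bounded_operator_diff:
  assumes "bounded_operator T" "f \<in> bergman_space" "g \<in> bergman_space"
  shows "T (f - g) = T f - T g"
proof -
  have "f - g = f + fscale (-1) g" by (auto simp: fscale_def)
  then have "T (f - g) = T f + T (fscale (-1) g)"
    using assms bergman_scale(1)[OF assms(3), of "-1"] unfolding bounded_operator_def by metis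
  also have "T (fscale (-1) g) = fscale (-1) (T g)"
    using assms unfolding bounded_operator_def by blast
  also have "T f + fscale (-1) (T g) = T f - T g" by (auto simp: fscale_def)
  finally show ?thesis .
qed

text \<open>Taylor polynomials converge in norm; boundedness and
  \<open>taylor_coef_norm_bound\<close> pass this on to every coefficient of the images, where the
  two operators are compared.\<close>

lemma bounded_operator_unique:
  assumes T: "bounded_operator T" and S: "bounded_operator S"
    and eq: "\<And>p :: complex poly. T (on_disk (poly p)) = S (on_disk (poly p))"
  shows "T = S"
proof (rule PiE_ext)
  show "T \<in> bergman_space \<rightarrow>\<^sub>E bergman_space" "S \<in> bergman_space \<rightarrow>\<^sub>E bergman_space"
    using T S by (auto simp: bounded_operator_def)
  fix f assume f: "f \<in> bergman_space"
  let ?p = "\<lambda>N. on_disk (poly (\<Sum>n<N. monom (taylor_coef f n) n))"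
  have p: "?p N \<in> bergman_space" for N by (rule on_disk_poly)
  have lim: "(\<lambda>N. taylor_coef (T (?p N)) j) \<longlonglongrightarrow> taylor_coef (T f) j" if T: "bounded_operator T"
      for T j
  proof -
    have mem: "T g \<in> bergman_space" if "g \<in> bergman_space" for g using T that
        by (auto simp: bounded_operator_def)
    have "\<exists>K. \<forall>f\<in>bergman_space. L2_norm (T f) \<le> K * L2_norm f" using T
        by (simp add: bounded_operator_def)
    then obtain K where K: "\<And>f. f \<in> bergman_space \<Longrightarrow> L2_norm (T f) \<le> K * L2_norm f" by metis
    have "(\<lambda>N. taylor_coef (T f) j - taylor_coef (T (?p N)) j) \<longlonglongrightarrow> 0"
    proof (rule Lim_null_comparison)
      show "\<forall>\<^sub>F N in sequentially. norm (taylor_coef (T f) j - taylor_coef (T (?p N)) j)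
          \<le> sqrt (real j + 1) * (K * L2_norm (f - ?p N))"
      proof (intro always_eventually allI)
        fix N
        have "taylor_coef (T f) j - taylor_coef (T (?p N)) j = taylor_coef (T (f - ?p N)) j"
          by (simp add: bounded_operator_diff[OF T f p] bergman_diff mem f p)
        also have "cmod \<dots> \<le> sqrt (real j + 1) * L2_norm (T (f - ?p N))"
          by (intro taylor_coef_norm_bound mem bergman_diff f p)
        also have "\<dots> \<le> sqrt (real j + 1) * (K * L2_norm (f - ?p N))"
          by (intro mult_left_mono K bergman_diff f p) auto
        finally show "norm (taylor_coef (T f) j - taylor_coef (T (?p N)) j)
            \<le> sqrt (real j + 1) * (K * L2_norm (f - ?p N))" .
      qed
      have "(\<lambda>N. sqrt (real j + 1) * (K * L2_norm (f - ?p N))) \<longlonglongrightarrow> sqrt (real j + 1) * (K * 0)"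
        by (intro tendsto_intros poly_dense f)
      then show "(\<lambda>N. sqrt (real j + 1) * (K * L2_norm (f - ?p N))) \<longlonglongrightarrow> 0" by simp
    qed
    then have "(\<lambda>N. taylor_coef (T f) j - (taylor_coef (T f) j - taylor_coef (T (?p N)) j))
        \<longlonglongrightarrow> taylor_coef (T f) j - 0"
      by (intro tendsto_diff tendsto_const)
    then show ?thesis by simp
  qed
  have "taylor_coef (T f) j = taylor_coef (S f) j" for j
    using LIMSEQ_unique[OF lim[OF T, of j]] lim[OF S, of j] by (simp add: eq)
  then show "T f = S f"
    using T S f by (intro bergman_eqI) (auto simp: bounded_operator_def)
qed

text \<open>Discharges the definite description: the shift is a witness, and agreement on
  polynomials makes it the only one.\<close>

lemma toeplitz_eqI:
  assumes w: "bounded_weight k w"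
    and eq: "\<And>p :: complex poly. pser (shifted k w (coeff p)) = bergman_proj (\<lambda>w. u w * poly p w)"
  shows "toeplitz u = wshift k w"
  unfolding toeplitz_def
proof (rule the_equality)
  have 1: "wshift k w (on_disk (poly p)) = bergman_proj (\<lambda>w. u w * poly p w)" for p
    unfolding eq[symmetric] by (simp add: wshift_def on_disk_poly)
  then show "bounded_operator (wshift k w)
      \<and> (\<forall>p. wshift k w (on_disk (poly p)) = bergman_proj (\<lambda>w. u w * poly p w))"
    using bounded_operator_wshift[OF w] by simp
  show "T = wshift k w"
      if "bounded_operator T \<and> (\<forall>p. T (on_disk (poly p)) = bergman_proj (\<lambda>w. u w * poly p w))" for T
    using that 1 by (intro bounded_operator_unique bounded_operator_wshift[OF w]) auto
qed

text \<open>The kernel is the series of (j + 1) (z cnj w)^j, with majorant the sum of (j + 1) |z|^j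
  |v|. Thus the j-th coefficient of the projection is j + 1 times a moment.\<close>

lemma kernel_series:
  assumes v: "integrable dA v" and z: "cmod z < 1"
  shows "(\<lambda>j. of_nat (Suc j) * z ^ j * (LINT w|dA. v w * cnj w ^ j))
      sums (LINT w|dA. v w / (1 - z * cnj w)\<^sup>2)"
proof -
  have [measurable]: "v \<in> borel_measurable dA" using v by auto
  have cm [measurable]: "(\<lambda>w. cnj w) \<in> borel_measurable dA"
    by (intro borel_measurable_dAI borel_measurable_continuous_onI continuous_intros)
  have zs: "summable (\<lambda>j. real (Suc j) * cmod z ^ j)"
    using geometric_deriv_sums[of "cmod z"] z by (auto simp: sums_iff)
  define B where "B = (\<Sum>j. real (Suc j) * cmod z ^ j)"
  have lt: "cmod (z * cnj w) < 1" if "cmod w < 1" for w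
    using mult_strict_mono'[OF z that] by (simp add: norm_mult)
  have int: "integrable dA (\<lambda>w. v w * cnj w ^ j)" for j
  proof (rule Bochner_Integration.integrable_bound[OF integrable_norm[OF v]])
    show "AE w in dA. norm (v w * cnj w ^ j) \<le> norm (norm (v w))"
      by (intro AE_I2) (auto simp: norm_mult norm_power power_le_one intro!: mult_left_le)
  qed measurable
  have "(\<lambda>N. LINT w|dA. (\<Sum>j<N. of_nat (Suc j) * z ^ j * (v w * cnj w ^ j)))
      \<longlonglongrightarrow> (LINT w|dA. v w / (1 - z * cnj w)\<^sup>2)"
  proof (rule integral_dominated_convergence[where w = "\<lambda>w. B * cmod (v w)"])
    show "(\<lambda>w. v w / (1 - z * cnj w)\<^sup>2) \<in> borel_measurable dA"
      "\<And>N. (\<lambda>w. \<Sum>j<N. of_nat (Suc j) * z ^ j * (v w * cnj w ^ j)) \<in> borel_measurable dA"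
          by measurable
    show "integrable dA (\<lambda>w. B * cmod (v w))" using v
        by (intro integrable_mult_right integrable_norm)
    show "AE w in dA. (\<lambda>N. \<Sum>j<N. of_nat (Suc j) * z ^ j * (v w * cnj w ^ j))
        \<longlonglongrightarrow> v w / (1 - z * cnj w)\<^sup>2"
    proof (intro AE_I2)
      fix w assume "w \<in> space dA"
      then have "cmod w < 1" by simp
      from sums_mult[OF geometric_deriv_sums[OF lt[OF this]], of "v w"]
      show "(\<lambda>N. \<Sum>j<N. of_nat (Suc j) * z ^ j * (v w * cnj w ^ j)) \<longlonglongrightarrow> v w / (1 - z * cnj w)\<^sup>2"
        by (simp add: sums_def power_mult_distrib mult_ac del: of_nat_Suc)
    qed
    show "AE w in dA. norm (\<Sum>j<N. of_nat (Suc j) * z ^ j * (v w * cnj w ^ j)) \<le> B * cmod (v w)"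
        for N
    proof (intro AE_I2)
      fix w assume "w \<in> space dA"
      then have w: "cmod w < 1" by simp
      have "norm (\<Sum>j<N. of_nat (Suc j) * z ^ j * (v w * cnj w ^ j))
          \<le> (\<Sum>j<N. real (Suc j) * cmod z ^ j * cmod (v w))"
      proof (rule sum_norm_le)
        fix j
        have "cmod w ^ j \<le> 1" using w by (intro power_le_one) auto
        then have "real (Suc j) * cmod z ^ j * cmod (v w) * cmod w ^ j
            \<le> real (Suc j) * cmod z ^ j * cmod (v w) * 1"
          by (intro mult_left_mono) auto
        then show "norm (of_nat (Suc j) * z ^ j * (v w * cnj w ^ j))
            \<le> real (Suc j) * cmod z ^ j * cmod (v w)"
          unfolding norm_mult norm_power norm_of_nat complex_mod_cnj
              by (simp only: mult.assoc mult_1_right)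
      qed
      also have "\<dots> = (\<Sum>j<N. real (Suc j) * cmod z ^ j) * cmod (v w)"
          by (simp add: sum_distrib_right)
      also have "\<dots> \<le> B * cmod (v w)"
        unfolding B_def by (intro mult_right_mono sum_le_suminf zs) auto
      finally show "norm (\<Sum>j<N. of_nat (Suc j) * z ^ j * (v w * cnj w ^ j)) \<le> B * cmod (v w)" .
    qed
  qed
  moreover have "(LINT w|dA. (\<Sum>j<N. of_nat (Suc j) * z ^ j * (v w * cnj w ^ j)))
      = (\<Sum>j<N. of_nat (Suc j) * z ^ j * (LINT w|dA. v w * cnj w ^ j))" for N
    by (subst Bochner_Integration.integral_sum)
        (auto intro!: integrable_mult_right int simp del: of_nat_Suc)
  ultimately show ?thesis by (simp add: sums_def del: of_nat_Suc)
qed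

text \<open>\<open>Suc j\<close> comes from the kernel, 2 from the polar area element, and the
  argument is n + j + 2 for the input degree n = j - k.\<close>

definition toeplitz_weight :: "int \<Rightarrow> (real \<Rightarrow> complex) \<Rightarrow> nat \<Rightarrow> complex" where
  "toeplitz_weight k \<phi> j = 2 * of_nat (Suc j) * mellin \<phi> (of_int (2 * int j - k + 2))"

lemma bergman_proj_quasihomogeneous:
  fixes p :: "complex poly"
  assumes \<phi>: "integrable dA (\<lambda>z. \<phi> (cmod z))"
  shows "pser (shifted k (toeplitz_weight k \<phi>) (coeff p))
      = bergman_proj (\<lambda>w. quasihomogeneous k \<phi> w * poly p w)"
proof
  fix z
  let ?u = "quasihomogeneous k \<phi>"
  have u: "integrable dA ?u" by (rule quasihomogeneous_integrable[OF \<phi>])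
  have int: "integrable dA (\<lambda>w. ?u w * w ^ n * cnj w ^ j)" for n j
  proof (rule Bochner_Integration.integrable_bound[OF integrable_norm[OF u]])
    have [measurable]: "?u \<in> borel_measurable dA" using u by auto
    have [measurable]: "(\<lambda>w. cnj w) \<in> borel_measurable dA" "(\<lambda>w. w) \<in> borel_measurable dA"
      by (intro borel_measurable_dAI borel_measurable_continuous_onI continuous_intros)+
    show "(\<lambda>w. ?u w * w ^ n * cnj w ^ j) \<in> borel_measurable dA" by measurable
    show "AE w in dA. norm (?u w * w ^ n * cnj w ^ j) \<le> norm (norm (?u w))"
      by (intro AE_I2) (auto simp: norm_mult norm_power power_le_one mult.assoc intro!: mult_left_le
          mult_le_one)
  qed
  have mom: "(LINT w|dA. ?u w * poly p w * cnj w ^ j)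
      = (if k \<le> int j then coeff p (nat (int j - k)) * (2 * mellin \<phi> (of_int (2 * int j - k + 2)))
      else 0)" for j
  proof -
    have "(LINT w|dA. ?u w * poly p w * cnj w ^ j)
        = (LINT w|dA. (\<Sum>n\<le>degree p. coeff p n * (?u w * w ^ n * cnj w ^ j)))"
      by (intro Bochner_Integration.integral_cong)
          (auto simp: poly_altdef sum_distrib_left sum_distrib_right mult_ac)
    also have "\<dots> = (\<Sum>n\<le>degree p. coeff p n * (LINT w|dA. ?u w * w ^ n * cnj w ^ j))"
      by (subst Bochner_Integration.integral_sum) (auto intro!: integrable_mult_right int)
    also have "\<dots> = (\<Sum>n\<le>degree p. if int n + k
        = int j then coeff p n * (2 * mellin \<phi> (of_nat (n + j + 2))) else 0)"
      unfolding moment_quasihomogeneous[OF \<phi>] by (intro sum.cong) auto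
    also have "\<dots> = (if k \<le> int j then coeff p (nat (int j - k))
        * (2 * mellin \<phi> (of_int (2 * int j - k + 2))) else 0)"
    proof (cases "k \<le> int j")
      case True
      define m where "m = nat (int j - k)"
      have m: "int m = int j - k" using True by (simp add: m_def)
      then have e: "int n + k = int j \<longleftrightarrow> n = m" for n by auto
      have "int (m + j + 2) = 2 * int j - k + 2" using m by simp
      then have mel: "of_nat (m + j + 2) = (of_int (2 * int j - k + 2) :: complex)"
          by (metis of_int_of_nat_eq)
      show ?thesis
        unfolding e sum.delta[OF finite_atMost] mel m_def[symmetric] using True
            by (simp add: coeff_eq_0)
    next
      case False
      then show ?thesis by (auto intro!: sum.neutral)
    qed
    finally show ?thesis .
  qed
  show "pser (shifted k (toeplitz_weight k \<phi>) (coeff p)) z = bergman_proj (\<lambda>w. ?u w * poly p w) z"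
  proof (cases "cmod z < 1")
    case True
    have "integrable dA (\<lambda>w. ?u w * poly p w)"
    proof -
      have "integrable dA (\<lambda>w. (\<Sum>n\<le>degree p. coeff p n * (?u w * w ^ n * cnj w ^ 0)))"
        by (intro Bochner_Integration.integrable_sum integrable_mult_right int)
      then show ?thesis by (simp add: poly_altdef sum_distrib_left mult_ac)
    qed
    from kernel_series[OF this True]
    have "(\<lambda>j. shifted k (toeplitz_weight k \<phi>) (coeff p) j * z ^ j)
        sums (LINT w|dA. ?u w * poly p w / (1 - z * cnj w)\<^sup>2)"
      unfolding mom by (simp add: shifted_def toeplitz_weight_def mult_ac if_distrib[of "\<lambda>x. _
          * x"] if_distrib[of "\<lambda>x. x * _"] cong: if_cong del: of_nat_Suc)
    then show ?thesis using True by (simp add: pser_def bergman_proj_def on_disk_def sums_iff)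
  qed (simp add: pser_def bergman_proj_def on_disk_def)
qed

lemma toeplitz_quasihomogeneous:
  assumes "integrable dA (\<lambda>z. \<phi> (cmod z))" "bounded_weight k (toeplitz_weight k \<phi>)"
  shows "toeplitz (quasihomogeneous k \<phi>) = wshift k (toeplitz_weight k \<phi>)"
  by (rule toeplitz_eqI[OF assms(2) bergman_proj_quasihomogeneous[OF assms(1)]])

section \<open>Decay of the Mellin transform of a radial T-function\<close>

text \<open>r^p is the smallest of 1, r, ..., r^p, so (p + 1) r^p is at most their sum, and
  multiplying that sum by 1 - r gives 1 - r^(p + 1).\<close>

lemma power_unit_bound:
  assumes "0 \<le> r" "r \<le> (1::real)"
  shows "real (Suc p) * (r ^ p * (1 - r)) \<le> 1"
proof -
  have "real (Suc p) * r ^ p = (\<Sum>i<Suc p. r ^ p)" by simp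
  also have "\<dots> \<le> (\<Sum>i<Suc p. r ^ i)"
    using assms by (intro sum_mono power_decreasing) auto
  finally have "(1 - r) * (real (Suc p) * r ^ p) \<le> (1 - r) * (\<Sum>i<Suc p. r ^ i)"
    using assms by (intro mult_left_mono) auto
  also have "\<dots> = 1 - r ^ Suc p" by (simp only: one_diff_power_eq)
  also have "\<dots> \<le> 1" using assms by simp
  finally show ?thesis by (simp add: mult_ac)
qed

text \<open>The hypothesis that \<open>\<phi>\<close> is a T-function controls its Mellin transform only at even integers, whereas
  Toeplitz operators of odd degree involve odd integers. The two are compared through
  \<open>r ^ p - r ^ Suc p \<le> 1 / Suc p\<close>.\<close>

lemma mellin_step:
  assumes \<phi>: "radial_L1 \<phi>"
  shows "real (Suc p) * cmod (mellin \<phi> (of_nat (p + 2)) - mellin \<phi> (of_nat (p + 3)))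
      \<le> (LINT r|unit_leb. cmod (of_real r * \<phi> r))"
proof -
  let ?g = "\<lambda>r. complex_of_real r * \<phi> r"
  have g: "integrable unit_leb ?g" using \<phi> by (simp add: radial_L1_def)
  have pw: "(LINT r|unit_leb. ?g r * of_real r powr of_nat n)
      = (LINT r|unit_leb. ?g r * of_real r ^ n)"
     "integrable unit_leb (\<lambda>r. ?g r * of_real r ^ n)" for n
  proof -
    have e: "?g r * of_real r powr of_nat n = ?g r * of_real r ^ n" for r
      by (cases "r = 0") (auto simp: powr_nat')
    show "(LINT r|unit_leb. ?g r * of_real r powr of_nat n)
        = (LINT r|unit_leb. ?g r * of_real r ^ n)"
      by (simp only: e)
    show "integrable unit_leb (\<lambda>r. ?g r * of_real r ^ n)"
      using integrable_unit_mellin[OF g, of "of_nat n"] by (simp only: e) simp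
  qed
  have m: "mellin \<phi> (of_nat (n + 2)) = (LINT r|unit_leb. ?g r * of_real r ^ n)" for n
    using pw(1)[of n] by (simp add: mellin_eq_unit_mellin unit_mellin_def)
  have "mellin \<phi> (of_nat (p + 2)) - mellin \<phi> (of_nat (Suc p + 2))
      = (LINT r|unit_leb. ?g r * of_real r ^ p - ?g r * of_real r ^ Suc p)"
    unfolding m by (rule Bochner_Integration.integral_diff[symmetric]) (rule pw)+
  then have "cmod (mellin \<phi> (of_nat (p + 2)) - mellin \<phi> (of_nat (p + 3)))
      \<le> (LINT r|unit_leb. cmod (?g r * of_real r ^ p - ?g r * of_real r ^ Suc p))"
    using integral_norm_bound[of unit_leb "\<lambda>r. ?g r * of_real r ^ p - ?g r * of_real r ^ Suc p"]
    by (simp add: numeral_3_eq_3)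
  also have "\<dots> \<le> (LINT r|unit_leb. cmod (?g r) / real (Suc p))"
  proof (rule integral_mono)
    show "integrable unit_leb (\<lambda>r. cmod (?g r * of_real r ^ p - ?g r * of_real r ^ Suc p))"
      by (intro integrable_norm Bochner_Integration.integrable_diff pw)
    show "integrable unit_leb (\<lambda>r. cmod (?g r) / real (Suc p))"
      using g by (intro integrable_divide integrable_norm)
    fix r assume "r \<in> space unit_leb"
    then have r: "0 \<le> r" "r \<le> 1" by auto
    have "cmod (?g r * of_real r ^ p - ?g r * of_real r ^ Suc p)
        = cmod (?g r * of_real (r ^ p * (1 - r)))"
      by (simp add: algebra_simps)
    also have "\<dots> = cmod (?g r) * (r ^ p * (1 - r))"
      using r unfolding norm_mult[of "?g r"] norm_of_real by simp
    also have "\<dots> \<le> cmod (?g r) * (1 / real (Suc p))"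
      using power_unit_bound[OF r, of p] by (intro mult_left_mono) (simp_all add: field_simps)
    finally show "cmod (?g r * of_real r ^ p - ?g r * of_real r ^ Suc p)
        \<le> cmod (?g r) / real (Suc p)" by simp
  qed
  also have "\<dots> = (LINT r|unit_leb. cmod (?g r)) / real (Suc p)" by simp
  finally show ?thesis by (simp add: field_simps)
qed

lemma mellin_decay_of_even:
  assumes \<phi>: "radial_L1 \<phi>"
      and even: "\<And>n::nat. real (n + 1) * cmod (mellin \<phi> (of_nat (2 * n + 2))) \<le> K"
  shows "\<exists>K'. \<forall>s\<ge>2. real s * cmod (mellin \<phi> (of_nat s)) \<le> K'"
proof (intro exI allI impI)
  define I where "I = (LINT r|unit_leb. cmod (of_real r * \<phi> r))"
  have K: "K \<ge> 0" using even[of 0] by (intro order_trans[OF _ even[of 0]]) simp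
  have I: "I \<ge> 0" unfolding I_def by simp
  fix s :: nat assume s: "s \<ge> 2"
  \<comment> \<open>For odd s = 2 n + 3 the factor 4 covers both s <= 4 (n + 1) and s <= 4 (2 n +
    1); the second is needed down to n = 0.\<close>
  show "real s * cmod (mellin \<phi> (of_nat s)) \<le> 4 * K + 4 * I"
  proof (cases "even s")
    case True
    define n where "n = s div 2 - 1"
    have sn: "s = 2 * n + 2" using True s by (auto simp: n_def elim!: evenE)
    have "real s * cmod (mellin \<phi> (of_nat s))
        = 2 * (real (n + 1) * cmod (mellin \<phi> (of_nat (2 * n + 2))))"
      unfolding sn by simp
    then show ?thesis using even[of n] K I by linarith
  next
    case False
    define n where "n = s div 2 - 1"
    have sn: "s = 2 * n + 3" using False s by (auto simp: n_def elim!: oddE)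
    let ?a = "mellin \<phi> (of_nat (2 * n + 2))" and ?b = "mellin \<phi> (of_nat (2 * n + 3))"
    have "cmod ?b \<le> cmod ?a + cmod (?a - ?b)" by (metis norm_minus_commute norm_triangle_sub)
    then have "real s * cmod ?b \<le> real s * cmod ?a + real s * cmod (?a - ?b)"
      by (simp only: distrib_left[symmetric]) (intro mult_left_mono, auto)
    also have "real s * cmod ?a \<le> 4 * (real (n + 1) * cmod ?a)"
      unfolding sn by (simp only: mult.assoc[symmetric]) (intro mult_right_mono, auto)
    also have "real s * cmod (?a - ?b) \<le> 4 * (real (Suc (2 * n)) * cmod (?a - ?b))"
      unfolding sn by (simp only: mult.assoc[symmetric]) (intro mult_right_mono, auto)
    also have "4 * (real (n + 1) * cmod ?a) \<le> 4 * K" using even[of n] by simp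
    also have "4 * (real (Suc (2 * n)) * cmod (?a - ?b)) \<le> 4 * I"
      using mellin_step[OF \<phi>, of "2 * n"] unfolding I_def by simp
    finally show ?thesis by (simp add: sn)
  qed
qed

text \<open>A radial factor keeps w^n an eigenvector of the analytic part. The conjugate kernel
  contributes exactly the mean of the function, which the term -1 of the kernel cancels.\<close>

lemma harmonic_proj_radial_power:
  assumes \<phi>: "integrable dA (\<lambda>z. \<phi> (cmod z))"
  shows "harmonic_proj (\<lambda>w. \<phi> (cmod w) * w ^ n)
      = pser (\<lambda>j. if j = n then 2 * of_nat (Suc n) * mellin \<phi> (of_nat (2 * n + 2)) else 0)"
proof
  fix z
  define v where "v = (\<lambda>w. \<phi> (cmod w) * w ^ n)"
  have vq: "v = (\<lambda>w. quasihomogeneous 0 \<phi> w * w ^ n)" by (simp add: v_def quasihomogeneous_def)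
  have [measurable]: "(\<lambda>z. \<phi> (cmod z)) \<in> borel_measurable dA" using \<phi> by auto
  have [measurable]: "(\<lambda>w. cnj w) \<in> borel_measurable dA" "(\<lambda>w. w) \<in> borel_measurable dA"
    by (intro borel_measurable_dAI borel_measurable_continuous_onI continuous_intros)+
  have v: "integrable dA v"
  proof (rule Bochner_Integration.integrable_bound[OF integrable_norm[OF \<phi>]])
    show "v \<in> borel_measurable dA" unfolding v_def by measurable
    show "AE w in dA. norm (v w) \<le> norm (norm (\<phi> (cmod w)))"
      by (intro AE_I2) (auto simp: v_def norm_mult norm_power power_le_one intro!: mult_left_le)
  qed
  have [measurable]: "v \<in> borel_measurable dA" using v by auto
  have cv: "integrable dA (\<lambda>w. cnj (v w))" using v by simp
  have mom1: "(LINT w|dA. v w * cnj w ^ j)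
      = (if n = j then 2 * mellin \<phi> (of_nat (n + j + 2)) else 0)" for j
    using moment_quasihomogeneous[OF \<phi>, of 0 n j] by (simp add: vq)
  have mom2: "(LINT w|dA. v w * w ^ j) = (if n + j = 0 then 2 * mellin \<phi> 2 else 0)" for j
    using moment_quasihomogeneous[OF \<phi>, of 0 "n + j" 0] by (simp add: vq power_add mult.assoc)
  show "harmonic_proj (\<lambda>w. \<phi> (cmod w) * w ^ n) z
      = pser (\<lambda>j. if j = n then 2 * of_nat (Suc n) * mellin \<phi> (of_nat (2 * n + 2)) else 0) z"
  proof (cases "cmod z < 1")
    case z: True
    have lt: "cmod (z * cnj w) < 1" if "cmod w < 1" for w
      using mult_strict_mono'[OF z that] by (simp add: norm_mult)
    have bd: "cmod (v w / (1 - z * cnj w)\<^sup>2) \<le> cmod (v w) / (1 - cmod z)\<^sup>2" if "cmod w < 1" for w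
    proof -
      have "cmod (z * cnj w) \<le> cmod z" using that by (simp add: norm_mult mult_left_le)
      then have "1 - cmod z \<le> cmod (1 - z * cnj w)" using norm_triangle_ineq2[of 1 "z * cnj w"]
          by simp
      then have "(1 - cmod z)\<^sup>2 \<le> (cmod (1 - z * cnj w))\<^sup>2" using z by (intro power_mono) auto
      then show ?thesis using z unfolding norm_divide norm_power
          by (intro divide_left_mono mult_pos_pos) auto
    qed
    have bd': "cmod (v w / (1 - cnj z * w)\<^sup>2) \<le> cmod (v w) / (1 - cmod z)\<^sup>2" if "cmod w < 1" for w
    proof -
      have "cmod (1 - cnj z * w) = cmod (1 - z * cnj w)"
        by (metis complex_cnj_cnj complex_cnj_diff complex_cnj_mult complex_cnj_one complex_mod_cnj)
      then show ?thesis using bd[OF that] by (simp add: norm_divide norm_power)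
    qed
    have ib: "integrable dA (\<lambda>w. cmod (v w) / (1 - cmod z)\<^sup>2)" using v
        by (intro integrable_divide integrable_norm)
    have i1: "integrable dA (\<lambda>w. v w / (1 - z * cnj w)\<^sup>2)"
      by (rule Bochner_Integration.integrable_bound[OF ib])
          (measurable, use bd in \<open>auto intro!: AE_I2\<close>)
    have i2: "integrable dA (\<lambda>w. v w / (1 - cnj z * w)\<^sup>2)"
      by (rule Bochner_Integration.integrable_bound[OF ib])
          (measurable, use bd' in \<open>auto intro!: AE_I2\<close>)
    have 1: "(\<lambda>j. (if j = n then 2 * of_nat (Suc n) * mellin \<phi> (of_nat (2 * n + 2)) else 0) * z ^ j)
        sums (LINT w|dA. v w / (1 - z * cnj w)\<^sup>2)"
    proof -
      have "(\<lambda>j. of_nat (Suc j) * z ^ j * (LINT w|dA. v w * cnj w ^ j))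
          = (\<lambda>j. (if j = n then 2 * of_nat (Suc n) * mellin \<phi> (of_nat (2 * n + 2)) else 0) * z ^ j)"
      proof
        fix j
        show "of_nat (Suc j) * z ^ j * (LINT w|dA. v w * cnj w ^ j)
            = (if j = n then 2 * of_nat (Suc n) * mellin \<phi> (of_nat (2 * n + 2)) else 0) * z ^ j"
        proof (cases "j = n")
          case True
          show ?thesis unfolding mom1 True mult_2[of n] by (simp only: if_True refl mult_ac)
        qed (simp add: mom1)
      qed
      then show ?thesis using kernel_series[OF v z] by (simp only:)
    qed
    \<comment> \<open>Conjugation reduces the second kernel to \<open>kernel_series\<close>; by
      \<open>mom2\<close> only its constant term can survive.\<close>
    have 2: "(LINT w|dA. v w / (1 - cnj z * w)\<^sup>2) = (LINT w|dA. v w)"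
    proof -
      have c: "(LINT w|dA. cnj (v w) * cnj w ^ j) = cnj (if n + j = 0 then 2 * mellin \<phi> 2 else 0)"
          for j
        unfolding mom2[symmetric]
        using Bochner_Integration.integral_cnj[of dA "\<lambda>w. v w * w ^ j"]
            by (simp only: complex_cnj_mult complex_cnj_power)
      have A: "(\<lambda>j. of_nat (Suc j) * z ^ j * cnj (if n + j = 0 then 2 * mellin \<phi> 2 else 0))
          sums (LINT w|dA. cnj (v w) / (1 - z * cnj w)\<^sup>2)"
        using kernel_series[OF cv z] unfolding c .
      have B: "(\<lambda>j. of_nat (Suc j) * z ^ j * cnj (if n + j = 0 then 2 * mellin \<phi> 2 else 0))
          = (\<lambda>j. if j = 0 then cnj (if n = 0 then 2 * mellin \<phi> 2 else 0) else 0)"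
        by (auto simp: fun_eq_iff)
      have C: "(\<lambda>j::nat. if j = 0 then cnj (if n = 0 then 2 * mellin \<phi> 2 else 0) else 0)
          sums cnj (if n = 0 then 2 * mellin \<phi> 2 else 0)"
        using sums_single[of 0 "\<lambda>_. cnj (if n = 0 then 2 * mellin \<phi> 2 else 0)"] by simp
      have "(LINT w|dA. cnj (v w) / (1 - z * cnj w)\<^sup>2) = cnj (if n = 0 then 2 * mellin \<phi> 2 else 0)"
        by (rule sums_unique2[OF A[unfolded B] C])
      moreover have "(LINT w|dA. v w / (1 - cnj z * w)\<^sup>2)
          = cnj (LINT w|dA. cnj (v w) / (1 - z * cnj w)\<^sup>2)"
        using Bochner_Integration.integral_cnj[of dA "\<lambda>w. cnj (v w) / (1 - z * cnj w)\<^sup>2"] by simp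
      ultimately show ?thesis using mom2[of 0] by simp
    qed
    have "harmonic_proj v z = (LINT w|dA. v w / (1 - z * cnj w)\<^sup>2 + v w / (1 - cnj z * w)\<^sup>2 - v w)"
      using z unfolding harmonic_proj_def on_disk_def
      by (simp add: dist_norm) (intro Bochner_Integration.integral_cong, auto simp: algebra_simps)
    also have "\<dots> = (LINT w|dA. v w / (1 - z * cnj w)\<^sup>2) + (LINT w|dA. v w / (1 - cnj z * w)\<^sup>2)
        - (LINT w|dA. v w)"
      using i1 i2 v by simp
    also have "\<dots> = (LINT w|dA. v w / (1 - z * cnj w)\<^sup>2)" by (simp add: 2)
    finally show ?thesis using 1 z by (simp add: v_def pser_def on_disk_def sums_iff)
  qed (simp add: pser_def harmonic_proj_def on_disk_def)
qed

lemma single_wsq: "summable (wsq (\<lambda>j. if j = n then c else 0))"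
    "suminf (wsq (\<lambda>j. if j = n then c else 0)) = (cmod c)\<^sup>2 / (real n + 1)"
proof -
  have "wsq (\<lambda>j. if j = n then c else 0) = (\<lambda>j. if j = n then (cmod c)\<^sup>2 / (real j + 1) else 0)"
    by (auto simp: wsq_def fun_eq_iff)
  then have "wsq (\<lambda>j. if j = n then c else 0) sums ((cmod c)\<^sup>2 / (real n + 1))"
    using sums_single[of n "\<lambda>j. (cmod c)\<^sup>2 / (real j + 1)"] by simp
  then show "summable (wsq (\<lambda>j. if j = n then c else 0))"
      "suminf (wsq (\<lambda>j. if j = n then c else 0)) = (cmod c)\<^sup>2 / (real n + 1)"
    by (auto simp: sums_iff)
qed

lemma pser_single: "pser (\<lambda>j. if j = n then c else 0) = on_disk (\<lambda>z. c * z ^ n)"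
proof
  fix z
  have "(\<lambda>j. (if j = n then c else 0) * z ^ j) = (\<lambda>j. if j = n then c * z ^ j else 0)" by auto
  then have "(\<lambda>j. (if j = n then c else 0) * z ^ j) sums (c * z ^ n)"
      using sums_single[of n "\<lambda>j. c * z ^ j"] by simp
  then show "pser (\<lambda>j. if j = n then c else 0) z = on_disk (\<lambda>z. c * z ^ n) z"
    by (simp add: pser_def on_disk_def sums_iff)
qed

lemma L2_norm_on_disk: "L2_norm (on_disk f) = L2_norm f"
  unfolding L2_norm_def
      by (intro arg_cong[where f = sqrt] Bochner_Integration.integral_cong) (auto simp: on_disk_def)

text \<open>Tested on w^n, the T-function bound says that the eigenvalue 2 (n + 1) F(2 n + 2) is
  bounded; the previous comparison of even and odd arguments does the rest.\<close>

lemma T_function_decay: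
  assumes T: "T_function (\<lambda>z. \<phi> (cmod z))"
  shows "\<exists>K. \<forall>s\<ge>2. real s * cmod (mellin \<phi> (of_nat s)) \<le> K"
proof -
  have int: "integrable dA (\<lambda>z. \<phi> (cmod z))" using T by (simp add: T_function_def)
  obtain K where K: "\<And>h. h \<in> harmonic_polynomials \<Longrightarrow> L2_norm (harmonic_proj (\<lambda>w. \<phi> (cmod w) * h w))
      \<le> K * L2_norm h"
    using T unfolding T_function_def by blast
  show ?thesis
  proof (rule mellin_decay_of_even)
    show "radial_L1 \<phi>" unfolding radial_L1_def by (rule radial_integrable[OF int])
    fix n :: nat
    let ?c = "2 * of_nat (Suc n) * mellin \<phi> (of_nat (2 * n + 2))"
    have "(\<lambda>w. w ^ n) \<in> harmonic_polynomials"
    proof -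
      have "(\<lambda>w::complex. w ^ n) = (\<lambda>z. poly (monom 1 n) z + cnj (poly 0 z))"
          by (simp add: poly_monom)
      then show ?thesis unfolding harmonic_polynomials_def by blast
    qed
    from K[OF this] have le:
        "L2_norm (pser (\<lambda>j. if j = n then ?c else 0)) \<le> K * L2_norm (\<lambda>w. w ^ n)"
      unfolding harmonic_proj_radial_power[OF int] .
    have sq: "L2_norm (pser (\<lambda>j. if j = n then c else 0)) = cmod c / sqrt (real n + 1)" for c
    proof -
      have "(L2_norm (pser (\<lambda>j. if j = n then c else 0)))\<^sup>2 = (cmod c / sqrt (real n + 1))\<^sup>2"
        unfolding pser_bergman(4)[OF single_wsq(1)] single_wsq(2) by (simp add: power_divide)
      then show ?thesis by (rule power2_eq_imp_eq) (auto simp: L2_norm_def)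
    qed
    have "L2_norm (\<lambda>w. w ^ n) = 1 / sqrt (real n + 1)"
      using sq[of 1] unfolding pser_single by (simp add: L2_norm_on_disk)
    with le have "cmod ?c \<le> K" unfolding sq by (simp add: divide_le_cancel)
    moreover have "cmod ?c = 2 * (real (n + 1) * cmod (mellin \<phi> (of_nat (2 * n + 2))))"
      unfolding norm_mult norm_of_nat by simp
    moreover have "0 \<le> real (n + 1) * cmod (mellin \<phi> (of_nat (2 * n + 2)))" by simp
    ultimately show "real (n + 1) * cmod (mellin \<phi> (of_nat (2 * n + 2))) \<le> K" by linarith
  qed
qed

text \<open>For k <= j the Mellin argument s = 2 j - k + 2 is at least j + 1, so the decay in s
  absorbs the factor \<open>Suc j\<close>.\<close>

lemma bounded_toeplitz_weight:
  assumes "\<exists>K. \<forall>s\<ge>2. real s * cmod (mellin \<phi> (of_nat s)) \<le> K"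
  shows "bounded_weight k (toeplitz_weight k \<phi>)"
proof -
  obtain K where K: "\<And>s::nat. s \<ge> 2 \<Longrightarrow> real s * cmod (mellin \<phi> (of_nat s)) \<le> K" using assms by blast
  have "cmod (toeplitz_weight k \<phi> j) \<le> 2 * K" if "k \<le> int j" for j
  proof -
    define s where "s = nat (2 * int j - k + 2)"
    have s: "int s = 2 * int j - k + 2" using that by (simp add: s_def)
    then have "s \<ge> 2" "Suc j \<le> s" using that by linarith+
    have "of_nat s = (of_int (2 * int j - k + 2) :: complex)" by (metis s of_int_of_nat_eq)
    then have "cmod (toeplitz_weight k \<phi> j) = 2 * (real (Suc j) * cmod (mellin \<phi> (of_nat s)))"
      unfolding toeplitz_weight_def norm_mult norm_of_nat by simp
    also have "\<dots> \<le> 2 * (real s * cmod (mellin \<phi> (of_nat s)))"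
      using \<open>Suc j \<le> s\<close> by (intro mult_left_mono mult_right_mono) auto
    also have "\<dots> \<le> 2 * K" using K[OF \<open>s \<ge> 2\<close>] by simp
    finally show ?thesis .
  qed
  then show ?thesis unfolding bounded_weight_def by blast
qed

section \<open>Commutators and ranks of weighted shifts\<close>

text \<open>Each guard asks whether the intermediate monomial between the two shifts has nonnegative
  degree. For shifts in opposite directions the guards can disagree.\<close>

definition shift_comm_weight :: "int \<Rightarrow> (nat \<Rightarrow> complex) \<Rightarrow> int \<Rightarrow> (nat \<Rightarrow> complex) \<Rightarrow> nat \<Rightarrow> complex"
    where
  "shift_comm_weight k1 w1 k2 w2 j = (if k1 \<le> int j then w1 j * w2 (nat (int j - k1)) else 0)
     - (if k2 \<le> int j then w2 j * w1 (nat (int j - k2)) else 0)"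

lemma bounded_shift_comm_weight:
  assumes "bounded_weight k1 w1" "bounded_weight k2 w2"
  shows "bounded_weight (k1 + k2) (shift_comm_weight k1 w1 k2 w2)"
proof -
  obtain K1 K2 where K1: "\<And>j. k1 \<le> int j \<Longrightarrow> cmod (w1 j) \<le> K1"
      and K2: "\<And>j. k2 \<le> int j \<Longrightarrow> cmod (w2 j) \<le> K2"
    using assms unfolding bounded_weight_def by blast
  have pos: "K1 \<ge> 0" "K2 \<ge> 0"
    by (rule order_trans[OF norm_ge_zero K1[of "nat \<bar>k1\<bar>"]], simp)
        (rule order_trans[OF norm_ge_zero K2[of "nat \<bar>k2\<bar>"]], simp)
  have "cmod (shift_comm_weight k1 w1 k2 w2 j) \<le> K1 * K2 + K2 * K1" if j: "k1 + k2 \<le> int j" for j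
  proof -
    have 1: "cmod (if k1 \<le> int j then w1 j * w2 (nat (int j - k1)) else 0) \<le> K1 * K2"
      using pos j by (auto simp: norm_mult intro!: mult_mono K1 K2)
    have 2: "cmod (if k2 \<le> int j then w2 j * w1 (nat (int j - k2)) else 0) \<le> K2 * K1"
      using pos j by (auto simp: norm_mult intro!: mult_mono K1 K2)
    show ?thesis unfolding shift_comm_weight_def
        by (rule order_trans[OF norm_triangle_ineq4 add_mono[OF 1 2]])
  qed
  then show ?thesis unfolding bounded_weight_def by blast
qed

lemma shifted_shifted:
  "shifted k1 w1 (shifted k2 w2 b) j =
    (if k1 + k2 \<le> int j \<and> k1
        \<le> int j then w1 j * w2 (nat (int j - k1)) * b (nat (int j - (k1 + k2))) else 0)"
  by (auto simp: shifted_def algebra_simps)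

lemma commutator_wshift:
  assumes w: "bounded_weight k1 w1" "bounded_weight k2 w2"
  shows "commutator (wshift k1 w1) (wshift k2 w2)
      = wshift (k1 + k2) (shift_comm_weight k1 w1 k2 w2)"
proof
  fix f
  note c = bounded_shift_comm_weight[OF w]
  show "commutator (wshift k1 w1) (wshift k2 w2) f
      = wshift (k1 + k2) (shift_comm_weight k1 w1 k2 w2) f"
  proof (cases "f \<in> bergman_space")
    case f: True
    let ?A = "wshift k1 w1" and ?B = "wshift k2 w2"
    have m: "?A (?B f) \<in> bergman_space" "?B (?A f) \<in> bergman_space"
      using wshift_bergman(1) w f by blast+
    have "?A (?B f) - ?B (?A f) = wshift (k1 + k2) (shift_comm_weight k1 w1 k2 w2) f"
    proof (rule bergman_eqI)
      show "?A (?B f) - ?B (?A f) \<in> bergman_space" by (rule bergman_diff(1)[OF m])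
      show "wshift (k1 + k2) (shift_comm_weight k1 w1 k2 w2) f \<in> bergman_space"
          by (rule wshift_bergman(1)[OF c f])
      have "taylor_coef (?A (?B f)) = shifted k1 w1 (shifted k2 w2 (taylor_coef f))"
        by (simp add: wshift_bergman(2)[OF w(1) wshift_bergman(1)[OF w(2) f]]
            wshift_bergman(2)[OF w(2) f])
      moreover have "taylor_coef (?B (?A f)) = shifted k2 w2 (shifted k1 w1 (taylor_coef f))"
        by (simp add: wshift_bergman(2)[OF w(2) wshift_bergman(1)[OF w(1) f]]
            wshift_bergman(2)[OF w(1) f])
      ultimately show "taylor_coef (?A (?B f) - ?B (?A f))
          = taylor_coef (wshift (k1 + k2) (shift_comm_weight k1 w1 k2 w2) f)"
        unfolding bergman_diff(2)[OF m] wshift_bergman(2)[OF c f]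
        by (auto simp: fun_eq_iff shifted_shifted shifted_def[of "k1
            + k2"] shift_comm_weight_def left_diff_distrib add.commute[of k2 k1])
    qed
    then show ?thesis using f by (simp add: commutator_def)
  qed (simp add: commutator_def wshift_def)
qed

section \<open>Monomials and the range of a weighted shift\<close>

lemma monomial_pser: "monomial (int j) = pser (\<lambda>i. if i = j then 1 else 0)"
  unfolding pser_single by (simp add: monomial_def)

lemma monomial_bergman: "monomial (int j) \<in> bergman_space"
    "taylor_coef (monomial (int j)) = (\<lambda>i. if i = j then 1 else 0)"
  unfolding monomial_pser by (rule pser_bergman[OF single_wsq(1)])+

lemma fscale_monomial: "fscale c (monomial (int j)) = pser (\<lambda>i. if i = j then c else 0)"
  unfolding pser_single by (auto simp: monomial_def fscale_def on_disk_def)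

lemma wshift_eq_single:
  assumes D: "\<And>j. k \<le> int j \<Longrightarrow> j \<noteq> j0 \<Longrightarrow> D j = 0" and j0: "k \<le> int j0" and f: "f \<in> bergman_space"
  shows "wshift k D f = fscale (D j0 * taylor_coef f (nat (int j0 - k))) (monomial (int j0))"
proof -
  have "shifted k D (taylor_coef f)
      = (\<lambda>i. if i = j0 then D j0 * taylor_coef f (nat (int j0 - k)) else 0)"
    using D j0 by (auto simp: shifted_def fun_eq_iff)
  then show ?thesis using f by (simp add: wshift_def fscale_monomial)
qed

lemma wshift_monomial:
  assumes j: "k \<le> int j"
  shows "wshift k D (monomial (int j - k)) = fscale (D j) (monomial (int j))"
proof -
  define n where "n = nat (int j - k)"
  have n: "int j - k = int n" using j by (simp add: n_def)
  have "shifted k D (taylor_coef (monomial (int n))) = (\<lambda>i. if i = j then D j else 0)"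
    unfolding monomial_bergman(2) using j n by (auto simp: shifted_def fun_eq_iff nat_eq_iff)
  then show ?thesis unfolding n fscale_monomial using monomial_bergman(1) by (simp add: wshift_def)
qed

lemma subspace_taylor_coef_zero: "cfun.subspace {f \<in> bergman_space. taylor_coef f j = 0}"
proof (rule cfun.subspaceI)
  have "fscale 0 (monomial 0) = 0" by (auto simp: fscale_def)
  then show "0 \<in> {f \<in> bergman_space. taylor_coef f j = 0}"
    using bergman_scale[OF monomial_bergman(1)[of 0], of 0] by simp
qed (auto simp: bergman_add bergman_scale)

lemma independent_monomials: "\<not> cfun.dependent ((\<lambda>j. monomial (int j)) ` A)"
proof
  assume "cfun.dependent ((\<lambda>j. monomial (int j)) ` A)"
  then obtain j where j: "j \<in> A"
      "monomial (int j) \<in> fspan ((\<lambda>j. monomial (int j)) ` A - {monomial (int j)})"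
    unfolding cfun.dependent_def by auto
  have "(\<lambda>j. monomial (int j)) ` A - {monomial (int j)} \<subseteq> {f \<in> bergman_space. taylor_coef f j = 0}"
    by (auto simp: monomial_bergman)
  then have "fspan ((\<lambda>j. monomial (int j)) ` A - {monomial (int j)}) \<subseteq> {f
      \<in> bergman_space. taylor_coef f j = 0}"
    by (rule cfun.span_minimal[OF _ subspace_taylor_coef_zero])
  then show False using j(2) by (auto simp: monomial_bergman)
qed

lemma inj_monomial: "inj (\<lambda>j::nat. monomial (int j))"
proof (rule injI)
  fix i j :: nat assume "monomial (int i) = monomial (int j)"
  then have "taylor_coef (monomial (int i)) j = taylor_coef (monomial (int j)) j" by simp
  then show "i = j" by (simp add: monomial_bergman split: if_splits)
qed

lemma bergman_finite_support:
  assumes f: "f \<in> bergman_space" and A: "finite A" and z: "\<And>j. j \<notin> A \<Longrightarrow> taylor_coef f j = 0"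
  shows "f \<in> fspan ((\<lambda>j. monomial (int j)) ` A)"
proof -
  have "f = (\<Sum>j\<in>A. fscale (taylor_coef f j) (monomial (int j)))"
  proof
    fix x
    have "f x = pser (taylor_coef f) x" by (simp add: bergman_pser[OF f])
    also have "\<dots> = on_disk (\<lambda>x. \<Sum>j\<in>A. taylor_coef f j * x ^ j) x"
      unfolding pser_def on_disk_def using A z by (auto intro!: suminf_finite)
    also have "\<dots> = (\<Sum>j\<in>A. fscale (taylor_coef f j) (monomial (int j)) x)"
      by (simp add: on_disk_def fscale_def monomial_def)
    also have "\<dots> = (\<Sum>j\<in>A. fscale (taylor_coef f j) (monomial (int j))) x"
      using A by (induction rule: finite_induct) auto
    finally show "f x = (\<Sum>j\<in>A. fscale (taylor_coef f j) (monomial (int j))) x" .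
  qed
  also have "\<dots> \<in> fspan ((\<lambda>j. monomial (int j)) ` A)"
    by (intro cfun.span_sum cfun.span_scale cfun.span_base) auto
  finally show ?thesis .
qed

lemma L2_norm_zero: "L2_norm (f - f) = 0"
  by (simp add: L2_norm_def)

text \<open>Monomials with nonzero weight lie in the range and are independent. Conversely a
  coefficient outside the support vanishes on the range, hence on its closure, since coefficients
  are continuous.\<close>

lemma finite_rank_wshift:
  assumes w: "bounded_weight k D"
  shows "finite_rank (wshift k D) \<longleftrightarrow> finite {j. k \<le> int j \<and> D j \<noteq> 0}" (is "_ \<longleftrightarrow> finite ?A")
proof
  assume "finite_rank (wshift k D)"
  then obtain B where B: "finite B" "bergman_closure (Ran (wshift k D)) \<subseteq> fspan B"
    by (auto simp: finite_rank_def finite_dimensional_def)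
  have "(\<lambda>j. monomial (int j)) ` ?A \<subseteq> bergman_closure (Ran (wshift k D))"
  proof safe
    fix j assume j: "k \<le> int j" "D j \<noteq> 0"
    define n where "n = nat (int j - k)"
    have n: "int j - k = int n" using j by (simp add: n_def)
    let ?g = "fscale (inverse (D j)) (monomial (int n))"
    have g: "?g \<in> bergman_space" by (intro bergman_scale monomial_bergman)
    have "wshift k D ?g = fscale (inverse (D j)) (wshift k D (monomial (int n)))"
      using bounded_operator_wshift[OF w] monomial_bergman(1)[of n]
          by (simp add: bounded_operator_def)
    also have "\<dots> = monomial (int j)"
      using wshift_monomial[OF j(1), of D] j(2) unfolding n
          by (simp add: fscale_def mult.assoc[symmetric])
    finally have "monomial (int j) \<in> Ran (wshift k D)" using g unfolding Ran_def by (metis imageI)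
    then show "monomial (int j) \<in> bergman_closure (Ran (wshift k D))"
      using monomial_bergman(1)[of j] L2_norm_zero unfolding bergman_closure_def by force
  qed
  then have "finite ((\<lambda>j. monomial (int j)) ` ?A)"
    using cfun.independent_span_bound[OF B(1) independent_monomials[of ?A]] B(2) by blast
  then show "finite ?A" by (rule finite_imageD) (use inj_monomial in \<open>auto intro: inj_on_subset\<close>)
next
  assume A: "finite ?A"
  have "f \<in> fspan ((\<lambda>j. monomial (int j)) ` ?A)" if "f \<in> bergman_closure (Ran (wshift k D))" for f
  proof (rule bergman_finite_support[OF _ A])
    show f: "f \<in> bergman_space" using that by (simp add: bergman_closure_def)
    fix j assume j: "j \<notin> ?A"
    have "cmod (taylor_coef f j) \<le> 0 + e" if "e > 0" for e
    proof -
      have "e / sqrt (real j + 1) > 0" using that by simp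
      then obtain g where g: "g \<in> Ran (wshift k D)" "L2_norm (f - g) < e / sqrt (real j + 1)"
        using \<open>f \<in> bergman_closure (Ran (wshift k D))\<close> unfolding bergman_closure_def by blast
      then obtain h where h: "h \<in> bergman_space" "g = wshift k D h" by (auto simp: Ran_def)
      have gm: "g \<in> bergman_space" unfolding h(2) by (rule wshift_bergman(1)[OF w h(1)])
      have "taylor_coef g j = 0" unfolding h(2) wshift_bergman(2)[OF w h(1)] using j
          by (auto simp: shifted_def)
      then have "cmod (taylor_coef f j) = cmod (taylor_coef (f - g) j)"
          by (simp add: bergman_diff(2)[OF f gm])
      also have "\<dots> \<le> sqrt (real j + 1) * L2_norm (f - g)"
          by (intro taylor_coef_norm_bound bergman_diff f gm)
      also have "\<dots> \<le> sqrt (real j + 1) * (e / sqrt (real j + 1))" using g(2)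
          by (intro mult_left_mono) auto
      also have "\<dots> = e" by simp
      finally show ?thesis by simp
    qed
    then have "cmod (taylor_coef f j) \<le> 0" by (rule field_le_epsilon)
    then show "taylor_coef f j = 0" by simp
  qed
  then show "finite_rank (wshift k D)"
    using A unfolding finite_rank_def finite_dimensional_def by blast
qed

lemma op_rank_wshift_zero:
  assumes D: "\<And>j. k \<le> int j \<Longrightarrow> D j = 0"
  shows "op_rank (wshift k D) = 0"
proof -
  have "wshift k D f = 0" if "f \<in> bergman_space" for f
  proof -
    have "shifted k D (taylor_coef f) = (\<lambda>i. if i = 0 then 0 else 0)" using D
        by (auto simp: shifted_def)
    then have "wshift k D f = fscale 0 (monomial (int 0))" using that
        by (simp only: wshift_def fscale_monomial restrict_apply if_True)
    then show ?thesis by (auto simp: fscale_def)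
  qed
  then have "Ran (wshift k D) = {0}" unfolding Ran_def using monomial_bergman(1)[of 0] by auto
  also have "{0} = fspan {}" by simp
  finally have R: "Ran (wshift k D) = fspan {}" .
  have "finite_dimensional (fspan {})" unfolding finite_dimensional_def by blast
  moreover have "fdim (fspan {}) = 0"
      using cfun.dim_span_eq_card_independent[OF cfun.independent_empty] by (simp only: card.empty)
  ultimately show ?thesis unfolding op_rank_def R by (simp add: zero_enat_def)
qed

lemma bergman_integrable:
  assumes "f \<in> bergman_space"
  shows "integrable dA f"
proof (rule Bochner_Integration.integrable_bound)
  show "integrable dA (\<lambda>z. 1 + (cmod (f z))\<^sup>2)"
    using assms finite_measure_dA by (intro Bochner_Integration.integrable_add)
      (auto simp: bergman_space_def square_integrable_def finite_measure.integrable_const)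
  show "f \<in> borel_measurable dA" using assms by (simp add: bergman_space_def square_integrable_def)
  show "AE z in dA. norm (f z) \<le> norm (1 + (cmod (f z))\<^sup>2)"
  proof (intro AE_I2)
    fix z
    have "2 * 1 * cmod (f z) \<le> 1\<^sup>2 + (cmod (f z))\<^sup>2" by (rule sum_squares_bound)
    then show "norm (f z) \<le> norm (1 + (cmod (f z))\<^sup>2)" using norm_ge_zero[of "f z"]
        by (simp del: norm_ge_zero)
  qed
qed

text \<open>\<open>disc_inner\<close> on discs growing to the whole disk, with |f| as integrable
  majorant.\<close>

lemma L2_inner_monomial:
  assumes f: "f \<in> bergman_space"
  shows "L2_inner f (monomial (int n)) = taylor_coef f n / of_nat (Suc n)"
proof -
  have int: "integrable dA f" by (rule bergman_integrable[OF f])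
  have fm: "f \<in> borel_measurable dA" using int by auto
  have cm: "(\<lambda>w. cnj w ^ n) \<in> borel_measurable dA"
    by (intro borel_measurable_dAI borel_measurable_continuous_onI continuous_intros)
  have "(\<lambda>i. LINT w|dA. disc_ind (rho i) w * f w * cnj w ^ n) \<longlonglongrightarrow> (LINT w|dA. f w * cnj w ^ n)"
  proof (rule integral_dominated_convergence[where w = "\<lambda>w. cmod (f w)"])
    show "(\<lambda>w. f w * cnj w ^ n) \<in> borel_measurable dA"
        "\<And>i. (\<lambda>w. disc_ind (rho i) w * f w * cnj w ^ n) \<in> borel_measurable dA"
      by (intro borel_measurable_times disc_ind_measurable fm cm)+
    show "integrable dA (\<lambda>w. cmod (f w))" using int by (rule integrable_norm)
    show "AE w in dA. (\<lambda>i. disc_ind (rho i) w * f w * cnj w ^ n) \<longlonglongrightarrow> f w * cnj w ^ n"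
    proof (intro AE_I2 tendsto_eventually)
      fix w assume "w \<in> space dA"
      then have "cmod w < 1" by simp
      from order_tendstoD(1)[OF rho_lim this]
      show "\<forall>\<^sub>F i in sequentially. disc_ind (rho i) w * f w * cnj w ^ n = f w * cnj w ^ n"
        by eventually_elim simp
    qed
    show "AE w in dA. norm (disc_ind (rho i) w * f w * cnj w ^ n) \<le> cmod (f w)" for i
      by (intro AE_I2) (auto simp: indicator_def norm_mult norm_power power_le_one intro!:
          mult_left_le)
  qed
  moreover have "(\<lambda>i. LINT w|dA. disc_ind (rho i) w * f w * cnj w ^ n)
      \<longlonglongrightarrow> taylor_coef f n * of_real (1 ^ (2 * n + 2) / (real n + 1))"
    unfolding disc_inner[OF bergman_series[OF f] rho_bounds(1,2)]
        by (intro tendsto_intros rho_lim) auto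
  ultimately have "(LINT w|dA. f w * cnj w ^ n)
      = taylor_coef f n * of_real (1 ^ (2 * n + 2) / (real n + 1))"
    by (rule LIMSEQ_unique)
  moreover have "L2_inner f (monomial (int n)) = (LINT w|dA. f w * cnj w ^ n)"
    unfolding L2_inner_def
        by (intro Bochner_Integration.integral_cong) (auto simp: monomial_def on_disk_def)
  ultimately show ?thesis by (simp add: add.commute)
qed

lemma wshift_rank_one:
  assumes D: "\<And>j. k \<le> int j \<Longrightarrow> j \<noteq> j0 \<Longrightarrow> D j = 0" and j0: "k \<le> int j0" "D j0 \<noteq> 0"
  shows "Ran (wshift k D) = fspan {monomial (int j0)}"
    and "\<exists>C'. wshift k D = op_scale C' (rank_one (monomial (int j0)) (monomial (int j0 - k)))"
    and "op_rank (wshift k D) = 1"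
proof -
  define n where "n = nat (int j0 - k)"
  have n: "int j0 - k = int n" using j0 by (simp add: n_def)
  have eq: "wshift k D f = fscale (D j0 * taylor_coef f n) (monomial (int j0))"
      if "f \<in> bergman_space" for f
    using wshift_eq_single[OF D j0(1) that] by (simp add: n_def)
  have "fscale c (monomial (int j0)) \<in> Ran (wshift k D)" for c
  proof -
    have m: "fscale (c / D j0) (monomial (int n)) \<in> bergman_space"
        by (intro bergman_scale monomial_bergman)
    have "wshift k D (fscale (c / D j0) (monomial (int n))) = fscale c (monomial (int j0))"
      unfolding eq[OF m] bergman_scale(2)[OF monomial_bergman(1)] monomial_bergman(2) using j0
          by simp
    then show ?thesis using m unfolding Ran_def by (metis imageI)
  qed
  then show R: "Ran (wshift k D) = fspan {monomial (int j0)}"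
    unfolding cfun.span_singleton by (auto simp: Ran_def eq)
  show "\<exists>C'. wshift k D = op_scale C' (rank_one (monomial (int j0)) (monomial (int j0 - k)))"
  proof (rule exI, rule ext)
    fix f
    \<comment> \<open>The factor \<open>Suc n\<close> undoes the division in
      \<open>L2_inner_monomial\<close>.\<close>
    show "wshift k D f = op_scale (D j0
        * of_nat (Suc n)) (rank_one (monomial (int j0)) (monomial (int j0 - k))) f"
    proof (cases "f \<in> bergman_space")
      case True
      then show ?thesis unfolding n
        by (auto simp: op_scale_def rank_one_def eq L2_inner_monomial fscale_def fun_eq_iff simp
            del: of_nat_Suc)
    qed (simp add: op_scale_def wshift_def)
  qed
  have "monomial (int j0) \<noteq> 0"
  proof
    assume "monomial (int j0) = 0"
    then have "monomial (int j0) (1/2) = 0" by simp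
    then show False by (simp add: monomial_def on_disk_def)
  qed
  then have "\<not> cfun.dependent {monomial (int j0)}" by (simp add: cfun.dependent_single)
  then have "fdim (fspan {monomial (int j0)}) = 1"
    using cfun.dim_span_eq_card_independent[of "{monomial (int j0)}"] by simp
  moreover have "finite_dimensional (fspan {monomial (int j0)})" unfolding finite_dimensional_def
      by blast
  ultimately show "op_rank (wshift k D) = 1" unfolding op_rank_def R by (simp add: one_enat_def)
qed

section \<open>The weights of the commutator\<close>

definition comm_weight :: "int \<Rightarrow> real \<Rightarrow> int \<Rightarrow> (real \<Rightarrow> complex) \<Rightarrow> nat \<Rightarrow> complex" where
  "comm_weight k1 m k2 \<phi>
      = shift_comm_weight k1 (toeplitz_weight k1 (\<lambda>r. of_real (r powr m))) k2 (toeplitz_weight k2 \<phi>)"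

lemma powr_decay:
  assumes "m \<ge> - 1"
  shows "\<exists>K. \<forall>s\<ge>2. real s * cmod (mellin (\<lambda>r. of_real (r powr m)) (of_nat s)) \<le> K"
proof (intro exI allI impI)
  fix s :: nat assume s: "s \<ge> 2"
  then have p: "m + real s > 0" "real s + m > 0" using assms by auto
  have "mellin (\<lambda>r. of_real (r powr m)) (of_nat s) = of_real (1 / (real s + m))"
    using mellin_powr_real[OF p(1)] by simp
  then have "cmod (mellin (\<lambda>r. of_real (r powr m)) (of_nat s)) = 1 / (real s + m)"
    using p by (simp only: norm_of_real) simp
  \<comment> \<open>Since m >= - 1 and s >= 2, the quotient is at most s / (s - 1) <= 2.\<close>
  also have "real s * (1 / (real s + m)) \<le> 2" using p s assms by (simp add: divide_simps)
  finally show "real s * cmod (mellin (\<lambda>r. of_real (r powr m)) (of_nat s)) \<le> 2" by simp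
qed

lemma integrable_powr_disk:
  assumes "m \<ge> - 1"
  shows "integrable dA (\<lambda>z. complex_of_real (cmod z powr m))"
proof -
  have m: "(\<lambda>r. complex_of_real (r powr m)) \<in> borel_measurable borel" by measurable
  show ?thesis
    unfolding integrable_dA_radial_iff[OF m] using radial_L1_powr[of m] assms
        by (simp add: radial_L1_def)
qed

lemma toeplitz_commutator_wshift:
  assumes "m \<ge> - 1" "T_function (\<lambda>z. \<phi> (cmod z))"
  shows "toeplitz_commutator k1 m k2 \<phi> = wshift (k1 + k2) (comm_weight k1 m k2 \<phi>)"
    and "bounded_weight (k1 + k2) (comm_weight k1 m k2 \<phi>)"
proof -
  have w1: "bounded_weight k1 (toeplitz_weight k1 (\<lambda>r. of_real (r powr m)))"
    by (rule bounded_toeplitz_weight[OF powr_decay[OF assms(1)]])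
  have w2: "bounded_weight k2 (toeplitz_weight k2 \<phi>)"
    by (rule bounded_toeplitz_weight[OF T_function_decay[OF assms(2)]])
  have i2: "integrable dA (\<lambda>z. \<phi> (cmod z))" using assms(2) by (simp add: T_function_def)
  show "toeplitz_commutator k1 m k2 \<phi> = wshift (k1 + k2) (comm_weight k1 m k2 \<phi>)"
    unfolding toeplitz_commutator_def comm_weight_def toeplitz_quasihomogeneous[OF i2 w2]
      toeplitz_quasihomogeneous[OF integrable_powr_disk[OF assms(1)] w1]
    by (rule commutator_wshift[OF w1 w2])
  show "bounded_weight (k1 + k2) (comm_weight k1 m k2 \<phi>)"
    unfolding comm_weight_def by (rule bounded_shift_comm_weight[OF w1 w2])
qed

lemma toeplitz_weight_powr:
  assumes "m \<ge> - 1" "k \<le> int j"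
  shows "toeplitz_weight k (\<lambda>r. of_real (r powr m)) j
      = 2 * of_nat (Suc j) / (of_int (2 * int j - k + 2) + of_real m)"
proof -
  have "of_int (2 * int j - k + 2) \<ge> (2 :: real)" using assms(2) by linarith
  then have "m + of_int (2 * int j - k + 2) > 0" using assms(1) by linarith
  from mellin_powr_real[OF this] show ?thesis by (simp add: toeplitz_weight_def)
qed

text \<open>The contribution of the product in which the power symbol acts last, with the common
  factor 4 (j + 1) removed; \<open>rhs_term\<close> is that of the reversed product. Integer
  arguments avoid truncated subtraction.\<close>

definition lhs_term :: "int \<Rightarrow> real \<Rightarrow> int \<Rightarrow> (real \<Rightarrow> complex) \<Rightarrow> int \<Rightarrow> complex" where
  "lhs_term k1 m k2 \<phi> j
      = of_int (j - k1 + 1) * mellin \<phi> (of_int (2 * j - 2 * k1 - k2 + 2)) /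
      (of_int (2 * j - k1 + 2) + of_real m)"

definition rhs_term :: "int \<Rightarrow> real \<Rightarrow> int \<Rightarrow> (real \<Rightarrow> complex) \<Rightarrow> int \<Rightarrow> complex" where
  "rhs_term k1 m k2 \<phi> j
      = of_int (j - k2 + 1) * mellin \<phi> (of_int (2 * j - k2 + 2)) /
      (of_int (2 * j - 2 * k2 - k1 + 2) + of_real m)"

lemma comm_weight_eq:
  assumes m: "m \<ge> - 1" and j: "k1 + k2 \<le> int j"
  shows "comm_weight k1 m k2 \<phi> j = 4 * of_nat (Suc j) *
    ((if k1 \<le> int j then lhs_term k1 m k2 \<phi> (int j) else 0)
        - (if k2 \<le> int j then rhs_term k1 m k2 \<phi> (int j) else 0))"
proof -
  have 1: "toeplitz_weight k1 (\<lambda>r. of_real (r powr m)) j * toeplitz_weight k2 \<phi> (nat (int j - k1))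
      = 4 * of_nat (Suc j) * lhs_term k1 m k2 \<phi> (int j)"
    if "k1 \<le> int j"
  proof -
    have e: "int (nat (int j - k1)) = int j - k1" using that by simp
    have "(of_nat (Suc (nat (int j - k1))) :: complex) = of_int (int j - k1 + 1)"
      using that by (simp add: of_nat_nat)
    moreover have "2 * (int j - k1) - k2 + 2 = 2 * int j - 2 * k1 - k2 + 2" by simp
    ultimately show ?thesis
      unfolding toeplitz_weight_powr[OF m that] toeplitz_weight_def[of k2] lhs_term_def e
          by (simp only: times_divide_eq_left times_divide_eq_right mult_ac) simp
  qed
  have 2: "toeplitz_weight k2 \<phi> j * toeplitz_weight k1 (\<lambda>r. of_real (r powr m)) (nat (int j - k2))
      = 4 * of_nat (Suc j) * rhs_term k1 m k2 \<phi> (int j)"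
    if "k2 \<le> int j"
  proof -
    have e: "int (nat (int j - k2)) = int j - k2" using that by simp
    have "(of_nat (Suc (nat (int j - k2))) :: complex) = of_int (int j - k2 + 1)"
      using that by (simp add: of_nat_nat)
    moreover have "2 * (int j - k2) - k1 + 2 = 2 * int j - 2 * k2 - k1 + 2" by simp
    moreover have "k1 \<le> int (nat (int j - k2))" using j that by simp
    ultimately show ?thesis
      unfolding toeplitz_weight_powr[OF m \<open>k1 \<le> int (nat (int j - k2))\<close>] toeplitz_weight_def[of k2]
          rhs_term_def e by (simp only: times_divide_eq_left times_divide_eq_right mult_ac) simp
  qed
  show ?thesis unfolding comm_weight_def shift_comm_weight_def using 1 2
      by (simp add: right_diff_distrib)
qed

lemma denominators_nonzero:
  fixes m :: real
  assumes "m \<ge> - 1" "k1 + k2 \<le> j" "0 \<le> j"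
  shows "k1 \<le> j \<Longrightarrow> complex_of_int (2 * j - k1 + 2) + of_real m \<noteq> 0"
    "k2 \<le> j \<Longrightarrow> complex_of_int (2 * j - 2 * k2 - k1 + 2) + of_real m \<noteq> 0"
proof -
  show "complex_of_int (2 * j - k1 + 2) + of_real m \<noteq> 0" if "k1 \<le> j"
  proof -
    have "of_int (2 * j - k1 + 2) \<ge> (2 :: real)" using that assms by linarith
    then have "of_int (2 * j - k1 + 2) + m \<noteq> 0" using assms(1) by linarith
    then show ?thesis by (metis of_real_add of_real_eq_0_iff of_real_of_int_eq)
  qed
  show "complex_of_int (2 * j - 2 * k2 - k1 + 2) + of_real m \<noteq> 0" if "k2 \<le> j"
  proof -
    have "of_int (2 * j - 2 * k2 - k1 + 2) \<ge> (2 :: real)" using that assms by linarith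
    then have "of_int (2 * j - 2 * k2 - k1 + 2) + m \<noteq> 0" using assms(1) by linarith
    then show ?thesis by (metis of_real_add of_real_eq_0_iff of_real_of_int_eq)
  qed
qed

text \<open>The weights are indexed by the exponent of the image: \<open>comm_weight k1 m k2 \<phi> j\<close> is the coefficient with
  which the commutator maps the monomial of degree \<open>j - k1 - k2\<close> to that of degree \<open>j\<close>.\<close>

lemma comm_weight_zero_iff:
  assumes m: "m \<ge> - 1" and j: "k1 + k2 \<le> int j" "k1 \<le> int j" "k2 \<le> int j" and k1: "k1 \<noteq> 0"
  shows "comm_weight k1 m k2 \<phi> j = 0 \<longleftrightarrow>
    recur (of_int \<bar>k1\<bar>) m (of_int (sgn k1 * k2)) (mellin \<phi>)
        (of_int (2 * int j + 2 - k2 - 2 * max k1 0))"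
proof -
  define P1 Q1 P2 Q2 X Y where d: "P1 = complex_of_int (int j - k1 + 1)"
      "Q1 = complex_of_int (2 * int j - k1 + 2) + of_real m"
    "P2 = complex_of_int (int j - k2 + 1)"
        "Q2 = complex_of_int (2 * int j - 2 * k2 - k1 + 2) + of_real m"
    "X = complex_of_int (2 * int j - 2 * k1 - k2 + 2)" "Y = complex_of_int (2 * int j - k2 + 2)"
  have nz: "Q1 \<noteq> 0" "Q2 \<noteq> 0" unfolding d using denominators_nonzero[OF m j(1)] j by auto
  have "comm_weight k1 m k2 \<phi> j
      = 4 * of_nat (Suc j) * (P1 * mellin \<phi> X / Q1 - P2 * mellin \<phi> Y / Q2)"
    unfolding comm_weight_eq[OF m j(1)] lhs_term_def rhs_term_def d using j by simp
  then have "comm_weight k1 m k2 \<phi> j = 0 \<longleftrightarrow> P1 * mellin \<phi> X / Q1 = P2 * mellin \<phi> Y / Q2"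
    by (simp del: of_nat_Suc)
  also have "\<dots> \<longleftrightarrow> P1 * Q2 * mellin \<phi> X = P2 * Q1 * mellin \<phi> Y"
    using nz by (simp add: frac_eq_eq mult_ac)
  finally have 1: "comm_weight k1 m k2 \<phi> j = 0 \<longleftrightarrow> P1 * Q2 * mellin \<phi> X = P2 * Q1 * mellin \<phi> Y" .
  \<comment> \<open>The two Mellin arguments differ by 2 |k1|. The sign of \<open>k1\<close> decides
    which of them is the point z of the recurrence and which is z + 2 |k1|.\<close>
  show ?thesis
  proof (cases "k1 > 0")
    case True
    have z: "complex_of_int (2 * int j + 2 - k2 - 2 * max k1 0) = X" using True by (simp add: d)
    have e: "X + of_real (of_int (sgn k1 * k2)) = 2 * P1"
        "X + of_real m + of_real (of_int \<bar>k1\<bar>) - of_real (of_int (sgn k1 * k2)) = Q2"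
      "Y - of_real (of_int (sgn k1 * k2)) = 2 * P2"
      "X + of_real m + of_real (of_int \<bar>k1\<bar>) + of_real (of_int (sgn k1 * k2)) = Q1"
      "X + 2 * of_real (of_int \<bar>k1\<bar>) = Y"
      using True by (simp_all add: d algebra_simps)
    show ?thesis unfolding recur_def z 1 by (simp only: e) (simp add: mult.assoc)
  next
    case False
    then have k: "k1 < 0" using k1 by simp
    have z: "complex_of_int (2 * int j + 2 - k2 - 2 * max k1 0) = Y" using k by (simp add: d)
    have e: "Y + of_real (of_int (sgn k1 * k2)) = 2 * P2"
        "Y + of_real m + of_real (of_int \<bar>k1\<bar>) - of_real (of_int (sgn k1 * k2)) = Q1"
      "X - of_real (of_int (sgn k1 * k2)) = 2 * P1"
      "Y + of_real m + of_real (of_int \<bar>k1\<bar>) + of_real (of_int (sgn k1 * k2)) = Q2"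
      "Y + 2 * of_real (of_int \<bar>k1\<bar>) = X"
      using k by (simp_all add: d algebra_simps)
    show ?thesis unfolding recur_def z 1 by (simp only: e) (auto simp: mult.assoc)
  qed
qed

lemma finite_comm_weight_gquot:
  assumes m: "m \<ge> - 1" and \<phi>: "radial_L1 \<phi>" and k1: "k1 \<noteq> 0"
    and fin: "finite {j. k1 + k2 \<le> int j \<and> comm_weight k1 m k2 \<phi> j \<noteq> 0}"
  obtains C where "\<And>z. Re z > \<bar>real_of_int (sgn k1 * k2)\<bar> + 2 \<Longrightarrow> mellin \<phi> z
      = C * gquot (of_int \<bar>k1\<bar>) m (of_int (sgn k1 * k2)) z"
proof -
  obtain J where J: "\<And>j. k1 + k2 \<le> int j \<Longrightarrow> comm_weight k1 m k2 \<phi> j \<noteq> 0 \<Longrightarrow> j \<le> J"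
    using fin unfolding finite_nat_set_iff_bounded_le by blast
  \<comment> \<open>Large enough to pass every nonzero weight, to satisfy all guards, and to put
    \<open>t\<close> beyond |k2| + 2.\<close>
  define j0 where "j0 = Suc J + nat \<bar>k1\<bar> + nat \<bar>k2\<bar> + nat \<bar>k1\<bar> + nat \<bar>k2\<bar>"
  define t where "t = real_of_int (2 * int j0 + 2 - k2 - 2 * max k1 0)"
  have "\<bar>sgn k1 * k2\<bar> = \<bar>k2\<bar>" using k1 by (simp add: abs_mult abs_sgn_eq)
  have tI: "\<bar>sgn k1 * k2\<bar> + 2 < 2 * int j0 + 2 - k2 - 2 * max k1 0"
    unfolding \<open>\<bar>sgn k1 * k2\<bar> = \<bar>k2\<bar>\<close> j0_def using k1 by simp
  then have "real_of_int (\<bar>sgn k1 * k2\<bar> + 2) < t" unfolding t_def by (simp only: of_int_less_iff)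
  then have t: "t > \<bar>real_of_int (sgn k1 * k2)\<bar> + 2" by simp
  have E: "recur (of_int \<bar>k1\<bar>) m (of_int (sgn k1 * k2)) (mellin \<phi>) (of_real (t + 2 * of_int \<bar>k1\<bar>
      * real i))" for i
  proof -
    \<comment> \<open>A step of |k1| in the degree is a step of 2 |k1| in the Mellin argument, the
      progression that \<open>recur_imp_gquot\<close> expects.\<close>
    define j where "j = j0 + nat \<bar>k1\<bar> * i"
    have "int j \<ge> int j0" "j \<ge> j0" unfolding j_def by auto
    moreover have "k1 + k2 \<le> int j0" "k1 \<le> int j0" "k2 \<le> int j0" "\<not> j0 \<le> J" unfolding j0_def by auto
    ultimately have jj: "k1 + k2 \<le> int j" "k1 \<le> int j" "k2 \<le> int j" "\<not> j \<le> J" by linarith+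
    then have "comm_weight k1 m k2 \<phi> j = 0" using J by blast
    then have "recur (of_int \<bar>k1\<bar>) m (of_int (sgn k1 * k2)) (mellin \<phi>) (of_int (2 * int j + 2 - k2
        - 2 * max k1 0))"
      using comm_weight_zero_iff[OF m jj(1,2,3) k1] by blast
    moreover have "(of_int (2 * int j + 2 - k2 - 2 * max k1 0) :: complex)
        = of_real (t + 2 * of_int \<bar>k1\<bar> * real i)"
      by (simp add: j_def t_def algebra_simps del: of_int_abs)
    ultimately show ?thesis by simp
  qed
  have "real_of_int \<bar>k1\<bar> \<ge> 1" using k1 by linarith
  then have "real_of_int \<bar>k1\<bar> > 0" "m + of_int \<bar>k1\<bar> \<ge> 0" using m by linarith+
  from recur_imp_gquot[OF \<phi> this refl t E] show ?thesis using that by blast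
qed

text \<open>For k1 = 0 both products involve the same Mellin value. After clearing denominators its
  coefficient is k2 m, which is nonzero, so the transform vanishes on a progression and hence
  identically to the right of 2.\<close>

lemma finite_comm_weight_k1_zero:
  assumes m: "m \<ge> - 1" and \<phi>: "radial_L1 \<phi>" and k: "k2 \<noteq> 0" "m \<noteq> 0"
    and fin: "finite {j. 0 + k2 \<le> int j \<and> comm_weight 0 m k2 \<phi> j \<noteq> 0}"
  shows "AE r in unit_leb. \<phi> r = 0"
proof -
  obtain J where J: "\<And>j. 0 + k2 \<le> int j \<Longrightarrow> comm_weight 0 m k2 \<phi> j \<noteq> 0 \<Longrightarrow> j \<le> J"
    using fin unfolding finite_nat_set_iff_bounded_le by blast
  define j0 where "j0 = Suc J + nat \<bar>k2\<bar>"
  define t where "t = real_of_int (2 * int j0 - k2 + 2)"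
  have t: "t > 2" unfolding t_def j0_def by simp
  have zero: "mellin \<phi> (of_real (t + 2 * real i)) = 0" for i
  proof -
    define j where "j = j0 + i"
    have jj: "0 + k2 \<le> int j" "0 \<le> int j" "k2 \<le> int j" "\<not> j \<le> J" unfolding j_def j0_def by auto
    define P1 Q1 P2 Q2 Y where d: "P1 = complex_of_int (int j + 1)"
        "Q1 = complex_of_int (2 * int j + 2) + of_real m"
      "P2 = complex_of_int (int j - k2 + 1)"
          "Q2 = complex_of_int (2 * int j - 2 * k2 + 2) + of_real m"
      "Y = complex_of_int (2 * int j - k2 + 2)"
    have nz: "Q1 \<noteq> 0" "Q2 \<noteq> 0" unfolding d using denominators_nonzero[OF m jj(1,2)] jj by auto
    have "0 = comm_weight 0 m k2 \<phi> j" using J jj by metis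
    also have "\<dots> = 4 * of_nat (Suc j) * (P1 * mellin \<phi> Y / Q1 - P2 * mellin \<phi> Y / Q2)"
      unfolding comm_weight_eq[OF m jj(1)] lhs_term_def rhs_term_def d using jj by simp
    finally have "P1 * mellin \<phi> Y / Q1 = P2 * mellin \<phi> Y / Q2"
      by (simp del: of_nat_Suc)
    then have "(P1 * Q2 - P2 * Q1) * mellin \<phi> Y = 0" using nz
        by (simp add: frac_eq_eq algebra_simps)
    moreover have "P1 * Q2 - P2 * Q1 = of_int k2 * of_real m" by (simp add: d algebra_simps)
    ultimately have "mellin \<phi> Y = 0" using k by simp
    moreover have "Y = of_real (t + 2 * real i)" by (simp add: d t_def j_def)
    ultimately show ?thesis by simp
  qed
  obtain M where M: "\<And>z. Re z \<ge> 2 \<Longrightarrow> cmod (mellin \<phi> z) \<le> M" using mellin_bounded[OF \<phi>] by blast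
  have all: "mellin \<phi> z = 0" if "Re z > 2" for z
    by (rule half_plane_uniqueness[where p = 2 and t = t and M = M and L = 0 and H
        = "mellin \<phi>" and \<sigma> = 2])
      (use mellin_holomorphic[OF \<phi>] M t zero that in auto)
  show ?thesis by (rule mellin_moments_zero[OF \<phi>, of 3]) (rule all, simp)
qed

section \<open>The classification\<close>

lemma recur_cong:
  assumes "F z = G z" "F (z + 2 * of_real a) = G (z + 2 * of_real a)"
  shows "recur a m s F z \<longleftrightarrow> recur a m s G z"
  unfolding recur_def by (simp only: assms)

lemma recur_cong_Re:
  assumes "\<And>z. Re z \<ge> 2 \<Longrightarrow> F z = G z" "Re z \<ge> 2" "a \<ge> 0"
  shows "recur a m s F z \<longleftrightarrow> recur a m s G z"
  by (rule recur_cong) (use assms in auto)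

text \<open>For equal signs both guards hold automatically, so every weight is governed by the
  recurrence, at points no smaller than 2 + |k2|.\<close>

lemma comm_weight_zero_same_sign:
  assumes m: "m \<ge> - 1" and k: "k1 * k2 > 0"
    and E: "\<And>x. real_of_int x \<ge> 2 + of_int \<bar>k2\<bar>
        \<Longrightarrow> recur (of_int \<bar>k1\<bar>) m (of_int \<bar>k2\<bar>) (mellin \<phi>) (of_int x)"
    and j: "k1 + k2 \<le> int j"
  shows "comm_weight k1 m k2 \<phi> j = 0"
proof -
  have s: "k1 > 0 \<and> k2 > 0 \<or> k1 < 0 \<and> k2 < 0" using k by (simp add: zero_less_mult_iff)
  then have "k1 \<le> int j" "k2 \<le> int j" "k1 \<noteq> 0" "sgn k1 * k2 = \<bar>k2\<bar>" using j by auto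
  moreover have "2 * int j + 2 - k2 - 2 * max k1 0 \<ge> 2 + \<bar>k2\<bar>" using s j by auto
  then have "real_of_int (2 * int j + 2 - k2 - 2 * max k1 0) \<ge> real_of_int (2 + \<bar>k2\<bar>)"
      by (simp only: of_int_le_iff)
  then have "recur (of_int \<bar>k1\<bar>) m (of_int \<bar>k2\<bar>) (mellin \<phi>) (of_int (2 * int j + 2 - k2 - 2
      * max k1 0))"
    by (intro E) simp
  ultimately show ?thesis using comm_weight_zero_iff[OF m j] by simp
qed

text \<open>For opposite signs exactly one guard fails for max(0, k1 + k2) <= j < max(k1, k2), that
  is for min(|k1|, |k2|) degrees. Since this minimum is 1, only \<open>j0\<close> is exceptional,
  and there a single term survives with nothing to cancel it.\<close>

lemma comm_weight_opposite_sign: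
  assumes m: "m \<ge> - 1" and k: "k1 * k2 < 0" "\<bar>k1\<bar> = 1 \<or> \<bar>k2\<bar> = 1" and C: "C \<noteq> 0"
    and F: "\<And>x. x \<ge> \<bar>k2\<bar> + 1 \<Longrightarrow> mellin \<phi> (of_int x)
        = C * gquot (of_int \<bar>k1\<bar>) m (- of_int \<bar>k2\<bar>) (of_int x)"
    and j0: "j0 = nat (max k1 k2 - 1)"
  shows "k1 + k2 \<le> int j0" "int j0 = max k1 k2 - 1"
    "\<And>j. k1 + k2 \<le> int j \<Longrightarrow> j \<noteq> j0 \<Longrightarrow> comm_weight k1 m k2 \<phi> j = 0"
    "comm_weight k1 m k2 \<phi> j0 \<noteq> 0"
proof -
  define a b where "a = real_of_int \<bar>k1\<bar>" and "b = real_of_int \<bar>k2\<bar>"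
  have s: "k1 > 0 \<and> k2 < 0 \<or> k1 < 0 \<and> k2 > 0" using k by (simp add: mult_less_0_iff)
  then have ab: "a \<ge> 1" "b \<ge> 1" unfolding a_def b_def by linarith+
  have k1: "k1 \<noteq> 0" and sg: "sgn k1 * k2 = - \<bar>k2\<bar>" using s by auto
  show ij0: "int j0 = max k1 k2 - 1" and kj0: "k1 + k2 \<le> int j0" using s j0 by auto
  have E: "recur a m (- b) (mellin \<phi>) (of_int x)" if x: "x \<ge> 2 + \<bar>k2\<bar>" for x
  proof -
    have xr: "real_of_int x \<ge> 2 + b" using x unfolding b_def by linarith
    have "recur a m (- b) (\<lambda>z. C * gquot a m (- b) z) (of_int x)"
      by (rule recur_gquot) (use xr ab m in auto)
    moreover have "of_int x + 2 * of_real a = (of_int (x + 2 * \<bar>k1\<bar>) :: complex)"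
        by (simp add: a_def del: of_int_abs)
    then have "mellin \<phi> (of_int x + 2 * of_real a) = C * gquot a m (- b) (of_int x + 2 * of_real a)"
      using F[of "x + 2 * \<bar>k1\<bar>"] x unfolding a_def b_def by simp
    moreover have "mellin \<phi> (of_int x) = C * gquot a m (- b) (of_int x)"
      using F[of x] x unfolding a_def b_def by simp
    ultimately show ?thesis using recur_cong[of "mellin \<phi>" "of_int x" "\<lambda>z. C * gquot a m (- b) z"]
        by simp
  qed
  show "comm_weight k1 m k2 \<phi> j = 0" if j: "k1 + k2 \<le> int j" "j \<noteq> j0" for j
  proof -
    have le: "k1 \<le> int j" "k2 \<le> int j" using s k(2) j ij0 by auto
    have "2 * int j + 2 - k2 - 2 * max k1 0 \<ge> 2 + \<bar>k2\<bar>" using s le by auto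
    then have "recur a m (- b) (mellin \<phi>) (of_int (2 * int j + 2 - k2 - 2 * max k1 0))" by (rule E)
    then show ?thesis using comm_weight_zero_iff[OF m j(1) le k1] unfolding sg
        by (simp add: a_def b_def)
  qed
  \<comment> \<open>The surviving term at \<open>j0\<close> evaluates the transform at |k2| + 2
    |k1|, where all four Gamma arguments have positive real part.\<close>
  have "mellin \<phi> (of_int (\<bar>k2\<bar> + 2 * \<bar>k1\<bar>)) = C * gquot a m (- b) (of_int (\<bar>k2\<bar> + 2 * \<bar>k1\<bar>))"
    unfolding a_def b_def by (rule F) (use k1 in simp)
  moreover have "gquot a m (- b) (of_int (\<bar>k2\<bar> + 2 * \<bar>k1\<bar>)) \<noteq> 0"
    by (rule gquot_nonzero) (use ab m in \<open>auto simp: a_def b_def\<close>)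
  ultimately have Fn: "mellin \<phi> (of_int (\<bar>k2\<bar> + 2 * \<bar>k1\<bar>)) \<noteq> 0" using C by simp
  show "comm_weight k1 m k2 \<phi> j0 \<noteq> 0"
  proof (cases "k1 > 0")
    case True
    then have k: "k1 > 0" "k2 < 0" using s by auto
    have i: "\<not> k1 \<le> int j0" "k2 \<le> int j0" using k ij0 by auto
    have y: "2 * int j0 - k2 + 2 = \<bar>k2\<bar> + 2 * \<bar>k1\<bar>" "int j0 - k2 + 1 = k1 - k2" using k ij0 by auto
    have "complex_of_int (k1 - k2) \<noteq> 0" using k by (simp only: of_int_eq_0_iff)
    then show ?thesis
      unfolding comm_weight_eq[OF m kj0] rhs_term_def y
          using i Fn denominators_nonzero(2)[OF m kj0 _ i(2)] by (simp del: of_nat_Suc)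
  next
    case False
    then have k: "k1 < 0" "k2 > 0" using s by auto
    have i: "\<not> k2 \<le> int j0" "k1 \<le> int j0" using k ij0 by auto
    have y: "2 * int j0 - 2 * k1 - k2 + 2 = \<bar>k2\<bar> + 2 * \<bar>k1\<bar>" "int j0 - k1 + 1 = k2 - k1" using k ij0
        by auto
    have "complex_of_int (k2 - k1) \<noteq> 0" using k by (simp only: of_int_eq_0_iff)
    then show ?thesis
      unfolding comm_weight_eq[OF m kj0] lhs_term_def y
          using i Fn denominators_nonzero(1)[OF m kj0 _ i(2)] by (simp del: of_nat_Suc)
  qed
qed

lemma pochhammer_prods:
  fixes u v :: complex
  shows "pochhammer (u + 1) n = (\<Prod>j=1..n. u + of_nat j)"
      "pochhammer v (Suc n) = (\<Prod>j=0..n. v + of_nat j)"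
proof -
  show "pochhammer (u + 1) n = (\<Prod>j=1..n. u + of_nat j)"
    by (induction n) (auto simp: pochhammer_Suc algebra_simps)
  show "pochhammer v (Suc n) = (\<Prod>j=0..n. v + of_nat j)"
    by (simp only: pochhammer_prod atLeastLessThanSuc_atLeastAtMost)
qed

lemma AE_unit_nonzero: "AE r in unit_leb. r \<noteq> 0"
proof -
  have "AE r in lborel. r \<noteq> (0::real)" by (rule AE_lborel_singleton)
  then have "AE r in lebesgue. r \<noteq> (0::real)" by (rule AE_completion)
  then show ?thesis by (subst AE_restrict_space_iff) auto
qed

lemma mellin_of_AE_powr:
  assumes \<phi>: "radial_L1 \<phi>" and ae: "AE r in unit_leb. \<phi> r = C * of_real (r powr b)" and b: "b \<ge> 0"
      and x: "x > 0"
  shows "mellin \<phi> (of_real x) = C / of_real (x + b)"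
proof -
  have L: "radial_L1 (\<lambda>r. of_real (r powr b))" by (rule radial_L1_powr) (use b in simp)
  have "integrable unit_leb (\<lambda>r. C * (of_real r * of_real (r powr b)))"
    using L unfolding radial_L1_def by (rule integrable_mult_right)
  then have L': "radial_L1 (\<lambda>r. C * of_real (r powr b))" by (simp add: radial_L1_def mult_ac)
  have "mellin \<phi> (of_real x) = mellin (\<lambda>r. C * of_real (r powr b)) (of_real x)"
    by (rule mellin_cong_AE[OF \<phi> L' ae])
  also have "\<dots> = C * mellin (\<lambda>r. of_real (r powr b)) (of_real x)"
    unfolding mellin_def mult.assoc by (rule integral_mult_right_zero)
  also have "\<dots> = C / of_real (x + b)" using mellin_powr_real[of b x] b x by simp
  finally show ?thesis .
qed

lemma of_real_powr_powi:
  assumes "r \<ge> 0" "b > 0" shows "complex_of_real (r powr (of_int b)) = of_real r powi b"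
proof -
  obtain n where n: "b = int n" "n > 0" using assms(2) by (metis zero_less_imp_eq_int)
  show ?thesis using assms(1) n by (cases "r = 0") (auto simp: powr_realpow power_0_left)
qed

lemma AE_unit_nonneg: "AE r in unit_leb. r \<ge> 0"
  by (rule AE_I2) auto

text \<open>The setting in which weights are matched with conditions. The T-function bound enters
  the theorem separately, through \<open>toeplitz_commutator_wshift\<close>.\<close>

locale toeplitz_pair =
  fixes k1 k2 :: int and m :: real and \<phi> :: "real \<Rightarrow> complex"
  assumes m: "m \<ge> - 1" and L: "radial_L1 \<phi>" and nz: "\<not> (AE r in unit_leb. \<phi> r = 0)"
begin

abbreviation D where "D \<equiv> comm_weight k1 m k2 \<phi>"
abbreviation supp where "supp \<equiv> {j. k1 + k2 \<le> int j \<and> D j \<noteq> 0}"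

lemma exponent_bounds: "k1 \<noteq> 0 \<Longrightarrow> real_of_int \<bar>k1\<bar> > 0" "k1 \<noteq> 0 \<Longrightarrow> m + real_of_int \<bar>k1\<bar> \<ge> 0"
proof -
  assume "k1 \<noteq> 0"
  then have "real_of_int \<bar>k1\<bar> \<ge> 1" by linarith
  then show "real_of_int \<bar>k1\<bar> > 0" "m + real_of_int \<bar>k1\<bar> \<ge> 0" using m by linarith+
qed

lemma C_nonzero:
  assumes "\<And>n::nat. real n > \<sigma> \<Longrightarrow> mellin \<phi> (of_nat n) = C * G n" shows "C \<noteq> 0"
proof
  assume "C = 0"
  have "AE r in unit_leb. \<phi> r = 0"
  proof (rule mellin_moments_zero[OF L, of "nat \<lceil>\<sigma>\<rceil> + 1"])
    fix n :: nat assume "n \<ge> nat \<lceil>\<sigma>\<rceil> + 1"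
    then have "real n > \<sigma>" by linarith
    then show "mellin \<phi> (of_nat n) = 0" using assms[of n] \<open>C = 0\<close> by simp
  qed
  then show False using nz by simp
qed

text \<open>With s = sgn(k1) k2 and a = |k1|, the numerator Gammas have their rightmost poles at z =
  - s and z = s - m - a. If both lie left of Re z = 2, the quotient formula holds there as it
  stands, giving (4) and (7); otherwise cancellation forces (5) or (6).\<close>

lemma finite_supp_imp:
  assumes fin: "finite supp"
  shows "cond1 k1 m k2 \<phi> \<or> cond2 k1 m k2 \<phi> \<or> cond3 k1 m k2 \<phi> \<or> cond4 k1 m k2 \<phi> \<or>
            cond5 k1 m k2 \<phi> \<or> cond6 k1 m k2 \<phi> \<or> cond7 k1 m k2 \<phi>"
proof (cases "k1 = 0")
  case True
  have "k2 = 0 \<or> m = 0"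
  proof (rule ccontr)
    assume "\<not> (k2 = 0 \<or> m = 0)"
    then have "AE r in unit_leb. \<phi> r = 0"
      using finite_comm_weight_k1_zero[OF m L, of k2] fin True by simp
    then show False using nz by simp
  qed
  then show ?thesis using True by (auto simp: cond1_def cond3_def)
next
  case k1: False
  obtain C where F: "\<And>z. Re z > \<bar>real_of_int (sgn k1 * k2)\<bar> + 2 \<Longrightarrow> mellin \<phi> z
      = C * gquot (of_int \<bar>k1\<bar>) m (of_int (sgn k1 * k2)) z"
    using finite_comm_weight_gquot[OF m L k1 fin] by blast
  have C: "C \<noteq> 0" by (rule C_nonzero[OF F]) simp
  consider "k2 = 0" | "k1 * k2 > 0" | "k1 * k2 < 0" using k1 by (metis linorder_neqE mult_eq_0_iff)
  then show ?thesis
  proof cases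
    case 1
    \<comment> \<open>For s = 0 the quotient collapses to 2 |k1| / z, a multiple of the transform of
      a constant.\<close>
    have "AE r in unit_leb. \<phi> r = (C * 2 * of_real (of_int \<bar>k1\<bar>)) * of_real (r powr (- 0))"
      by (rule mellin_gquot_simple[OF L exponent_bounds[OF k1], of 0]) (use F 1 in auto)
    then have "AE r in unit_leb. \<phi> r = C * 2 * of_real (of_int \<bar>k1\<bar>)"
      using AE_unit_nonzero AE_unit_nonneg by eventually_elim simp
    then show ?thesis using 1 by (auto simp: cond2_def)
  next
    case 2
    then have "k1 > 0 \<and> k2 > 0 \<or> k1 < 0 \<and> k2 < 0" by (simp add: zero_less_mult_iff)
    then have s: "sgn k1 * k2 = \<bar>k2\<bar>" and k2: "k2 \<noteq> 0" by auto
    note F = F[unfolded s]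
    have b: "real_of_int \<bar>k2\<bar> \<ge> 1" using k2 by linarith
    show ?thesis
    proof (cases "real_of_int \<bar>k2\<bar> < m + of_int \<bar>k1\<bar> + 2")
      case True
      have "mellin \<phi> z = C * gquot (of_int \<bar>k1\<bar>) m (of_int \<bar>k2\<bar>) z" if "Re z \<ge> 2" for z
        by (rule mellin_gquot_extend[OF L exponent_bounds[OF k1] F that]) (use b True that in auto)
      then have "cond4 k1 m k2 \<phi>" unfolding cond4_def using True 2
        by (intro conjI exI[of _ C]) (auto simp: gquot_Gamma simp del: of_int_abs)
      then show ?thesis by blast
    next
      case False
      then have le: "real_of_int \<bar>k2\<bar> \<ge> m + of_int \<bar>k1\<bar> + 2" by simp
      obtain n :: nat where n: "m = (2 * of_nat n + 1) * of_int \<bar>k1\<bar>"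
        and P: "\<And>z. Re z \<ge> 2 \<Longrightarrow> mellin \<phi> z
            = C * pochhammer ((z - of_real (of_int \<bar>k2\<bar>)) / (2 * of_real (of_int \<bar>k1\<bar>)) + 1) n /
           pochhammer ((z + of_real (of_int \<bar>k2\<bar>)) / (2 * of_real (of_int \<bar>k1\<bar>))) (Suc n)"
        using mellin_gquot_pos[OF L exponent_bounds[OF k1] le C F] by blast
      have "cond5 k1 m k2 \<phi>" unfolding cond5_def using 2 le n P[unfolded pochhammer_prods]
        by (intro conjI exI[of _ n] exI[of _ C]) (auto simp del: of_int_abs)
      then show ?thesis by blast
    qed
  next
    case 3
    then have "k1 > 0 \<and> k2 < 0 \<or> k1 < 0 \<and> k2 > 0" by (simp add: mult_less_0_iff)
    then have s: "sgn k1 * k2 = - \<bar>k2\<bar>" and k2: "k2 \<noteq> 0" by auto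
    have s': "real_of_int (- \<bar>k2\<bar>) = - real_of_int \<bar>k2\<bar>" by simp
    note F = F[unfolded s s']
    show ?thesis
    proof (cases "\<bar>k2\<bar> = 1")
      case True
      have "mellin \<phi> z = C * gquot (of_int \<bar>k1\<bar>) m (- of_int \<bar>k2\<bar>) z" if "Re z \<ge> 2" for z
        by (rule mellin_gquot_extend[OF L exponent_bounds[OF k1] F that])
            (use True that exponent_bounds[OF k1] in auto)
      then have "cond7 k1 m k2 \<phi>" unfolding cond7_def using True 3
        by (intro conjI exI[of _ C]) (auto simp: gquot_Gamma simp del: of_int_abs)
      then show ?thesis by blast
    next
      case False
      then have "\<bar>k2\<bar> \<ge> 2" using k2 by linarith
      then have b: "real_of_int \<bar>k2\<bar> \<ge> 2" by linarith
      have m0: "m + of_int \<bar>k1\<bar> = 0" by (rule mellin_gquot_neg[OF L exponent_bounds[OF k1] b C F])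
      have "AE r in unit_leb. \<phi> r
          = (C * 2 * of_real (of_int \<bar>k1\<bar>)) * of_real (r powr (- (- of_int \<bar>k2\<bar>)))"
        by (rule mellin_gquot_simple[OF L exponent_bounds[OF k1] _ _ F]) (use m0 in auto)
      then have "AE r in unit_leb. \<phi> r = (C * 2 * of_real (of_int \<bar>k1\<bar>)) * of_real r powi \<bar>k2\<bar>"
        using AE_unit_nonneg
        by eventually_elim (use of_real_powr_powi[of _ "\<bar>k2\<bar>"] k2 in simp)
      then have "cond6 k1 m k2 \<phi>" unfolding cond6_def using m0 3 \<open>\<bar>k2\<bar> \<ge> 2\<close> by blast
      then show ?thesis by blast
    qed
  qed
qed

text \<open>In (1) and (2) one of the operators is a multiple of the identity, and in (3) both are
  diagonal on monomials; here this is read off the weights.\<close>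

lemma cond123_weight_zero:
  assumes "cond1 k1 m k2 \<phi> \<or> cond2 k1 m k2 \<phi> \<or> cond3 k1 m k2 \<phi>" and j: "k1 + k2 \<le> int j"
  shows "D j = 0"
  using assms(1)
proof (elim disjE)
  assume "cond3 k1 m k2 \<phi>"
  then have "k1 = 0" "k2 = 0" by (auto simp: cond3_def)
  then show ?thesis unfolding comm_weight_eq[OF m j] by (simp add: lhs_term_def rhs_term_def)
next
  assume "cond1 k1 m k2 \<phi>"
  then have k: "k1 = 0" "m = 0" by (auto simp: cond1_def)
  have "k2 \<le> int j" using j k by simp
  have "complex_of_int (int j + 1) \<noteq> 0" "complex_of_int (int j - k2 + 1) \<noteq> 0"
    unfolding of_int_eq_0_iff using \<open>k2 \<le> int j\<close> by simp_all
  moreover have e: "complex_of_int (2 * int j - 0 + 2) = 2 * of_int (int j + 1)"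
     "complex_of_int (2 * int j - 2 * k2 - 0 + 2) = 2 * of_int (int j - k2 + 1)" by simp_all
  ultimately have "lhs_term 0 0 k2 \<phi> (int j) = mellin \<phi> (of_int (2 * int j - k2 + 2)) / 2"
    "rhs_term 0 0 k2 \<phi> (int j) = mellin \<phi> (of_int (2 * int j - k2 + 2)) / 2"
    unfolding lhs_term_def rhs_term_def e by (simp_all del: of_int_add of_int_diff)
  then have "lhs_term 0 0 k2 \<phi> (int j) = rhs_term 0 0 k2 \<phi> (int j)" by (simp only:)
  then show ?thesis unfolding comm_weight_eq[OF m j] using k \<open>k2 \<le> int j\<close> by simp
next
  assume "cond2 k1 m k2 \<phi>"
  then obtain C where k: "k2 = 0" and ae: "AE r in unit_leb. \<phi> r = C" by (auto simp: cond2_def)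
  have ae': "AE r in unit_leb. \<phi> r = C * of_real (r powr 0)"
    using ae AE_unit_nonzero by eventually_elim simp
  have F: "mellin \<phi> (of_int x) = C / of_int x" if "x > 0" for x
    using mellin_of_AE_powr[OF L ae', of "of_int x"] that by simp
  have kj: "k1 \<le> int j" using j k by simp
  have e: "2 * int j - 2 * k1 - 0 + 2 = 2 * (int j - k1 + 1)" "2 * int j - 0 + 2 = 2 * (int j + 1)"
      by simp_all
  have "complex_of_int (int j - k1 + 1) \<noteq> 0" "complex_of_int (int j + 1) \<noteq> 0"
    unfolding of_int_eq_0_iff using kj by simp_all
  moreover have "mellin \<phi> (of_int (2 * (int j - k1 + 1))) = C / of_int (2 * (int j - k1 + 1))"
     "mellin \<phi> (of_int (2 * (int j + 1))) = C / of_int (2 * (int j + 1))"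
    by (rule F, use kj in simp)+
  ultimately have "lhs_term k1 m 0 \<phi> (int j) = C / 2 / (of_int (2 * int j - k1 + 2) + of_real m)"
    "rhs_term k1 m 0 \<phi> (int j) = C / 2 / (of_int (2 * int j - k1 + 2) + of_real m)"
    unfolding lhs_term_def rhs_term_def e
    by (simp_all only: of_int_mult) (simp_all del: of_int_add of_int_diff)
  then show ?thesis unfolding comm_weight_eq[OF m j] using k kj by simp
qed

lemma cond4_weight_zero:
  assumes "cond4 k1 m k2 \<phi>" and j: "k1 + k2 \<le> int j"
  shows "D j = 0"
proof -
  obtain C where k: "k1 * k2 > 0"
      and F: "\<And>z. Re z \<ge> 2 \<Longrightarrow> mellin \<phi> z = C * gquot (of_int \<bar>k1\<bar>) m (of_int \<bar>k2\<bar>) z"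
    using assms(1) unfolding cond4_def gquot_Gamma by (auto simp del: of_int_abs)
  have "k1 \<noteq> 0" "k2 \<noteq> 0" using k by auto
  note a = exponent_bounds[OF \<open>k1 \<noteq> 0\<close>]
  show ?thesis
  proof (rule comm_weight_zero_same_sign[OF m k _ j])
    fix x assume x: "2 + of_int \<bar>k2\<bar> \<le> real_of_int x"
    have "recur (of_int \<bar>k1\<bar>) m (of_int \<bar>k2\<bar>) (\<lambda>z. C
        * gquot (of_int \<bar>k1\<bar>) m (of_int \<bar>k2\<bar>) z) (of_int x)"
      by (rule recur_gquot) (use a x in auto)
    then show "recur (of_int \<bar>k1\<bar>) m (of_int \<bar>k2\<bar>) (mellin \<phi>) (of_int x)"
      by (subst recur_cong_Re[OF F]) (use x in auto)
  qed
qed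

lemma cond5_weight_zero:
  assumes "cond5 k1 m k2 \<phi>" and j: "k1 + k2 \<le> int j"
  shows "D j = 0"
proof -
  obtain C n where k: "k1 * k2 > 0" and n: "m = (2 * of_nat n + 1) * of_int \<bar>k1\<bar>"
    and F: "\<And>z. Re z \<ge> 2 \<Longrightarrow> mellin \<phi> z
        = C * (\<Prod>j=1..n. (z - of_int \<bar>k2\<bar>) / (2 * of_int \<bar>k1\<bar>) + of_nat j) /
          (\<Prod>j=0..n. (z + of_int \<bar>k2\<bar>) / (2 * of_int \<bar>k1\<bar>) + of_nat j)"
    using assms(1) unfolding cond5_def by blast
  have "k1 \<noteq> 0" "k2 \<noteq> 0" using k by auto
  note a = exponent_bounds[OF \<open>k1 \<noteq> 0\<close>]
  define G where "G = (\<lambda>z. C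
      * pochhammer ((z - of_real (of_int \<bar>k2\<bar>)) / (2 * of_real (of_int \<bar>k1\<bar>)) + 1) n /
           pochhammer ((z + of_real (of_int \<bar>k2\<bar>)) / (2 * of_real (of_int \<bar>k1\<bar>))) (Suc n))"
  have FG: "mellin \<phi> z = G z" if "Re z \<ge> 2" for z
    using F[OF that] unfolding G_def pochhammer_prods by (simp del: of_int_abs)
  show ?thesis
  proof (rule comm_weight_zero_same_sign[OF m k _ j])
    fix x assume x: "2 + of_int \<bar>k2\<bar> \<le> real_of_int x"
    have "recur (of_int \<bar>k1\<bar>) m (of_int \<bar>k2\<bar>) G (of_int x)"
      by (rule recur_pochhammer[OF a(1) _ n]) (use x in \<open>auto simp: G_def\<close>)
    then show "recur (of_int \<bar>k1\<bar>) m (of_int \<bar>k2\<bar>) (mellin \<phi>) (of_int x)"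
      by (subst recur_cong_Re[OF FG]) (use x in auto)
  qed
qed

text \<open>Brings (6) and (7) to the common form required by
  \<open>comm_weight_opposite_sign\<close>: the power symbol of (6) is the collapsed Gamma
  quotient.\<close>

lemma cond67_gquot:
  assumes "cond6 k1 m k2 \<phi> \<or> cond7 k1 m k2 \<phi>"
  obtains C where "k1 * k2 < 0" "\<bar>k1\<bar> = 1 \<or> \<bar>k2\<bar> = 1" "C \<noteq> 0"
    "\<And>x. x \<ge> \<bar>k2\<bar> + 1 \<Longrightarrow> mellin \<phi> (of_int x) = C * gquot (of_int \<bar>k1\<bar>) m (- of_int \<bar>k2\<bar>) (of_int x)"
  using assms
proof
  assume c: "cond7 k1 m k2 \<phi>"
  then have k: "k1 * k2 < 0" "\<bar>k2\<bar> = 1" by (auto simp: cond7_def)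
  obtain C where F: "\<And>z. Re z \<ge> 2 \<Longrightarrow> mellin \<phi> z = C * gquot (of_int \<bar>k1\<bar>) m (- of_int \<bar>k2\<bar>) z"
    using c unfolding cond7_def gquot_Gamma by (auto simp del: of_int_abs)
  have "C \<noteq> 0" by (rule C_nonzero[of 2, OF F]) simp
  moreover have "mellin \<phi> (of_int x) = C * gquot (of_int \<bar>k1\<bar>) m (- of_int \<bar>k2\<bar>) (of_int x)"
      if "x \<ge> \<bar>k2\<bar> + 1" for x
    by (rule F) (use that k in simp)
  ultimately show ?thesis using that[of C] k by blast
next
  assume c: "cond6 k1 m k2 \<phi>"
  then obtain C where k: "k1 * k2 < 0" "\<bar>k2\<bar> \<ge> 2" "m + of_int \<bar>k1\<bar> = 0"
      and ae: "AE r in unit_leb. \<phi> r = C * of_real r powi \<bar>k2\<bar>"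
    by (auto simp: cond6_def)
  have "k1 \<noteq> 0" using k by auto
  note a = exponent_bounds[OF this]
  \<comment> \<open>As m >= - 1, the equation m + |k1| = 0 with nonzero \<open>k1\<close> leaves
    only |k1| = 1 and m = - 1.\<close>
  have "real_of_int \<bar>k1\<bar> \<le> 1" using k(3) m by linarith
  then have k1: "\<bar>k1\<bar> = 1" using \<open>k1 \<noteq> 0\<close> by linarith
  have ae': "AE r in unit_leb. \<phi> r = C * of_real (r powr (of_int \<bar>k2\<bar>))"
    using ae AE_unit_nonneg by eventually_elim (use of_real_powr_powi[of _ "\<bar>k2\<bar>"] k(2) in simp)
  have Fx: "mellin \<phi> (of_real x) = C / of_real (x + of_int \<bar>k2\<bar>)" if "x > 0" for x
    by (rule mellin_of_AE_powr[OF L ae' _ that]) simp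
  \<comment> \<open>Half of \<open>C\<close>, because the collapsed quotient equals 2 / (x + |k2|)
    when |k1| = 1.\<close>
  have F: "mellin \<phi> (of_int x) = (C / 2) * gquot (of_int \<bar>k1\<bar>) m (- of_int \<bar>k2\<bar>) (of_int x)"
      if x: "x \<ge> \<bar>k2\<bar> + 1" for x
  proof -
    have xr: "real_of_int x > real_of_int \<bar>k2\<bar>" using x by linarith
    have "gquot (of_int \<bar>k1\<bar>) m (- of_int \<bar>k2\<bar>) (of_int x)
        = 2 * of_real (of_int \<bar>k1\<bar>) / (of_int x - of_real (- of_int \<bar>k2\<bar>))"
      by (rule gquot_simple[OF a(1) _ _ a(2)]) (use k xr in auto)
    also have "\<dots> = 2 / of_int (x + \<bar>k2\<bar>)" unfolding k1 by (simp del: of_int_abs)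
    finally show ?thesis using Fx[of "of_int x"] x by (simp del: of_int_abs)
  qed
  have "C / 2 \<noteq> 0"
  proof (rule C_nonzero)
    fix n :: nat assume "real_of_int \<bar>k2\<bar> + 1 < real n"
    then have "int n \<ge> \<bar>k2\<bar> + 1" by linarith
    from F[OF this] show "mellin \<phi> (of_nat n)
        = (C / 2) * gquot (of_int \<bar>k1\<bar>) m (- of_int \<bar>k2\<bar>) (of_int (int n))" by simp
  qed
  then show ?thesis using that[of "C / 2"] k k1 F by blast
qed

lemma cond67_single_weight:
  assumes "cond6 k1 m k2 \<phi> \<or> cond7 k1 m k2 \<phi>"
  obtains j0 where "k1 + k2 \<le> int j0" "int j0 = max k1 k2 - 1"
      "\<And>j. k1 + k2 \<le> int j \<Longrightarrow> j \<noteq> j0 \<Longrightarrow> D j = 0" "D j0 \<noteq> 0"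
proof -
  obtain C where c: "k1 * k2 < 0" "\<bar>k1\<bar> = 1 \<or> \<bar>k2\<bar> = 1" "C \<noteq> 0"
    "\<And>x. x \<ge> \<bar>k2\<bar> + 1 \<Longrightarrow> mellin \<phi> (of_int x) = C * gquot (of_int \<bar>k1\<bar>) m (- of_int \<bar>k2\<bar>) (of_int x)"
    using cond67_gquot[OF assms] by blast
  show ?thesis
    by (rule that[of "nat (max k1 k2 - 1)"]) (use comm_weight_opposite_sign[OF m c refl] in blast)+
qed

end

theorem theorem6p2:
  fixes k1 k2 :: int and m :: real and \<phi> :: "real \<Rightarrow> complex"
  assumes "m \<ge> - 1"
    and "T_function (\<lambda>z. \<phi> (cmod z))"
    and "\<not> (AE r in lebesgue_on {0..1}. \<phi> r = 0)"
  shows "(finite_rank (toeplitz_commutator k1 m k2 \<phi>) \<longleftrightarrow>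
            cond1 k1 m k2 \<phi> \<or> cond2 k1 m k2 \<phi> \<or> cond3 k1 m k2 \<phi> \<or> cond4 k1 m k2 \<phi> \<or>
            cond5 k1 m k2 \<phi> \<or> cond6 k1 m k2 \<phi> \<or> cond7 k1 m k2 \<phi>) \<and>
         (cond1 k1 m k2 \<phi> \<or> cond2 k1 m k2 \<phi> \<or> cond3 k1 m k2 \<phi> \<or> cond4 k1 m k2 \<phi> \<or>
            cond5 k1 m k2 \<phi> \<longrightarrow>
          op_rank (toeplitz_commutator k1 m k2 \<phi>) = 0) \<and>
         (cond6 k1 m k2 \<phi> \<or> cond7 k1 m k2 \<phi> \<longrightarrow>
          Ran (toeplitz_commutator k1 m k2 \<phi>) = fspan {monomial (max k1 k2 - 1)} \<and>
          (\<exists>C'. toeplitz_commutator k1 m k2 \<phi> =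
             op_scale C' (rank_one (monomial (max k1 k2 - 1)) (monomial (max (- k1) (- k2) - 1)))) \<and>
          op_rank (toeplitz_commutator k1 m k2 \<phi>) = 1)"
proof -
  have "radial_L1 \<phi>" using assms(2) unfolding radial_L1_def T_function_def
      by (intro radial_integrable) simp
  then interpret toeplitz_pair k1 k2 m \<phi> using assms by unfold_locales
  note T = toeplitz_commutator_wshift[OF assms(1,2), of k1 k2]
  let ?c15 = "cond1 k1 m k2 \<phi> \<or> cond2 k1 m k2 \<phi> \<or> cond3 k1 m k2 \<phi> \<or> cond4 k1 m k2 \<phi>
      \<or> cond5 k1 m k2 \<phi>"
  let ?c67 = "cond6 k1 m k2 \<phi> \<or> cond7 k1 m k2 \<phi>"
  have zero: "D j = 0" if ?c15 "k1 + k2 \<le> int j" for j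
    using that cond123_weight_zero cond4_weight_zero cond5_weight_zero by blast
  have fin: "finite_rank (toeplitz_commutator k1 m k2 \<phi>) \<longleftrightarrow> finite supp"
    unfolding T(1) by (rule finite_rank_wshift[OF T(2)])
  have "finite supp" if ?c15
  proof -
    have "supp = {}" using zero[OF that] by blast
    then show ?thesis by (simp only: finite.emptyI)
  qed
  moreover have "finite supp" if c: ?c67
  proof -
    obtain j0 where "\<And>j. k1 + k2 \<le> int j \<Longrightarrow> j \<noteq> j0 \<Longrightarrow> D j = 0" using cond67_single_weight[OF c]
        by blast
    then have "supp \<subseteq> {j0}" by blast
    then show ?thesis by (rule finite_subset) simp
  qed
  ultimately have 1: "finite_rank (toeplitz_commutator k1 m k2 \<phi>) \<longleftrightarrow> ?c15 \<or> ?c67"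
    using finite_supp_imp unfolding fin by blast
  have 2: "op_rank (toeplitz_commutator k1 m k2 \<phi>) = 0" if ?c15
    unfolding T(1) by (rule op_rank_wshift_zero) (rule zero[OF that])
  have 3: "Ran (toeplitz_commutator k1 m k2 \<phi>) = fspan {monomial (max k1 k2 - 1)} \<and>
          (\<exists>C'. toeplitz_commutator k1 m k2 \<phi> =
             op_scale C' (rank_one (monomial (max k1 k2 - 1)) (monomial (max (- k1) (- k2) - 1)))) \<and>
          op_rank (toeplitz_commutator k1 m k2 \<phi>) = 1" if c: ?c67
  proof -
    obtain j0 where j0: "k1 + k2 \<le> int j0" "int j0 = max k1 k2 - 1"
      and D0: "\<And>j. k1 + k2 \<le> int j \<Longrightarrow> j \<noteq> j0 \<Longrightarrow> D j = 0" and Dn: "D j0 \<noteq> 0"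
      using cond67_single_weight[OF c] by blast
    \<comment> \<open>The input degree is the output degree minus the total shift: max(k1, k2) - k1
      - k2 = max(- k1, - k2).\<close>
    have "int j0 - (k1 + k2) = max (- k1) (- k2) - 1" using j0(2) by auto
    then show ?thesis
      using wshift_rank_one[of "k1 + k2" j0 D, OF D0 j0(1) Dn] unfolding T(1) j0(2) by metis
  qed
  show ?thesis using 1 2 3 by blast
qed

end
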